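(* Let $T>0$ and let $a\in L_T(\mathbb{R},\mathbb{R})$. Suppose that there exist $p\in\mathbb{N}$ and $k\in\left[\frac{p^2\pi^2}{T^2},\frac{(p+1)^2\pi^2}{T^2}\right]$ such that $$k\le a(x)\ \text{ for a.e. } x,\qquad \|a\|_{L^1(0,T)}\le kT+2(p+1)\,k^{1/2}\cot\frac{k^{1/2}T}{2(p+1)}.$$ Then $\mu=0$ is in the $p$-th stability zone of the Hill's equation $$u''(x)+(\mu+a(x))u(x)=0.$$
   Context: $\mathbb{N}=\{1,2,\dots\}$. $L_T(\mathbb{R},\mathbb{R})$ is the set of $T$-periodic functions $a:\mathbb{R}\to\mathbb{R}$ with $a|_{[0,T]}\in L^1(0,T)$. Solutions are $C^1$ functions with absolutely continuous derivative satisfying the equation a.e. The equation $u''+(\mu+a(x))u=0$ is called stable if all its solutions are bounded on $\mathbb{R}$ (together with their derivatives). For $a\in L_T(\mathbb{R},\mathbb{R})$, let $\lambda_0(a)<\lambda_1(a)\le\lambda_2(a)<\lambda_3(a)\le\dots$ be the eigenvalues $\mu$ (with multiplicity) of $u''+(\mu+a(x))u=0$ on $(0,T)$ with periodic conditions $u(0)-u(T)=u'(0)-u'(T)=0$, and let $\tilde\lambda_1(a)\le\tilde\lambda_2(a)<\tilde\lambda_3(a)\le\dots$ be those with antiperiodic conditions $u(0)+u(T)=u'(0)+u'(T)=0$. They satisfy $$\lambda_0(a)<\tilde\lambda_1(a)\le\tilde\lambda_2(a)<\lambda_1(a)\le\lambda_2(a)<\tilde\lambda_3(a)\le\tilde\lambda_4(a)<\lambda_3(a)\le\dots$$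 The equation is stable for $\mu$ in each of the open intervals $(\lambda_{2n}(a),\tilde\lambda_{2n+1}(a))$ and $(\tilde\lambda_{2n+2}(a),\lambda_{2n+1}(a))$, $n\ge 0$. It is also stable at an endpoint $\mu=\lambda_{2n+1}(a)$ or $\mu=\lambda_{2n+2}(a)$ if and only if $\lambda_{2n+1}(a)=\lambda_{2n+2}(a)$, and at $\mu=\tilde\lambda_{2n+1}(a)$ or $\mu=\tilde\lambda_{2n+2}(a)$ if and only if $\tilde\lambda_{2n+1}(a)=\tilde\lambda_{2n+2}(a)$. The $p$-th stability zone is the interval with endpoints $\lambda_{2n}(a)$ and $\tilde\lambda_{2n+1}(a)$ if $p=2n$ is even, and the interval with endpoints $\tilde\lambda_{2n+2}(a)$ and $\lambda_{2n+1}(a)$ if $p=2n+1$ is odd; each endpoint is included exactly when the equation is stable for that value of $\mu$. *)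

theory Defs
  imports "HOL-Analysis.Analysis" "HOL-Library.Function_Algebras"
begin

text \<open>
  The class of \<open>T\<close>-periodic real functions whose restriction to \<open>(0,T)\<close> is Lebesgue integrable.
\<close>

definition L_per :: "real \<Rightarrow> (real \<Rightarrow> real) set" where
  "L_per T = {a. (\<forall>x. a (x + T) = a x) \<and> set_integrable lebesgue {0<..<T} a}"

definition L1_norm :: "real \<Rightarrow> (real \<Rightarrow> real) \<Rightarrow> real" where
  "L1_norm T a = (LINT x:{0<..<T}|lebesgue. \<bar>a x\<bar>)"

text \<open>
  Absolute continuity of a real function on a compact interval, in the usual
  \<open>\<epsilon>\<close>-\<open>\<delta>\<close> form. (The library constant \<open>absolutely_continuous\<close> is about measures.)
  A finite family of non-overlapping compact subintervals of \<open>S\<close> is a division \<open>d\<close> of its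
  union; the members of a division are nonempty, so \<open>Inf K\<close> and \<open>Sup K\<close> are the endpoints of \<open>K\<close>.
\<close>

definition abs_cont_on :: "real set \<Rightarrow> (real \<Rightarrow> real) \<Rightarrow> bool" where
  "abs_cont_on S f \<longleftrightarrow>
     (\<forall>\<epsilon>>0. \<exists>\<delta>>0. \<forall>d. d division_of \<Union>d \<and> \<Union>d \<subseteq> S \<and> (\<Sum>K\<in>d. Sup K - Inf K) < \<delta> \<longrightarrow>
        (\<Sum>K\<in>d. \<bar>f (Sup K) - f (Inf K)\<bar>) < \<epsilon>)"

text \<open>
  \<open>u\<close> is a solution of \<open>u'' + (\<mu> + a(x)) u = 0\<close> on the interval \<open>I\<close>, with derivative \<open>v\<close>.
  Derivatives are one-sided at endpoints belonging to \<open>I\<close>.  On an unbounded interval, absolute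
  continuity of \<open>v\<close> is understood on compact subintervals. It entails that \<open>v\<close> is continuous,
  i.e. that \<open>u\<close> is continuously differentiable.
\<close>

definition hill_solution ::
    "(real \<Rightarrow> real) \<Rightarrow> real \<Rightarrow> real set \<Rightarrow> (real \<Rightarrow> real) \<Rightarrow> (real \<Rightarrow> real) \<Rightarrow> bool" where
  "hill_solution a \<mu> I u v \<longleftrightarrow>
     (\<forall>x\<in>I. (u has_real_derivative v x) (at x within I)) \<and>
     (\<forall>s t. {s..t} \<subseteq> I \<longrightarrow> abs_cont_on {s..t} v) \<and>
     (AE x in lebesgue. x \<in> I \<longrightarrow>
        (\<exists>w. (v has_real_derivative w) (at x within I) \<and> w + (\<mu> + a x) * u x = 0))"

definition hill_stable :: "(real \<Rightarrow> real) \<Rightarrow> real \<Rightarrow> bool" where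
  "hill_stable a \<mu> \<longleftrightarrow>
     (\<forall>u v. hill_solution a \<mu> UNIV u v \<longrightarrow> bounded (range u) \<and> bounded (range v))"

text \<open>
  The boundary conditions are \<open>u(0) - \<sigma> u(T) = u'(0) - \<sigma> u'(T) = 0\<close>: periodic for \<open>\<sigma> = 1\<close>,
  antiperiodic for \<open>\<sigma> = -1\<close>.  A function on \<open>[0,T]\<close> is represented by its extension by zero, so
  that distinct elements of the eigenspace are distinct functions on \<open>[0,T]\<close>.
\<close>

definition hill_eigenspace :: "real \<Rightarrow> (real \<Rightarrow> real) \<Rightarrow> real \<Rightarrow> real \<Rightarrow> (real \<Rightarrow> real) set" where
  "hill_eigenspace T a \<sigma> \<mu> =
     {u. (\<forall>x. x \<notin> {0..T} \<longrightarrow> u x = 0) \<and>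
         (\<exists>v. hill_solution a \<mu> {0..T} u v \<and> u 0 - \<sigma> * u T = 0 \<and> v 0 - \<sigma> * v T = 0)}"

definition hill_eigenvalue :: "real \<Rightarrow> (real \<Rightarrow> real) \<Rightarrow> real \<Rightarrow> real \<Rightarrow> bool" where
  "hill_eigenvalue T a \<sigma> \<mu> \<longleftrightarrow> (\<exists>u\<in>hill_eigenspace T a \<sigma> \<mu>. u \<noteq> (\<lambda>x. 0))"

definition fun_scale :: "real \<Rightarrow> (real \<Rightarrow> real) \<Rightarrow> real \<Rightarrow> real" where
  "fun_scale c f = (\<lambda>x. c * f x)"

lemma vector_space_fun_scale: "vector_space fun_scale"
  by unfold_locales (auto simp: fun_scale_def fun_eq_iff algebra_simps)

definition hill_multiplicity :: "real \<Rightarrow> (real \<Rightarrow> real) \<Rightarrow> real \<Rightarrow> real \<Rightarrow> nat" where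
  "hill_multiplicity T a \<sigma> \<mu> = vector_space.dim fun_scale (hill_eigenspace T a \<sigma> \<mu>)"

text \<open>
  The entry with index \<open>n\<close> (counting from 0) of the nondecreasing list of all eigenvalues, each
  repeated according to its multiplicity: the least eigenvalue \<open>\<mu>\<close> for which more than \<open>n\<close>
  entries of the list are at most \<open>\<mu>\<close>.
\<close>

definition nth_eigenvalue :: "real \<Rightarrow> (real \<Rightarrow> real) \<Rightarrow> real \<Rightarrow> nat \<Rightarrow> real" where
  "nth_eigenvalue T a \<sigma> n =
     (LEAST \<mu>. hill_eigenvalue T a \<sigma> \<mu> \<and>
        n < (\<Sum>\<nu> | hill_eigenvalue T a \<sigma> \<nu> \<and> \<nu> \<le> \<mu>. hill_multiplicity T a \<sigma> \<nu>))"

text \<open>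
  The periodic eigenvalues are numbered from 0, the antiperiodic ones from 1;
  \<open>antiper_eigenvalue T a 0\<close> is not meaningful.
\<close>

definition per_eigenvalue :: "real \<Rightarrow> (real \<Rightarrow> real) \<Rightarrow> nat \<Rightarrow> real" where
  "per_eigenvalue T a n = nth_eigenvalue T a 1 n"

definition antiper_eigenvalue :: "real \<Rightarrow> (real \<Rightarrow> real) \<Rightarrow> nat \<Rightarrow> real" where
  "antiper_eigenvalue T a n = nth_eigenvalue T a (- 1) (n - 1)"

text \<open>
  For \<open>p = 2n\<close> the zone goes from \<open>\<lambda>\<^sub>2\<^sub>n\<close> to the antiperiodic eigenvalue of index \<open>2n + 1\<close>;
  for \<open>p = 2n + 1\<close> it goes from the antiperiodic eigenvalue of index \<open>2n + 2\<close> to the periodic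
  one of index \<open>2n + 1\<close>.
\<close>

definition zone_left :: "real \<Rightarrow> (real \<Rightarrow> real) \<Rightarrow> nat \<Rightarrow> real" where
  "zone_left T a p = (if even p then per_eigenvalue T a p else antiper_eigenvalue T a (p + 1))"

definition zone_right :: "real \<Rightarrow> (real \<Rightarrow> real) \<Rightarrow> nat \<Rightarrow> real" where
  "zone_right T a p = (if even p then antiper_eigenvalue T a (p + 1) else per_eigenvalue T a p)"

definition stability_zone :: "real \<Rightarrow> (real \<Rightarrow> real) \<Rightarrow> nat \<Rightarrow> real set" where
  "stability_zone T a p =
     {zone_left T a p<..<zone_right T a p} \<union>
     {\<mu> \<in> {zone_left T a p, zone_right T a p}. hill_stable a \<mu>}"

end

theory Submission
  imports Defs
begin

text \<open>
  Let \<open>w = sqrt k\<close> and write a solution in polar coordinates, \<open>(u', w u) = r (cos \<phi>, sin \<phi>)\<close>. The angle satisfies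
  a first-order equation of its own, \<open>\<phi>' = w cos\<^sup>2 \<phi> + (q / w) sin\<^sup>2 \<phi>\<close> with \<open>q = \<mu> + a\<close>. Its right-hand
  side is Lipschitz in \<open>\<phi>\<close> with an integrable constant, so it can be solved and compared although \<open>a\<close> is only
  integrable. Let \<open>rot \<mu> y\<close> be the increment over one period of the angle that starts at \<open>y\<close>, and \<open>rotmax \<mu>\<close>,
  \<open>rotmin \<mu>\<close> its extrema over \<open>y\<close>; they are continuous and strictly increasing in \<open>\<mu>\<close>, and differ by less than \<open>\<pi>\<close>.

  The monodromy map has determinant 1. A direction that turns by \<open>j \<pi>\<close> consists of eigenvectors, whose eigenvalue
  is \<open>(-1) ^ j\<close> exactly when \<open>j \<pi>\<close> is one of the two extrema; if both are, the map is \<open>(-1) ^ j\<close> times the identity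
  (\<open>growth_eq_1_iff_extremal\<close>, \<open>multiplicity_eq_card_entry\<close>). Counting the multiples of \<open>\<pi>\<close> that the extrema have
  passed therefore counts eigenvalues with multiplicity, and the \<open>p\<close>-th stability zone begins where \<open>rotmin\<close>
  reaches \<open>p \<pi>\<close> and ends where \<open>rotmax\<close> reaches \<open>(p + 1) \<pi>\<close> (\<open>zone_left_eq\<close>, \<open>zone_right_eq\<close>).

  It remains to locate \<open>rotmin 0\<close> and \<open>rotmax 0\<close>. As \<open>a \<ge> w\<^sup>2\<close>, every angle moves with speed at least \<open>w\<close>, so
  \<open>rotmin 0 \<ge> w T \<ge> p \<pi>\<close>, with equality only if \<open>a = w\<^sup>2\<close> almost everywhere. If \<open>rotmax 0 \<ge> (p + 1) \<pi>\<close>, then some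
  solution makes \<open>2 (p + 1)\<close> quarter turns within a period. A quarter turn of duration \<open>l\<close> costs
  \<open>\<integral> (a - w\<^sup>2) \<ge> w cot (w l)\<close> (\<open>quarter_turn_bound\<close>), so convexity of the cotangent makes the total cost at least
  the excess allowed by the hypothesis on the norm. Hence equality holds throughout, and it forces \<open>a = w\<^sup>2\<close>
  (\<open>constant_if_maximal_rotation\<close>). So 0 is interior to the zone unless \<open>a\<close> is constant almost everywhere; in that
  case the equation at 0 is that of the harmonic oscillator, which is stable, and an endpoint at 0 belongs to the zone.
\<close>

section \<open>Absolutely continuous functions and their derivatives\<close>

abbreviation total_length :: "real set set \<Rightarrow> real" where
  "total_length d \<equiv> \<Sum>K\<in>d. Sup K - Inf K"

abbreviation variation :: "(real \<Rightarrow> real) \<Rightarrow> real set set \<Rightarrow> real" where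
  "variation f d \<equiv> \<Sum>K\<in>d. \<bar>f (Sup K) - f (Inf K)\<bar>"

lemma division_of_real_interval:
  fixes d :: "real set set"
  assumes "d division_of S" "K \<in> d"
  obtains s t where "s \<le> t" "K = {s..t}" "Inf K = s" "Sup K = t" "s \<in> S" "t \<in> S"
proof -
  obtain s t where K: "K = cbox s t" and ne: "K \<noteq> {}" and sub: "K \<subseteq> S"
    using division_ofD[OF assms(1)] assms(2) by metis
  then have st: "s \<le> t" by auto
  show thesis
    by (rule that[of s t]) (use K st sub in \<open>auto simp: cInf_atLeastAtMost cSup_atLeastAtMost\<close>)
qed

lemma abs_cont_on_subset:
  assumes "abs_cont_on S f" "T \<subseteq> S"
  shows "abs_cont_on T f"
  using assms unfolding abs_cont_on_def by (meson order_trans)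

lemma abs_cont_on_imp_continuous_on:
  assumes "abs_cont_on {A..B} f"
  shows "continuous_on {A..B} f"
  unfolding continuous_on_iff
proof (intro ballI allI impI)
  fix x e :: real
  assume x: "x \<in> {A..B}" and "e > 0"
  then obtain \<delta> where "\<delta> > 0" and \<delta>: "\<And>d. d division_of \<Union>d \<Longrightarrow> \<Union>d \<subseteq> {A..B} \<Longrightarrow> total_length d < \<delta>
      \<Longrightarrow> variation f d < e"
    using assms unfolding abs_cont_on_def by meson
  have "dist (f y) (f x) < e" if y: "y \<in> {A..B}" "dist y x < \<delta>" for y
  proof -
    define s t where "s = min x y" and "t = max x y"
    have st: "s \<le> t" "{s..t} \<subseteq> {A..B}" "t - s < \<delta>"
      using x y by (auto simp: s_def t_def dist_real_def)
    have "{{s..t}} division_of {s..t}"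
      using division_of_self[of s t] st(1) by (simp add: cbox_interval)
    then have "\<bar>f t - f s\<bar> < e"
      using \<delta>[of "{{s..t}}"] st by (simp add: cInf_atLeastAtMost cSup_atLeastAtMost)
    then show ?thesis
      by (auto simp: s_def t_def dist_real_def min_def max_def split: if_splits)
  qed
  then show "\<exists>d>0. \<forall>x'\<in>{A..B}. dist x' x < d \<longrightarrow> dist (f x') (f x) < e"
    using \<open>\<delta> > 0\<close> by blast
qed

text \<open>
  One estimate for both kinds of combination in use: sums, with \<open>C = 1\<close>, and Lipschitz functions of
  one absolutely continuous function, with \<open>f = g\<close>.
\<close>

lemma abs_cont_on_comp_lipschitz2:
  assumes f: "abs_cont_on {A..B} f" and g: "abs_cont_on {A..B} g" and C: "C \<ge> 0"
    and lip: "\<And>x y. x \<in> {A..B} \<Longrightarrow> y \<in> {A..B} \<Longrightarrow> \<bar>h x - h y\<bar> \<le> C * \<bar>f x - f y\<bar> + C * \<bar>g x - g y\<bar>"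
  shows "abs_cont_on {A..B} h"
  unfolding abs_cont_on_def
proof (intro allI impI)
  fix e :: real
  assume "e > 0"
  define e' where "e' = e / (2 * (C + 1))"
  have "e' > 0" using \<open>e > 0\<close> C by (simp add: e'_def)
  obtain \<delta>1 where "\<delta>1 > 0" and \<delta>1: "\<And>d. d division_of \<Union>d \<Longrightarrow> \<Union>d \<subseteq> {A..B} \<Longrightarrow> total_length d < \<delta>1 \<Longrightarrow> variation f d < e'"
      using f \<open>e' > 0\<close> unfolding abs_cont_on_def by meson
  obtain \<delta>2 where "\<delta>2 > 0" and \<delta>2: "\<And>d. d division_of \<Union>d \<Longrightarrow> \<Union>d \<subseteq> {A..B} \<Longrightarrow> total_length d < \<delta>2 \<Longrightarrow> variation g d < e'"
      using g \<open>e' > 0\<close> unfolding abs_cont_on_def by meson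
  show "\<exists>\<delta>>0. \<forall>d. d division_of \<Union>d \<and> \<Union>d \<subseteq> {A..B} \<and> total_length d < \<delta> \<longrightarrow>
      variation h d < e"
  proof (intro exI[of _ "min \<delta>1 \<delta>2"] conjI allI impI)
    show "0 < min \<delta>1 \<delta>2" using \<open>\<delta>1 > 0\<close> \<open>\<delta>2 > 0\<close> by simp
    fix d :: "real set set"
    assume d: "d division_of \<Union>d \<and> \<Union>d \<subseteq> {A..B} \<and> total_length d < min \<delta>1 \<delta>2"
    have "variation h d
        \<le> (\<Sum>K\<in>d. C * \<bar>f (Sup K) - f (Inf K)\<bar> + C * \<bar>g (Sup K) - g (Inf K)\<bar>)"
    proof (rule sum_mono)
      fix K assume "K \<in> d"
      then obtain s t where "Inf K = s" "Sup K = t" "s \<in> \<Union>d" "t \<in> \<Union>d"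
        using division_of_real_interval d by metis
      then show "\<bar>h (Sup K) - h (Inf K)\<bar> \<le> C * \<bar>f (Sup K) - f (Inf K)\<bar> + C * \<bar>g (Sup K) - g (Inf K)\<bar>"
        using lip d by (metis subsetD)
    qed
    also have "\<dots> = C * (variation f d + variation g d)"
      by (simp add: sum.distrib sum_distrib_left distrib_left)
    also have "\<dots> \<le> C * (e' + e')"
      using \<delta>1[of d] \<delta>2[of d] d C by (intro mult_left_mono add_mono) auto
    also have "\<dots> < (C + 1) * (e' + e')"
      using \<open>e' > 0\<close> by (simp add: distrib_right)
    also have "\<dots> = 2 * (C + 1) * e'" by (simp add: algebra_simps)
    also have "\<dots> = e" using C by (simp add: e'_def)
    finally show "variation h d < e" .
  qed
qed

text \<open>
  The almost everywhere derivative is a separate argument, so that sums, products and compositions can be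
  differentiated with no condition of integrability.
\<close>

definition ac_deriv :: "real \<Rightarrow> real \<Rightarrow> (real \<Rightarrow> real) \<Rightarrow> (real \<Rightarrow> real) \<Rightarrow> bool" where
  "ac_deriv A B f f' \<longleftrightarrow> abs_cont_on {A..B} f \<and>
     (AE x\<in>{A..B} in lebesgue. (f has_real_derivative f' x) (at x within {A..B}))"

lemma ac_derivD:
  "ac_deriv A B f f' \<Longrightarrow> AE x\<in>{A..B} in lebesgue. (f has_real_derivative f' x) (at x within {A..B})"
  by (simp add: ac_deriv_def)

lemma ac_deriv_continuous: "ac_deriv A B f f' \<Longrightarrow> continuous_on {A..B} f"
  by (simp add: ac_deriv_def abs_cont_on_imp_continuous_on)

lemma ac_deriv_subinterval:
  assumes "ac_deriv A B f f'" "A \<le> A'" "B' \<le> B"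
  shows "ac_deriv A' B' f f'"
proof -
  have sub: "{A'..B'} \<subseteq> {A..B}" using assms by auto
  from ac_derivD[OF assms(1)] have "AE x\<in>{A'..B'} in lebesgue. (f has_real_derivative f' x) (at x within {A'..B'})"
    by eventually_elim (use sub in \<open>auto intro: DERIV_subset\<close>)
  then show ?thesis
    using assms sub abs_cont_on_subset by (auto simp: ac_deriv_def)
qed

lemma ac_deriv_AE_cong:
  assumes "ac_deriv A B f f'" "AE x\<in>{A..B} in lebesgue. f' x = g' x"
  shows "ac_deriv A B f g'"
proof -
  from ac_derivD[OF assms(1)] have "AE x\<in>{A..B} in lebesgue. (f has_real_derivative g' x) (at x within {A..B})"
    using assms(2) by eventually_elim auto
  then show ?thesis using assms by (simp add: ac_deriv_def)
qed

lemma ac_deriv_cong: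
  assumes "ac_deriv A B f f'" "\<And>x. x \<in> {A..B} \<Longrightarrow> f x = g x" "\<And>x. x \<in> {A..B} \<Longrightarrow> f' x = g' x"
  shows "ac_deriv A B g g'"
proof -
  have "abs_cont_on {A..B} g"
    using assms by (intro abs_cont_on_comp_lipschitz2[of A B f f 1 g]) (auto simp: ac_deriv_def)
  moreover from ac_derivD[OF assms(1)] have "AE x\<in>{A..B} in lebesgue. (g has_real_derivative g' x) (at x within {A..B})"
  proof eventually_elim
    case (elim x)
    then show ?case
      using assms(2,3) has_field_derivative_transform_within[of f "f' x" x "{A..B}" 1 g] by auto
  qed
  ultimately show ?thesis by (simp add: ac_deriv_def)
qed

text \<open>
  The range of \<open>f\<close> is compact, and a continuously differentiable function is Lipschitz on compact intervals.
\<close>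

lemma ac_deriv_comp:
  assumes f: "ac_deriv A B f f'" and h: "\<And>y. (h has_real_derivative h' y) (at y)"
    and h': "continuous_on UNIV h'"
  shows "ac_deriv A B (\<lambda>x. h (f x)) (\<lambda>x. h' (f x) * f' x)"
proof -
  have "compact (f ` {A..B})"
    using ac_deriv_continuous[OF f] by (intro compact_continuous_image) auto
  then obtain b where b: "\<And>x. x \<in> {A..B} \<Longrightarrow> \<bar>f x\<bar> \<le> b"
    by (metis bounded_iff compact_imp_bounded image_eqI real_norm_def)
  have "compact (h' ` {-b..b})"
    using h' by (intro compact_continuous_image) (auto intro: continuous_on_subset)
  then obtain C where C: "\<And>y. y \<in> {-b..b} \<Longrightarrow> \<bar>h' y\<bar> \<le> C"
    by (metis bounded_iff compact_imp_bounded image_eqI real_norm_def)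
  have lip: "\<bar>h (f x) - h (f y)\<bar> \<le> max C 0 * \<bar>f x - f y\<bar> + max C 0 * \<bar>f x - f y\<bar>"
    if "x \<in> {A..B}" "y \<in> {A..B}" for x y
  proof -
    have "norm (h (f x) - h (f y)) \<le> max C 0 * norm (f x - f y)"
    proof (rule field_differentiable_bound[where S="{-b..b}" and f'=h'])
      show "(h has_field_derivative h' z) (at z within {- b..b})" for z
        using h has_field_derivative_at_within by blast
      show "norm (h' z) \<le> max C 0" if "z \<in> {-b..b}" for z
        using C[OF that] by simp
    qed (use b[OF that(1)] b[OF that(2)] in auto)
    moreover have "0 \<le> max C 0 * \<bar>f x - f y\<bar>" by simp
    ultimately show ?thesis unfolding real_norm_def by linarith
  qed
  have "abs_cont_on {A..B} (\<lambda>x. h (f x))"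
    using f by (intro abs_cont_on_comp_lipschitz2[OF _ _ _ lip]) (auto simp: ac_deriv_def)
  moreover from ac_derivD[OF f] have "AE x\<in>{A..B} in lebesgue.
      ((\<lambda>x. h (f x)) has_real_derivative h' (f x) * f' x) (at x within {A..B})"
    by eventually_elim (use h in \<open>blast intro: DERIV_chain2\<close>)
  ultimately show ?thesis by (simp add: ac_deriv_def)
qed

lemma ac_deriv_add:
  assumes f: "ac_deriv A B f f'" and g: "ac_deriv A B g g'"
  shows "ac_deriv A B (\<lambda>x. f x + g x) (\<lambda>x. f' x + g' x)"
proof -
  have "abs_cont_on {A..B} (\<lambda>x. f x + g x)"
  proof (rule abs_cont_on_comp_lipschitz2[of A B f g 1])
    show "\<bar>f x + g x - (f y + g y)\<bar> \<le> 1 * \<bar>f x - f y\<bar> + 1 * \<bar>g x - g y\<bar>" for x y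
      using abs_triangle_ineq[of "f x - f y" "g x - g y"] by (simp add: algebra_simps)
  qed (use f g in \<open>simp_all add: ac_deriv_def\<close>)
  moreover from ac_derivD[OF f] ac_derivD[OF g] have "AE x\<in>{A..B} in lebesgue.
      ((\<lambda>x. f x + g x) has_real_derivative f' x + g' x) (at x within {A..B})"
    by eventually_elim (blast intro: DERIV_add)
  ultimately show ?thesis by (simp add: ac_deriv_def)
qed

lemma ac_deriv_cmult:
  assumes f: "ac_deriv A B f f'"
  shows "ac_deriv A B (\<lambda>x. c * f x) (\<lambda>x. c * f' x)"
  using ac_deriv_comp[OF f, of "\<lambda>y. c * y" "\<lambda>_. c"] by (auto intro!: derivative_eq_intros)

lemma ac_deriv_diff:
  assumes f: "ac_deriv A B f f'" and g: "ac_deriv A B g g'"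
  shows "ac_deriv A B (\<lambda>x. f x - g x) (\<lambda>x. f' x - g' x)"
  using ac_deriv_add[OF f ac_deriv_cmult[OF g, of "-1"]] by simp

text \<open>Polarisation reduces the product rule to the chain rule for the square.\<close>

lemma ac_deriv_mult:
  assumes f: "ac_deriv A B f f'" and g: "ac_deriv A B g g'"
  shows "ac_deriv A B (\<lambda>x. f x * g x) (\<lambda>x. f' x * g x + f x * g' x)"
proof -
  have sq: "ac_deriv A B (\<lambda>x. (h x)\<^sup>2) (\<lambda>x. (2 * h x) * h' x)" if "ac_deriv A B h h'" for h h'
    by (rule ac_deriv_comp[OF that, of "\<lambda>y. y\<^sup>2" "\<lambda>y. 2 * y"])
      (auto intro!: derivative_eq_intros continuous_intros)
  have "ac_deriv A B (\<lambda>x. (1/4) * ((f x + g x)\<^sup>2 - (f x - g x)\<^sup>2))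
     (\<lambda>x. (1/4) * ((2 * (f x + g x)) * (f' x + g' x) - (2 * (f x - g x)) * (f' x - g' x)))"
    by (intro ac_deriv_cmult ac_deriv_diff sq ac_deriv_add f g)
  then show ?thesis
    by (rule ac_deriv_cong) (auto simp: algebra_simps power2_eq_square)
qed

lemma ac_deriv_id: "ac_deriv A B (\<lambda>x. x) (\<lambda>_. 1)"
  unfolding ac_deriv_def abs_cont_on_def
proof (intro conjI allI impI)
  fix e :: real assume "e > 0"
  have "variation (\<lambda>x. x) d < e" if d: "d division_of \<Union>d" "total_length d < e" for d :: "real set set"
  proof -
    have "variation (\<lambda>x. x) d = total_length d"
      by (intro sum.cong refl) (metis d(1) abs_of_nonneg diff_ge_0_iff_ge division_of_real_interval)
    with d show ?thesis by simp
  qed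
  then show "\<exists>\<delta>>0. \<forall>d. d division_of \<Union>d \<and> \<Union>d \<subseteq> {A..B} \<and> total_length d < \<delta> \<longrightarrow>
      variation (\<lambda>x. x) d < e" using \<open>e > 0\<close> by blast
qed auto

lemma ac_deriv_of_C1:
  assumes "\<And>y. (h has_real_derivative h' y) (at y)" "continuous_on UNIV h'"
  shows "ac_deriv A B h h'"
  using ac_deriv_comp[OF ac_deriv_id assms] by simp

text \<open>
  A Henstock--Kurzweil argument: a fine tagged division of \<open>[A,B]\<close> splits the increment of \<open>f\<close> into
  parts tagged where the derivative exists, which lose at most \<open>\<epsilon>\<close> times their length,
  and parts tagged in the exceptional null set, which absolute continuity makes negligible.
\<close>

lemma ac_deriv_nonneg_imp_le:
  assumes f: "ac_deriv A B f f'" and AB: "A \<le> B"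
    and pos: "AE x\<in>{A..B} in lebesgue. f' x \<ge> 0"
  shows "f A \<le> f B"
proof -
  define good where "good x \<longleftrightarrow> (f has_real_derivative f' x) (at x within {A..B}) \<and> f' x \<ge> 0" for x
  have "AE x\<in>{A..B} in lebesgue. good x"
    using f pos unfolding ac_deriv_def good_def by auto
  then obtain N where N: "N \<in> null_sets lebesgue" "{x \<in> space lebesgue. \<not> (x \<in> {A..B} \<longrightarrow> good x)} \<subseteq> N"
    by (rule AE_E3) auto
  then have good: "good x" if "x \<in> {A..B}" "x \<notin> N" for x using that by auto
  have *: "f A \<le> f B + e * (1 + (B - A))" if "e > 0" for e
  proof -
    obtain \<delta> where "\<delta> > 0" and \<delta>: "\<And>d. d division_of \<Union>d \<Longrightarrow> \<Union>d \<subseteq> {A..B} \<Longrightarrow> total_length d < \<delta> \<Longrightarrow> variation f d < e"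
      using f \<open>e > 0\<close> unfolding ac_deriv_def abs_cont_on_def by meson
    obtain U where U: "open U" "N \<subseteq> U" "U - N \<in> lmeasurable" "emeasure lebesgue (U - N) < ennreal \<delta>"
      using sets_lebesgue_outer_open[of N \<delta>] N \<open>\<delta> > 0\<close> by blast
    have Ueq: "U = (U - N) \<union> N" using U by blast
    have Um: "U \<in> lmeasurable"
      by (subst Ueq) (intro fmeasurable.Un U(3) fmeasurableI_null_sets N(1))
    have "emeasure lebesgue U < ennreal \<delta>"
      using U(4) emeasure_Diff_null_set[OF N(1), of U] Um by auto
    then have mU: "measure lebesgue U < \<delta>"
      using Um by (simp add: emeasure_eq_measure2 ennreal_less_iff)
    have "\<exists>r>0. (x \<in> U \<inter> N \<longrightarrow> ball x r \<subseteq> U) \<and>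
        (x \<in> {A..B} - N \<longrightarrow> (\<forall>y\<in>{A..B}. \<bar>y - x\<bar> < r \<longrightarrow> \<bar>f y - f x - f' x * (y - x)\<bar> \<le> e * \<bar>y - x\<bar>))" for x
    proof (cases "x \<in> N")
      case True
      then have "x \<in> U" using U by auto
      then obtain r where "r > 0" "ball x r \<subseteq> U" using U openE by blast
      then show ?thesis using True by auto
    next
      case False
      show ?thesis
      proof (cases "x \<in> {A..B}")
        case True
        then have "(f has_derivative (\<lambda>h. f' x * h)) (at x within {A..B})"
          using False good[of x] unfolding good_def has_field_derivative_def by auto
        then obtain r where "r > 0"
          "\<forall>y\<in>{A..B}. norm (y - x) < r \<longrightarrow> norm (f y - f x - f' x * (y - x)) \<le> e * norm (y - x)"
          using \<open>e > 0\<close> unfolding has_derivative_within_alt by metis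
        then show ?thesis using False by auto
      next
        case False
        with \<open>x \<notin> N\<close> show ?thesis by (intro exI[of _ 1]) auto
      qed
    qed
    then obtain r where r: "\<And>x. r x > 0" "\<And>x. x \<in> U \<inter> N \<Longrightarrow> ball x (r x) \<subseteq> U"
      "\<And>x y. x \<in> {A..B} - N \<Longrightarrow> y \<in> {A..B} \<Longrightarrow> \<bar>y - x\<bar> < r x \<Longrightarrow> \<bar>f y - f x - f' x * (y - x)\<bar> \<le> e * \<bar>y - x\<bar>"
      by metis
    have "gauge (\<lambda>x. ball x (r x))" using r by (auto simp: gauge_def)
    then obtain p where p: "p tagged_division_of cbox A B" "(\<lambda>x. ball x (r x)) fine p"
      using fine_division_exists by blast
    have finp: "finite p" using p by blast
    have p': "p tagged_division_of {A..B}" using p by (simp add: cbox_interval)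
    \<comment> \<open>The supremum and infimum of the empty set are unspecified.\<close>
    define inc where "inc K = (if K = {} then 0 else f (Sup K) - f (Inf K))" for K :: "real set"
    have "(\<Sum>(x,K)\<in>p. inc K) = (\<Sum>(x,K)\<in>p. f (Sup K) - f (Inf K))"
      by (rule sum.cong) (use tagged_division_ofD(2)[OF p(1)] in \<open>force simp: inc_def\<close>)+
    then have total: "f B - f A = (\<Sum>(x,K)\<in>p. inc K)"
      using additive_tagged_division_1[OF AB p', of f] by simp
    have len: "B - A = (\<Sum>(x,K)\<in>p. Sup K - Inf K)"
      using additive_tagged_division_1[OF AB p', of "\<lambda>x. x"] by simp
    define p1 where "p1 = {(x,K). (x,K) \<in> p \<and> x \<in> N}"
    have p1: "p1 \<subseteq> p" by (auto simp: p1_def)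
    have fin1: "finite p1" using p1 finp finite_subset by blast
    have K: "\<exists>s t. s \<le> t \<and> K = {s..t} \<and> Inf K = s \<and> Sup K = t \<and> s \<in> {A..B} \<and> t \<in> {A..B} \<and> s \<le> x \<and> x \<le> t \<and> x \<in> {A..B}"
      if xK: "(x,K) \<in> p" for x K
    proof -
      obtain s t where st: "K = cbox s t" "x \<in> K" "K \<subseteq> cbox A B"
        using p(1) xK by (meson tagged_division_ofD)
      then have "s \<le> t" by auto
      then show ?thesis using st
        by (intro exI[of _ s] exI[of _ t]) (auto simp: cInf_atLeastAtMost cSup_atLeastAtMost)
    qed
    have good_part: "- e * (Sup K - Inf K) \<le> inc K" if xK: "(x,K) \<in> p - p1" for x K
    proof -
      obtain s t where st: "s \<le> t" "K = {s..t}" "Inf K = s" "Sup K = t" "s \<in> {A..B}" "t \<in> {A..B}" "s \<le> x" "x \<le> t" "x \<in> {A..B}"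
        using K xK by blast
      have "x \<notin> N" using xK by (auto simp: p1_def)
      then have "f' x \<ge> 0" using good[of x] st by (simp add: good_def)
      have "K \<subseteq> ball x (r x)" using p(2) xK by (auto simp: fine_def)
      moreover have "s \<in> K" "t \<in> K" using st by auto
      ultimately have "\<bar>s - x\<bar> < r x" "\<bar>t - x\<bar> < r x" by (auto simp: dist_real_def abs_minus_commute)
      then have "\<bar>f s - f x - f' x * (s - x)\<bar> \<le> e * \<bar>s - x\<bar>" "\<bar>f t - f x - f' x * (t - x)\<bar> \<le> e * \<bar>t - x\<bar>"
        using r(3) st \<open>x \<notin> N\<close> by blast+
      moreover have "e * \<bar>s - x\<bar> = e * (x - s)" "e * \<bar>t - x\<bar> = e * (t - x)" using st by auto
      moreover have "f' x * (t - x) \<ge> 0" "f' x * (s - x) \<le> 0"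
        using \<open>f' x \<ge> 0\<close> st by (auto simp: mult_nonneg_nonpos)
      moreover have "inc K = f t - f s" using st by (simp add: inc_def)
      ultimately show ?thesis unfolding st(3,4) by (simp add: algebra_simps abs_le_iff)
    qed
    have bad_part: "(\<Sum>(x,K)\<in>p1. \<bar>inc K\<bar>) < e"
    proof -
      define d where "d = snd ` p1"
      have td: "p1 tagged_division_of \<Union>d"
        using tagged_partial_division_of_Union_self[OF tagged_partial_division_subset[OF _ p1, of "cbox A B"]] p(1)
        by (auto simp: d_def tagged_division_of_def)
      then have dd: "d division_of \<Union>d" unfolding d_def using division_of_tagged_division by blast
      have dsub: "\<Union>d \<subseteq> {A..B}"
      proof
        fix y assume "y \<in> \<Union>d"
        then obtain x K where xK: "(x,K) \<in> p" "y \<in> K" using p1 by (auto simp: d_def)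
        then obtain s t where "K = {s..t}" "s \<in> {A..B}" "t \<in> {A..B}" using K[OF xK(1)] by blast
        with xK show "y \<in> {A..B}" by auto
      qed
      have dU: "\<Union>d \<subseteq> U"
      proof
        fix y assume "y \<in> \<Union>d"
        then obtain x K where xK: "(x,K) \<in> p1" "y \<in> K" by (auto simp: d_def)
        then have "K \<subseteq> ball x (r x)" "x \<in> N" using p(2) p1 by (auto simp: fine_def p1_def)
        then show "y \<in> U" using r(2)[of x] U(2) xK by auto
      qed
      have "total_length d = (\<Sum>K\<in>d. measure lebesgue K)"
      proof (rule sum.cong[OF refl])
        fix K assume "K \<in> d"
        then obtain s t where "s \<le> t" "K = {s..t}" "Inf K = s" "Sup K = t"
          using division_of_real_interval dd by metis
        then show "Sup K - Inf K = measure lebesgue K" by simp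
      qed
      also have "\<dots> = measure lebesgue (\<Union>d)"
        using content_division[OF dd] by simp
      also have "\<dots> \<le> measure lebesgue U"
        using dU Um dd by (intro measure_mono_fmeasurable) (auto intro: lmeasurable_division fmeasurableD)
      also note mU
      finally have "variation f d < e" using \<delta> dd dsub by blast
      moreover have "(\<Sum>K\<in>d. \<bar>inc K\<bar>) = variation f d"
        by (rule sum.cong) (use division_ofD(3)[OF dd] in \<open>auto simp: inc_def\<close>)
      ultimately have "(\<Sum>K\<in>d. \<bar>inc K\<bar>) < e" by simp
      moreover have "(\<Sum>(x,K)\<in>p1. \<bar>inc K\<bar>) = (\<Sum>K\<in>d. \<bar>inc K\<bar>)" unfolding d_def
      proof (rule sum.over_tagged_division_lemma[OF td])
        fix u v :: real assume "box u v = {}"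
        then have "u \<ge> v" by simp
        then show "\<bar>inc (cbox u v)\<bar> = 0"
          by (cases "u = v") (auto simp: inc_def)
      qed
      ultimately show ?thesis by simp
    qed
    have "f B - f A = (\<Sum>(x,K)\<in>p1. inc K) + (\<Sum>(x,K)\<in>p-p1. inc K)"
      unfolding total by (subst sum.subset_diff[OF p1 finp]) simp
    moreover have "(\<Sum>(x,K)\<in>p1. inc K) \<ge> - (\<Sum>(x,K)\<in>p1. \<bar>inc K\<bar>)"
      unfolding sum_negf[symmetric] by (intro sum_mono) auto
    moreover have "(\<Sum>(x,K)\<in>p-p1. inc K) \<ge> (\<Sum>(x,K)\<in>p-p1. - e * (Sup K - Inf K))"
      by (intro sum_mono) (use good_part in auto)
    moreover have "(\<Sum>(x,K)\<in>p-p1. - e * (Sup K - Inf K)) = - e * (\<Sum>(x,K)\<in>p-p1. Sup K - Inf K)"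
      by (simp add: sum_distrib_left case_prod_unfold)
    moreover have "e * (\<Sum>(x,K)\<in>p-p1. Sup K - Inf K) \<le> e * (B - A)"
      unfolding len using \<open>e > 0\<close> finp K by (intro mult_left_mono sum_mono2) fastforce+
    ultimately show ?thesis using bad_part by (simp add: algebra_simps)
  qed
  show ?thesis
  proof (rule field_le_epsilon)
    fix e :: real assume "e > 0"
    then have "e / (1 + (B - A)) > 0" using AB by simp
    from *[OF this] show "f A \<le> f B + e" using AB by simp
  qed
qed

lemma ac_deriv_nonneg_imp_mono:
  assumes f: "ac_deriv A B f f'" and pos: "AE x\<in>{A..B} in lebesgue. f' x \<ge> 0"
    and "A \<le> x" "x \<le> y" "y \<le> B"
  shows "f x \<le> f y"
proof (rule ac_deriv_nonneg_imp_le[of x y f f'])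
  show "ac_deriv x y f f'" using ac_deriv_subinterval assms by blast
  show "AE z in lebesgue. z \<in> {x..y} \<longrightarrow> f' z \<ge> 0"
    using pos by eventually_elim (use assms in auto)
qed (use assms in auto)

lemma ac_deriv_zero_imp_const:
  assumes f: "ac_deriv A B f f'" and z: "AE x\<in>{A..B} in lebesgue. f' x = 0"
    and x: "x \<in> {A..B}"
  shows "f x = f A"
proof (rule antisym)
  show "f A \<le> f x"
    using x by (intro ac_deriv_nonneg_imp_mono[OF f]) (use z in auto)
  have "AE x\<in>{A..B} in lebesgue. 0 \<le> - 1 * f' x"
    using z by eventually_elim auto
  then have "- 1 * f A \<le> - 1 * f x"
    using x by (intro ac_deriv_nonneg_imp_mono[OF ac_deriv_cmult[OF f]]) auto
  then show "f x \<le> f A" by simp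
qed

text \<open>A singleton has no limit point of itself, whence the requirement that the interval be nondegenerate.\<close>

lemma ac_deriv_const_imp_zero:
  assumes f: "ac_deriv A B f f'" and "A < B" and c: "\<And>x. x \<in> {A..B} \<Longrightarrow> f x = c"
  shows "AE x\<in>{A..B} in lebesgue. f' x = 0"
proof -
  from ac_derivD[OF f] show ?thesis
  proof eventually_elim
    case (elim x)
    show ?case
    proof
      assume x: "x \<in> {A..B}"
      have "((\<lambda>_. c) has_real_derivative 0) (at x within {A..B})" by simp
      then have "(f has_real_derivative 0) (at x within {A..B})"
        by (rule has_field_derivative_transform_within[of _ _ _ _ 1]) (use x c in auto)
      moreover have "at x within {A..B} \<noteq> bot"
        using x \<open>A < B\<close> by (simp add: trivial_limit_within islimpt_Icc)
      ultimately show "f' x = 0"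
        using elim x by (metis has_field_derivative_unique)
    qed
  qed
qed

text \<open>
  Equality cases of integral inequalities are decided by this lemma: a monotone function with equal values at
  the endpoints is constant.
\<close>

lemma ac_deriv_nonneg_eq_imp_zero:
  assumes f: "ac_deriv A B f f'" and pos: "AE x\<in>{A..B} in lebesgue. f' x \<ge> 0"
    and "A < B" and "f B \<le> f A"
  shows "AE x\<in>{A..B} in lebesgue. f' x = 0"
proof (rule ac_deriv_const_imp_zero[OF f \<open>A < B\<close>])
  fix x assume x: "x \<in> {A..B}"
  have "f A \<le> f x" "f x \<le> f B"
    using x by (auto intro!: ac_deriv_nonneg_imp_mono[OF f pos])
  with assms show "f x = f A" by simp
qed

section \<open>Indefinite integrals and translations\<close>

text \<open>
  Absolute continuity of the indefinite integral is seen by splitting \<open>\<bar>g\<bar>\<close> into a bounded part and a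
  part of small integral; its a.e. differentiability is Lebesgue's theorem, applied to
  \<open>g\<close> for right derivatives and to the reflection of \<open>g\<close> for left derivatives.
\<close>

lemma abs_cont_on_integral:
  fixes g :: "real \<Rightarrow> real"
  assumes g: "g absolutely_integrable_on {A..B}"
  shows "abs_cont_on {A..B} (\<lambda>x. integral {A..x} g)"
  unfolding abs_cont_on_def
proof (intro allI impI)
  fix e :: real
  assume "e > 0"
  have gi: "g integrable_on {A..B}" and ga: "(\<lambda>x. \<bar>g x\<bar>) integrable_on {A..B}"
    using g by (auto simp: absolutely_integrable_on_def)
  have mi: "(\<lambda>x. min \<bar>g x\<bar> (real k)) integrable_on {A..B}" for k
  proof -
    have "(\<lambda>x. \<bar>g x\<bar>) absolutely_integrable_on {A..B}"
      using ga by (intro nonnegative_absolutely_integrable_1) auto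
    moreover have "(\<lambda>x. real k) absolutely_integrable_on {A..B}"
      by (intro absolutely_integrable_continuous_real) auto
    ultimately have "(\<lambda>x. min \<bar>g x\<bar> (real k)) absolutely_integrable_on {A..B}"
      by (rule absolutely_integrable_min_1)
    then show ?thesis by (simp add: absolutely_integrable_on_def)
  qed
  have "(\<lambda>k. integral {A..B} (\<lambda>x. min \<bar>g x\<bar> (real k))) \<longlonglongrightarrow> integral {A..B} (\<lambda>x. \<bar>g x\<bar>)"
  proof (rule dominated_convergence(2)[OF mi ga])
    show "(\<lambda>k. min \<bar>g x\<bar> (real k)) \<longlonglongrightarrow> \<bar>g x\<bar>" for x
    proof (rule tendsto_eventually)
      obtain N where "\<bar>g x\<bar> \<le> real N" using real_arch_simple by blast
      then show "\<forall>\<^sub>F k in sequentially. min \<bar>g x\<bar> (real k) = \<bar>g x\<bar>"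
        by (intro eventually_sequentiallyI[of N]) (auto simp: min_def)
    qed
  qed auto
  then obtain n where n: "\<bar>integral {A..B} (\<lambda>x. min \<bar>g x\<bar> (real n)) - integral {A..B} (\<lambda>x. \<bar>g x\<bar>)\<bar> < e/2"
    using \<open>e > 0\<close> by (metis LIMSEQ_D half_gt_zero order_refl real_norm_def)
  define h where "h x = \<bar>g x\<bar> - min \<bar>g x\<bar> (real n)" for x
  have hi: "h integrable_on {A..B}" unfolding h_def by (intro integrable_diff ga mi)
  have h0: "h x \<ge> 0" for x by (simp add: h_def)
  have hint: "integral {A..B} h < e/2"
    using n Henstock_Kurzweil_Integration.integral_diff[OF ga mi, of n] unfolding h_def abs_less_iff by simp
  show "\<exists>\<delta>>0. \<forall>d. d division_of \<Union>d \<and> \<Union>d \<subseteq> {A..B} \<and> total_length d < \<delta> \<longrightarrow>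
      variation (\<lambda>x. integral {A..x} g) d < e"
  proof (intro exI[of _ "e / (2 * (real n + 1))"] conjI allI impI)
    show "0 < e / (2 * (real n + 1))" using \<open>e > 0\<close> by simp
    fix d :: "real set set"
    assume d: "d division_of \<Union>d \<and> \<Union>d \<subseteq> {A..B} \<and> total_length d < e / (2 * (real n + 1))"
    have "variation (\<lambda>x. integral {A..x} g) d
        \<le> (\<Sum>K\<in>d. integral K h + real n * (Sup K - Inf K))"
    proof (rule sum_mono)
      fix K assume "K \<in> d"
      then obtain s t where st: "s \<le> t" "K = {s..t}" "Inf K = s" "Sup K = t" "s \<in> \<Union>d" "t \<in> \<Union>d"
        using division_of_real_interval d by metis
      then have AB: "A \<le> s" "t \<le> B" using d by auto
      have sub: "{s..t} \<subseteq> {A..B}" using AB by auto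
      have gi': "g integrable_on {A..t}" using gi by (rule integrable_on_subinterval) (use AB in auto)
      have "integral {A..t} g - integral {A..s} g = integral {s..t} g"
        using Henstock_Kurzweil_Integration.integral_combine[of A s t g] AB st gi' by simp
      moreover have "norm (integral {s..t} g) \<le> integral {s..t} (\<lambda>x. h x + real n)"
      proof (rule Henstock_Kurzweil_Integration.integral_norm_bound_integral)
        show "g integrable_on {s..t}" using gi sub by (rule integrable_on_subinterval)
        show "(\<lambda>x. h x + real n) integrable_on {s..t}"
          using hi sub by (intro integrable_add integrable_on_subinterval[of h]) auto
      qed (auto simp: h_def)
      moreover have "integral {s..t} (\<lambda>x. h x + real n) = integral {s..t} h + real n * (t - s)"
        using Henstock_Kurzweil_Integration.integral_add[OF integrable_on_subinterval[OF hi sub], of "\<lambda>_. real n"] st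
        by (simp add: integrable_const_ivl)
      ultimately show "\<bar>integral {A..Sup K} g - integral {A..Inf K} g\<bar> \<le> integral K h + real n * (Sup K - Inf K)"
        using st by simp
    qed
    also have "\<dots> = (\<Sum>K\<in>d. integral K h) + real n * total_length d"
      by (simp add: sum.distrib sum_distrib_left)
    also have "(\<Sum>K\<in>d. integral K h) \<le> integral {A..B} h"
    proof -
      have i: "h integrable_on \<Union>d" using integrable_on_subdivision d hi by blast
      have "(\<Sum>K\<in>d. integral K h) = integral (\<Union>d) h"
        using integral_combine_division_topdown[OF i, of d] d by metis
      also have "\<dots> \<le> integral {A..B} h"
        using d i hi h0 by (intro integral_subset_le) auto
      finally show ?thesis .
    qed
    also have "real n * total_length d \<le> real n * (e / (2 * (real n + 1)))"
      using d by (intro mult_left_mono) auto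
    also have "\<dots> \<le> e / 2"
      using \<open>e > 0\<close> by (simp add: field_simps)
    finally show "variation (\<lambda>x. integral {A..x} g) d < e"
      using hint by simp
  qed
qed

lemma ac_deriv_integral:
  fixes g :: "real \<Rightarrow> real"
  assumes g: "g absolutely_integrable_on {A..B}"
  shows "ac_deriv A B (\<lambda>x. integral {A..x} g) g"
proof -
  define G where "G x = integral {A..x} g" for x
  define k where "k x = (if x \<in> {A..B} then g x else 0)" for x
  have "k integrable_on UNIV"
    using integrable_restrict_UNIV[of "{A..B}" g] g
    unfolding k_def[abs_def] absolutely_integrable_on_def by blast
  then have k1: "k integrable_on cbox a b" for a b
    by (rule integrable_on_subcbox) auto
  have k2: "(\<lambda>x. k (- x)) integrable_on cbox a b" for a b
    using k1[of "-b" "-a"] Henstock_Kurzweil_Integration.integrable_reflect_real[of k "-a" "-b"] by simp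
  obtain N1 where N1: "negligible N1"
    "\<And>x e. x \<notin> N1 \<Longrightarrow> 0 < e \<Longrightarrow> \<exists>d>0. \<forall>h. 0 < h \<and> h < d \<longrightarrow> norm (integral {x..x+h} k / h - k x) < e"
    by (rule integrable_ccontinuous_explicit[OF k1]) (auto simp: divide_inverse mult.commute)
  obtain N2 where N2: "negligible N2"
    "\<And>x e. x \<notin> N2 \<Longrightarrow> 0 < e \<Longrightarrow> \<exists>d>0. \<forall>h. 0 < h \<and> h < d \<longrightarrow> norm (integral {x..x+h} (\<lambda>x. k (- x)) / h - k (-x)) < e"
    by (rule integrable_ccontinuous_explicit[OF k2]) (auto simp: divide_inverse mult.commute)
  define N where "N = N1 \<union> uminus ` N2"
  have "negligible (uminus ` N2)"
    using N2(1) by (intro negligible_differentiable_image_negligible)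
      (auto intro: linear_imp_differentiable_on linear_uminus)
  then have negN: "negligible N" using N1 by (simp add: N_def)
  have gi: "g integrable_on {A..B}" using g by (simp add: absolutely_integrable_on_def)
  have incr: "G t - G s = integral {s..t} k" if "A \<le> s" "s \<le> t" "t \<le> B" for s t
  proof -
    have "g integrable_on {A..t}" using gi by (rule integrable_on_subinterval) (use that in auto)
    then have "G t - G s = integral {s..t} g"
      using Henstock_Kurzweil_Integration.integral_combine[of A s t g] that by (simp add: G_def)
    also have "\<dots> = integral {s..t} k"
      using that by (intro integral_cong) (auto simp: k_def)
    finally show ?thesis .
  qed
  have der: "(G has_real_derivative g x) (at x within {A..B})" if x: "x \<in> {A..B}" "x \<notin> N" for x
  proof -
    have kx: "k x = g x" using x by (simp add: k_def)
    have "\<exists>d>0. \<forall>y\<in>{A..B}. norm (y - x) < d \<longrightarrow> norm (G y - G x - g x * (y - x)) \<le> e * norm (y - x)"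
      if "e > 0" for e
    proof -
      obtain d1 where d1: "d1 > 0" "\<And>h. 0 < h \<Longrightarrow> h < d1 \<Longrightarrow> \<bar>integral {x..x+h} k / h - k x\<bar> < e"
        using N1(2)[of x e] x \<open>e > 0\<close> by (auto simp: N_def)
      have "- x \<notin> N2" using x by (force simp: N_def)
      then obtain d2 where d2: "d2 > 0"
        "\<And>h. 0 < h \<Longrightarrow> h < d2 \<Longrightarrow> \<bar>integral {-x..-x+h} (\<lambda>x. k (- x)) / h - k x\<bar> < e"
        using N2(2)[of "-x" e] \<open>e > 0\<close> by auto
      have "\<bar>G y - G x - g x * (y - x)\<bar> \<le> e * \<bar>y - x\<bar>" if y: "y \<in> {A..B}" "\<bar>y - x\<bar> < min d1 d2" for y
      proof (cases y x rule: linorder_cases)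
        case equal
        then show ?thesis by simp
      next
        case greater
        define h where "h = y - x"
        have h: "h > 0" "h < d1" "y = x + h" using greater y by (auto simp: h_def)
        have "G y - G x = integral {x..x+h} k" using incr[of x y] x y h by simp
        then have "\<bar>(G y - G x) / h - g x\<bar> < e" using d1(2)[of h] h kx by simp
        moreover have "(G y - G x) / h - g x = (G y - G x - g x * h) / h"
          using h by (simp add: field_simps)
        ultimately have "\<bar>G y - G x - g x * h\<bar> < e * h"
          using h by (simp add: abs_divide pos_divide_less_eq)
        then show ?thesis using h by simp
      next
        case less
        define h where "h = x - y"
        have h: "h > 0" "h < d2" "y = x - h" using less y by (auto simp: h_def)
        have "integral {-x..-x+h} (\<lambda>x. k (- x)) = integral {y..x} k"
          using Henstock_Kurzweil_Integration.integral_reflect_real[of x y k] h by simp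
        also have "\<dots> = G x - G y" using incr[of y x] x y h by simp
        finally have "\<bar>(G x - G y) / h - g x\<bar> < e" using d2(2)[of h] h kx by simp
        moreover have "(G x - G y) / h - g x = (G x - G y - g x * h) / h"
          using h by (simp add: field_simps)
        ultimately have "\<bar>G x - G y - g x * h\<bar> < e * h"
          using h by (simp add: abs_divide pos_divide_less_eq)
        moreover have "G y - G x - g x * (y - x) = - (G x - G y - g x * h)"
          unfolding h_def by (simp add: algebra_simps)
        ultimately show ?thesis using h by simp
      qed
      then show ?thesis using d1 d2 by (intro exI[of _ "min d1 d2"]) auto
    qed
    then show ?thesis
      unfolding has_field_derivative_def has_derivative_within_alt
      using bounded_linear_mult_right by auto
  qed
  have "AE x\<in>{A..B} in lebesgue. (G has_real_derivative g x) (at x within {A..B})"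
    unfolding eventually_ae_filter_negligible using negN der by (intro exI[of _ N]) auto
  then show ?thesis
    using abs_cont_on_integral[OF g] by (simp add: ac_deriv_def G_def[abs_def])
qed

lemma ac_deriv_eq_integral:
  assumes f: "ac_deriv A B f f'" and f': "f' absolutely_integrable_on {A..B}" and "x \<in> {A..B}"
  shows "f x = f A + integral {A..x} f'"
proof -
  have "f x - integral {A..x} f' = f A - integral {A..A} f'"
    by (rule ac_deriv_zero_imp_const[OF ac_deriv_diff[OF f ac_deriv_integral[OF f']]])
      (use assms in auto)
  then show ?thesis by simp
qed

lemma AE_lebesgue_translate:
  fixes c :: real
  assumes "AE x in lebesgue. P x"
  shows "AE x in lebesgue. P (x + c)"
proof -
  obtain N where N: "negligible N" "{x. \<not> P x} \<subseteq> N"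
    using assms unfolding eventually_ae_filter_negligible by auto
  have "{x. \<not> P (x + c)} \<subseteq> (+) (-c) ` N"
  proof
    fix x assume "x \<in> {x. \<not> P (x + c)}"
    then have "x + c \<in> N" using N by auto
    then show "x \<in> (+) (-c) ` N" by (intro image_eqI[of _ _ "x + c"]) auto
  qed
  moreover have "negligible ((+) (-c) ` N)" using N(1) by (rule negligible_translation)
  ultimately show ?thesis unfolding eventually_ae_filter_negligible by blast
qed

lemma absolutely_integrable_translate:
  fixes f :: "real \<Rightarrow> real"
  assumes "f absolutely_integrable_on {A + c..B + c}"
  shows "(\<lambda>x. f (x + c)) absolutely_integrable_on {A..B}"
    and "integral {A..B} (\<lambda>x. f (x + c)) = integral {A + c..B + c} f"
proof -
  have shift: "((\<lambda>x. g (x + c)) has_integral i) {A..B}" if "(g has_integral i) {A+c..B+c}" for g :: "real \<Rightarrow> real" and i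
    using has_integral_affinity'[of g i "A+c" "B+c" 1 c] that by simp
  have "f integrable_on {A + c..B + c}" "(\<lambda>x. norm (f x)) integrable_on {A + c..B + c}"
    using assms by (auto simp: absolutely_integrable_on_def)
  then show "(\<lambda>x. f (x + c)) absolutely_integrable_on {A..B}"
    unfolding absolutely_integrable_on_def
    using shift[of f] shift[of "\<lambda>x. norm (f x)"] unfolding integrable_on_def by blast
  show "integral {A..B} (\<lambda>x. f (x + c)) = integral {A + c..B + c} f"
    by (rule integral_unique, rule shift, rule integrable_integral, fact)
qed

lemma ac_deriv_translate:
  assumes f: "ac_deriv (A + c) (B + c) f f'" and f': "f' absolutely_integrable_on {A + c..B + c}"
  shows "ac_deriv A B (\<lambda>x. f (x + c)) (\<lambda>x. f' (x + c))"
proof -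
  have "ac_deriv A B (\<lambda>x. integral {A..x} (\<lambda>x. f' (x + c)) + f (A + c)) (\<lambda>x. f' (x + c) + 0)"
    by (intro ac_deriv_add ac_deriv_integral absolutely_integrable_translate(1) f' ac_deriv_of_C1) auto
  then show ?thesis
  proof (rule ac_deriv_cong)
    fix x assume x: "x \<in> {A..B}"
    have "integral {A..x} (\<lambda>x. f' (x + c)) = integral {A + c..x + c} f'"
      by (intro absolutely_integrable_translate(2) absolutely_integrable_on_subinterval[OF f']) (use x in auto)
    then show "integral {A..x} (\<lambda>x. f' (x + c)) + f (A + c) = f (x + c)"
      using ac_deriv_eq_integral[OF f f', of "x + c"] x by simp
  qed simp
qed

section \<open>The angle equation\<close>

lemma ac_deriv_const: "ac_deriv A B (\<lambda>_. c) (\<lambda>_. 0)"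
  by (rule ac_deriv_of_C1) auto

lemma ac_deriv_linear: "ac_deriv A B (\<lambda>x. c * (x - b)) (\<lambda>_. c)"
  by (rule ac_deriv_of_C1) (auto intro!: derivative_eq_intros)

lemma ac_deriv_exp: "ac_deriv A B f f' \<Longrightarrow> ac_deriv A B (\<lambda>x. exp (f x)) (\<lambda>x. exp (f x) * f' x)"
  by (rule ac_deriv_comp) (auto intro!: derivative_eq_intros continuous_intros)

lemma absolutely_integrable_continuous_mult:
  fixes f g :: "real \<Rightarrow> real"
  assumes "continuous_on {A..B} f" "g absolutely_integrable_on {A..B}"
  shows "(\<lambda>x. f x * g x) absolutely_integrable_on {A..B}"
proof (rule absolutely_integrable_bounded_measurable_product_real)
  show "f \<in> borel_measurable (lebesgue_on {A..B})"
    using assms by (intro continuous_imp_measurable_on_sets_lebesgue) auto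
  show "bounded (f ` {A..B})"
    using assms by (intro compact_imp_bounded compact_continuous_image) auto
qed (use assms in auto)

lemma absolutely_integrable_const: "(\<lambda>_. c :: real) absolutely_integrable_on {A..B :: real}"
  by (intro absolutely_integrable_continuous_real) auto

text \<open>
  The right-hand side of the Pruefer equation: if \<open>u'' + q u = 0\<close> and \<open>(u', w u)\<close> has polar angle \<open>y\<close>, then
  \<open>y' = angle_rhs w q x y\<close>. The scale \<open>w\<close> changes neither multiples of \<open>\<pi>/2\<close> nor the order of angles; for
  the constant potential \<open>w\<^sup>2\<close> the angle has constant speed \<open>w\<close>.
\<close>

definition angle_rhs :: "real \<Rightarrow> (real \<Rightarrow> real) \<Rightarrow> real \<Rightarrow> real \<Rightarrow> real" where
  "angle_rhs w q x y = w * (cos y)\<^sup>2 + q x / w * (sin y)\<^sup>2"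

definition angle_solution :: "real \<Rightarrow> (real \<Rightarrow> real) \<Rightarrow> real \<Rightarrow> real \<Rightarrow> (real \<Rightarrow> real) \<Rightarrow> bool" where
  "angle_solution w q A B \<phi> \<longleftrightarrow> ac_deriv A B \<phi> (\<lambda>x. angle_rhs w q x (\<phi> x))"

abbreviation defect ::
    "real \<Rightarrow> (real \<Rightarrow> real) \<Rightarrow> (real \<Rightarrow> real) \<Rightarrow> (real \<Rightarrow> real) \<Rightarrow> real \<Rightarrow> real" where
  "defect w q \<phi> d x \<equiv> d x - angle_rhs w q x (\<phi> x)"

definition lip_weight :: "real \<Rightarrow> (real \<Rightarrow> real) \<Rightarrow> real \<Rightarrow> real" where
  "lip_weight w q x = \<bar>q x\<bar> / w + w"

text \<open>
  Division by zero gives the value 0 on the diagonal. There the factor \<open>z - y\<close> vanishes, so \<open>angle_rhs_diff\<close>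
  holds with any value, and 0 respects the bound by 1.
\<close>

definition sin2_slope :: "real \<Rightarrow> real \<Rightarrow> real" where
  "sin2_slope y z = ((sin z)\<^sup>2 - (sin y)\<^sup>2) / (z - y)"

lemma abs_sin2_slope_le_1: "\<bar>sin2_slope y z\<bar> \<le> 1"
proof (cases "y = z")
  case False
  have "(sin z)\<^sup>2 - (sin y)\<^sup>2 = sin (z + y) * sin (z - y)"
  proof -
    have "sin (z + y) * sin (z - y) = (sin z)\<^sup>2 * (cos y)\<^sup>2 - (cos z)\<^sup>2 * (sin y)\<^sup>2"
      by (simp add: sin_add sin_diff algebra_simps power2_eq_square)
    then show ?thesis by (simp add: cos_squared_eq algebra_simps)
  qed
  moreover have "\<bar>sin (z + y)\<bar> * \<bar>sin (z - y)\<bar> \<le> 1 * \<bar>z - y\<bar>"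
    by (intro mult_mono abs_sin_x_le_abs_x) auto
  ultimately show ?thesis using False by (simp add: sin2_slope_def abs_mult)
qed (simp add: sin2_slope_def)

lemma angle_rhs_diff:
  "angle_rhs w q x z - angle_rhs w q x y = (q x / w - w) * sin2_slope y z * (z - y)"
proof -
  have "sin2_slope y z * (z - y) = (sin z)\<^sup>2 - (sin y)\<^sup>2" by (simp add: sin2_slope_def)
  then have "(q x / w - w) * sin2_slope y z * (z - y) = (q x / w - w) * ((sin z)\<^sup>2 - (sin y)\<^sup>2)"
    by (simp add: mult.assoc)
  then show ?thesis by (simp add: angle_rhs_def cos_squared_eq algebra_simps)
qed

lemma slope_le_lip_weight: "w > 0 \<Longrightarrow> \<bar>(q x / w - w) * sin2_slope y z\<bar> \<le> lip_weight w q x"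
proof -
  assume "w > 0"
  have "\<bar>(q x / w - w) * sin2_slope y z\<bar> \<le> \<bar>q x / w - w\<bar> * 1"
    unfolding abs_mult by (intro mult_left_mono abs_sin2_slope_le_1) auto
  also have "\<dots> \<le> \<bar>q x / w\<bar> + \<bar>w\<bar>" using abs_triangle_ineq4[of "q x / w" w] by simp
  also have "\<dots> = lip_weight w q x" using \<open>w > 0\<close> by (simp add: lip_weight_def)
  finally show ?thesis .
qed

lemma angle_rhs_lipschitz:
  "w > 0 \<Longrightarrow> \<bar>angle_rhs w q x z - angle_rhs w q x y\<bar> \<le> lip_weight w q x * \<bar>z - y\<bar>"
  unfolding angle_rhs_diff abs_mult[of _ "z - y"] by (intro mult_right_mono slope_le_lip_weight) auto

context
  fixes w :: real and q :: "real \<Rightarrow> real" and A B :: real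
  assumes w: "w > 0" and q: "q absolutely_integrable_on {A..B}"
begin

lemma lip_weight_integrable: "lip_weight w q absolutely_integrable_on {A..B}"
proof -
  have "(\<lambda>x. (1 / w) * \<bar>q x\<bar> + w) absolutely_integrable_on {A..B}"
    using absolutely_integrable_norm[OF q]
    by (intro set_integral_add absolutely_integrable_continuous_mult absolutely_integrable_const) (auto simp: o_def)
  then show ?thesis by (simp add: lip_weight_def[abs_def])
qed

lemma angle_rhs_integrable:
  assumes "continuous_on {A..B} \<phi>"
  shows "(\<lambda>x. angle_rhs w q x (\<phi> x)) absolutely_integrable_on {A..B}"
proof -
  have "(\<lambda>x. w * (cos (\<phi> x))\<^sup>2 + ((sin (\<phi> x))\<^sup>2 / w) * q x) absolutely_integrable_on {A..B}"
    using assms w by (intro set_integral_add absolutely_integrable_continuous_mult q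
        absolutely_integrable_continuous_real continuous_intros) auto
  then show ?thesis by (simp add: angle_rhs_def mult.commute)
qed

text \<open>
  In the weighted norm \<open>sup \<bar>\<phi>\<bar> exp (- 2 E)\<close>, where \<open>E\<close> integrates the Lipschitz constant of the
  right-hand side, the Picard operator contracts by the factor \<open>1/2\<close> on the whole interval, so
  no subdivision is needed. To stay in the space of bounded continuous functions on the line,
  arguments are clamped to \<open>[A,B]\<close>.
\<close>

lemma angle_solution_exists:
  assumes AB: "A \<le> B"
  obtains \<phi> where "angle_solution w q A B \<phi>" "\<phi> A = \<alpha>"
proof -
  define E where "E x = integral {A..x} (lip_weight w q)" for x
  have E: "ac_deriv A B E (lip_weight w q)"
    unfolding E_def by (rule ac_deriv_integral[OF lip_weight_integrable])
  have contE: "continuous_on {A..B} E" using ac_deriv_continuous[OF E] .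
  have E0: "E A = 0" by (simp add: E_def)
  define cl where "cl x = max A (min B x)" for x
  have cl: "cl x \<in> {A..B}" for x using AB by (auto simp: cl_def)
  have cl_id: "cl x = x" if "x \<in> {A..B}" for x using that by (auto simp: cl_def)
  have contcl: "continuous_on UNIV cl" unfolding cl_def[abs_def] by (intro continuous_intros)
  define I where "I \<psi> x = integral {A..x} (\<lambda>s. angle_rhs w q s (exp (2 * E s) * \<psi> s))" for \<psi> x
  have intg: "(\<lambda>s. angle_rhs w q s (exp (2 * E s) * apply_bcontfun \<psi> s)) absolutely_integrable_on {A..B}" for \<psi>
    by (intro angle_rhs_integrable continuous_intros contE)
      (use continuous_on_subset[OF continuous_on_apply_bcontfun] in auto)
  have I: "ac_deriv A B (I (apply_bcontfun \<psi>)) (\<lambda>s. angle_rhs w q s (exp (2 * E s) * apply_bcontfun \<psi> s))" for \<psi>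
    unfolding I_def by (rule ac_deriv_integral[OF intg])
  define F where "F \<psi> = Bcontfun (\<lambda>x. exp (- 2 * E (cl x)) * (\<alpha> + I (apply_bcontfun \<psi>) (cl x)))" for \<psi>
  have F: "apply_bcontfun (F \<psi>) x = exp (- 2 * E (cl x)) * (\<alpha> + I (apply_bcontfun \<psi>) (cl x))" for \<psi> x
  proof -
    have c: "continuous_on {A..B} (\<lambda>x. exp (- 2 * E x) * (\<alpha> + I (apply_bcontfun \<psi>) x))"
      by (intro continuous_intros contE ac_deriv_continuous[OF I])
    have cl': "range cl \<subseteq> {A..B}" using cl by blast
    have "continuous_on UNIV (\<lambda>x. exp (- 2 * E (cl x)) * (\<alpha> + I (apply_bcontfun \<psi>) (cl x)))"
      by (rule continuous_on_compose2[OF c contcl cl'])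
    moreover have "bounded ((\<lambda>x. exp (- 2 * E x) * (\<alpha> + I (apply_bcontfun \<psi>) x)) ` {A..B})"
      by (intro compact_imp_bounded compact_continuous_image c) auto
    then have "bounded (range (\<lambda>x. exp (- 2 * E (cl x)) * (\<alpha> + I (apply_bcontfun \<psi>) (cl x))))"
      by (rule bounded_subset) (use cl' in blast)
    ultimately show ?thesis
      unfolding F_def by (subst Bcontfun_inverse) (auto simp: bcontfun_def)
  qed
  have "dist (F \<psi>1) (F \<psi>2) \<le> 1/2 * dist \<psi>1 \<psi>2" for \<psi>1 \<psi>2
  proof (rule dist_bound)
    fix x
    define y where "y = cl x"
    define d where "d = dist \<psi>1 \<psi>2"
    have y: "y \<in> {A..B}" unfolding y_def by (rule cl)
    have sub: "{A..y} \<subseteq> {A..B}" using y by auto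
    have d: "\<bar>apply_bcontfun \<psi>1 s - apply_bcontfun \<psi>2 s\<bar> \<le> d" for s
      using dist_bounded[of \<psi>1 s \<psi>2] by (simp add: d_def dist_real_def)
    define K where "K s = exp (2 * E s) * (2 * lip_weight w q s)" for s
    have K: "ac_deriv A B (\<lambda>s. exp (2 * E s)) K"
      unfolding K_def by (intro ac_deriv_exp ac_deriv_cmult E)
    have Kint: "K absolutely_integrable_on {A..B}"
      unfolding K_def by (intro absolutely_integrable_continuous_mult continuous_intros contE lip_weight_integrable)
    have expE: "exp (2 * E y) = 1 + integral {A..y} K"
      using ac_deriv_eq_integral[OF K Kint y] E0 by simp
    have int1: "(\<lambda>s. angle_rhs w q s (exp (2 * E s) * apply_bcontfun \<psi> s)) integrable_on {A..y}" for \<psi>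
      using intg integrable_on_subinterval[OF _ sub] by (auto simp: absolutely_integrable_on_def)
    have intK: "K integrable_on {A..y}"
      using Kint integrable_on_subinterval[OF _ sub] by (auto simp: absolutely_integrable_on_def)
    have "I \<psi>1 y - I \<psi>2 y = integral {A..y} (\<lambda>s. angle_rhs w q s (exp (2 * E s) * \<psi>1 s) - angle_rhs w q s (exp (2 * E s) * \<psi>2 s))"
      unfolding I_def by (simp add: Henstock_Kurzweil_Integration.integral_diff int1)
    also have "norm \<dots> \<le> integral {A..y} (\<lambda>s. d/2 * K s)"
    proof (rule Henstock_Kurzweil_Integration.integral_norm_bound_integral)
      fix s
      have "norm (angle_rhs w q s (exp (2 * E s) * \<psi>1 s) - angle_rhs w q s (exp (2 * E s) * \<psi>2 s))
        \<le> lip_weight w q s * \<bar>exp (2 * E s) * \<psi>1 s - exp (2 * E s) * \<psi>2 s\<bar>"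
        using angle_rhs_lipschitz[OF w] by simp
      also have "\<dots> = lip_weight w q s * (exp (2 * E s) * \<bar>\<psi>1 s - \<psi>2 s\<bar>)"
        by (simp add: right_diff_distrib[symmetric] abs_mult)
      also have "\<dots> \<le> lip_weight w q s * (exp (2 * E s) * d)"
        using w d by (intro mult_left_mono) (auto simp: lip_weight_def)
      finally show "norm (angle_rhs w q s (exp (2 * E s) * \<psi>1 s) - angle_rhs w q s (exp (2 * E s) * \<psi>2 s)) \<le> d/2 * K s"
        by (simp add: K_def mult_ac)
      show "(\<lambda>s. d/2 * K s) integrable_on {A..y}"
        using integrable_cmul[OF intK, of "d/2"] by simp
    qed (intro integrable_diff int1)
    also have "\<dots> = d/2 * (exp (2 * E y) - 1)" by (simp add: expE)
    finally have le: "\<bar>I \<psi>1 y - I \<psi>2 y\<bar> \<le> d/2 * (exp (2 * E y) - 1)" by simp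
    have "dist (F \<psi>1 x) (F \<psi>2 x) = exp (- 2 * E y) * \<bar>I \<psi>1 y - I \<psi>2 y\<bar>"
      by (simp add: F y_def[symmetric] dist_real_def right_diff_distrib[symmetric] abs_mult)
    also have "\<dots> \<le> exp (- 2 * E y) * (d/2 * (exp (2 * E y) - 1))"
      by (intro mult_left_mono le) auto
    also have "\<dots> = d/2 * (exp (- 2 * E y) * exp (2 * E y)) - d/2 * exp (- 2 * E y)"
      by (simp add: algebra_simps)
    also have "\<dots> \<le> d/2" by (simp add: exp_add[symmetric] d_def)
    finally show "dist (F \<psi>1 x) (F \<psi>2 x) \<le> 1/2 * dist \<psi>1 \<psi>2" by (simp add: d_def)
  qed
  then obtain \<psi> where \<psi>: "F \<psi> = \<psi>"
    using banach_fix_type[of "1/2" F] by auto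
  define \<phi> where "\<phi> x = \<alpha> + I (apply_bcontfun \<psi>) x" for x
  have \<phi>_eq: "exp (2 * E x) * apply_bcontfun \<psi> x = \<phi> x" if "x \<in> {A..B}" for x
  proof -
    have "apply_bcontfun \<psi> x = exp (- 2 * E x) * \<phi> x" using F[of \<psi> x] \<psi> cl_id[OF that] by (simp add: \<phi>_def)
    then have "exp (2 * E x) * apply_bcontfun \<psi> x = (exp (2 * E x) * exp (- 2 * E x)) * \<phi> x" by simp
    then show ?thesis by (simp add: exp_add[symmetric])
  qed
  have "ac_deriv A B \<phi> (\<lambda>s. 0 + angle_rhs w q s (exp (2 * E s) * apply_bcontfun \<psi> s))"
    unfolding \<phi>_def by (intro ac_deriv_add ac_deriv_const I)
  then have "angle_solution w q A B \<phi>"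
    unfolding angle_solution_def by (rule ac_deriv_cong) (auto simp: \<phi>_eq)
  moreover have "\<phi> A = \<alpha>" by (simp add: \<phi>_def I_def)
  ultimately show thesis by (rule that)
qed

text \<open>
  The difference of two functions satisfies a linear equation with coefficient \<open>h\<close>, the difference
  quotient of the right-hand side; \<open>exp (- P)\<close> with \<open>P = \<integral> h\<close> is its integrating factor. What is left
  on the right is the difference of the defects. All comparison results below come from this identity.
\<close>

lemma angle_integrating_factor:
  assumes \<phi>1: "ac_deriv A B \<phi>1 d1" and \<phi>2: "ac_deriv A B \<phi>2 d2"
  obtains P where "P A = 0" "\<And>x. x \<in> {A..B} \<Longrightarrow> \<bar>P x\<bar> \<le> integral {A..B} (lip_weight w q)"
    "ac_deriv A B (\<lambda>x. exp (- P x) * (\<phi>2 x - \<phi>1 x))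
      (\<lambda>x. exp (- P x) * (defect w q \<phi>2 d2 x - defect w q \<phi>1 d1 x))"
proof -
  define h where "h x = (q x / w - w) * sin2_slope (\<phi>1 x) (\<phi>2 x)" for x
  have m: "\<phi>1 \<in> borel_measurable (lebesgue_on {A..B})" "\<phi>2 \<in> borel_measurable (lebesgue_on {A..B})"
    using \<phi>1 \<phi>2 by (auto intro!: continuous_imp_measurable_on_sets_lebesgue ac_deriv_continuous)
  have "(\<lambda>x. sin2_slope (\<phi>1 x) (\<phi>2 x) * ((1 / w) * q x + - w)) absolutely_integrable_on {A..B}"
  proof (rule absolutely_integrable_bounded_measurable_product_real)
    show "(\<lambda>x. sin2_slope (\<phi>1 x) (\<phi>2 x)) \<in> borel_measurable (lebesgue_on {A..B})"
      unfolding sin2_slope_def using m by measurable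
    show "bounded ((\<lambda>x. sin2_slope (\<phi>1 x) (\<phi>2 x)) ` {A..B})"
      using abs_sin2_slope_le_1 by (auto intro!: boundedI[of _ 1])
    show "(\<lambda>x. (1 / w) * q x + - w) absolutely_integrable_on {A..B}"
      by (intro set_integral_add absolutely_integrable_continuous_mult absolutely_integrable_const q) auto
  qed auto
  then have hint: "h absolutely_integrable_on {A..B}"
    by (simp add: h_def[abs_def] mult.commute)
  define P where "P x = integral {A..x} h" for x
  have P: "ac_deriv A B P h" unfolding P_def by (rule ac_deriv_integral[OF hint])
  show thesis
  proof (rule that)
    show "P A = 0" by (simp add: P_def)
    show "\<bar>P x\<bar> \<le> integral {A..B} (lip_weight w q)" if x: "x \<in> {A..B}" for x
    proof -
      have sub: "{A..x} \<subseteq> {A..B}" using x by auto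
      have wi: "lip_weight w q integrable_on {A..B}"
        using lip_weight_integrable by (simp add: absolutely_integrable_on_def)
      then have wi': "lip_weight w q integrable_on {A..x}" using integrable_on_subinterval[OF _ sub] by blast
      have "norm (P x) \<le> integral {A..x} (lip_weight w q)"
        unfolding P_def
      proof (rule Henstock_Kurzweil_Integration.integral_norm_bound_integral)
        show "h integrable_on {A..x}"
          using hint integrable_on_subinterval[OF _ sub] by (auto simp: absolutely_integrable_on_def)
      qed (use wi' slope_le_lip_weight[OF w] in \<open>auto simp: h_def\<close>)
      also have "\<dots> \<le> integral {A..B} (lip_weight w q)"
        using sub wi wi' w by (intro integral_subset_le) (auto simp: lip_weight_def)
      finally show ?thesis by simp
    qed
    have "ac_deriv A B (\<lambda>x. exp (- 1 * P x) * (\<phi>2 x - \<phi>1 x))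
       (\<lambda>x. (exp (- 1 * P x) * (- 1 * h x)) * (\<phi>2 x - \<phi>1 x) + exp (- 1 * P x) * (d2 x - d1 x))"
      by (intro ac_deriv_mult ac_deriv_exp ac_deriv_cmult ac_deriv_diff P \<phi>1 \<phi>2)
    then show "ac_deriv A B (\<lambda>x. exp (- P x) * (\<phi>2 x - \<phi>1 x))
      (\<lambda>x. exp (- P x) * (defect w q \<phi>2 d2 x - defect w q \<phi>1 d1 x))"
    proof (rule ac_deriv_cong)
      fix x
      have "h x * (\<phi>2 x - \<phi>1 x) = angle_rhs w q x (\<phi>2 x) - angle_rhs w q x (\<phi>1 x)"
        by (simp add: h_def angle_rhs_diff)
      moreover have "(exp (- 1 * P x) * (- 1 * h x)) * (\<phi>2 x - \<phi>1 x) + exp (- 1 * P x) * (d2 x - d1 x)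
        = exp (- P x) * ((d2 x - d1 x) - h x * (\<phi>2 x - \<phi>1 x))"
        by (simp add: algebra_simps)
      moreover have "(d2 x - d1 x) - (angle_rhs w q x (\<phi>2 x) - angle_rhs w q x (\<phi>1 x))
        = defect w q \<phi>2 d2 x - defect w q \<phi>1 d1 x" by simp
      ultimately show "(exp (- 1 * P x) * (- 1 * h x)) * (\<phi>2 x - \<phi>1 x) + exp (- 1 * P x) * (d2 x - d1 x)
        = exp (- P x) * (defect w q \<phi>2 d2 x - defect w q \<phi>1 d1 x)"
        by (simp only:)
    qed auto
  qed
qed

text \<open>
  A subsolution stays below a supersolution. The third part says that they meet at the right end only
  if both are solutions.
\<close>

lemma angle_compare:
  assumes \<phi>1: "ac_deriv A B \<phi>1 d1" and \<phi>2: "ac_deriv A B \<phi>2 d2"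
    and sub: "AE x\<in>{A..B} in lebesgue. d1 x \<le> angle_rhs w q x (\<phi>1 x)"
    and super: "AE x\<in>{A..B} in lebesgue. angle_rhs w q x (\<phi>2 x) \<le> d2 x"
    and x: "x \<in> {A..B}"
  shows "\<phi>1 A \<le> \<phi>2 A \<Longrightarrow> \<phi>1 x \<le> \<phi>2 x"
    and "\<phi>1 A < \<phi>2 A \<Longrightarrow> \<phi>1 x < \<phi>2 x"
    and "\<phi>1 A \<le> \<phi>2 A \<Longrightarrow> \<phi>2 B \<le> \<phi>1 B \<Longrightarrow> A < B \<Longrightarrow>
      AE x\<in>{A..B} in lebesgue. d1 x = angle_rhs w q x (\<phi>1 x) \<and> d2 x = angle_rhs w q x (\<phi>2 x)"
proof -
  obtain P where P: "P A = 0" and D: "ac_deriv A B (\<lambda>x. exp (- P x) * (\<phi>2 x - \<phi>1 x))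
      (\<lambda>x. exp (- P x) * (defect w q \<phi>2 d2 x - defect w q \<phi>1 d1 x))"
    by (rule angle_integrating_factor[OF \<phi>1 \<phi>2])
  have pos: "AE x\<in>{A..B} in lebesgue.
      exp (- P x) * (defect w q \<phi>2 d2 x - defect w q \<phi>1 d1 x) \<ge> 0"
    using sub super by eventually_elim auto
  have mono: "\<phi>2 A - \<phi>1 A \<le> exp (- P x) * (\<phi>2 x - \<phi>1 x)"
    using ac_deriv_nonneg_imp_mono[OF D pos, of A x] x P by simp
  show "\<phi>1 x \<le> \<phi>2 x" if "\<phi>1 A \<le> \<phi>2 A"
  proof -
    have "0 \<le> exp (- P x) * (\<phi>2 x - \<phi>1 x)" using mono that by linarith
    then show ?thesis by (simp add: zero_le_mult_iff)
  qed
  show "\<phi>1 x < \<phi>2 x" if "\<phi>1 A < \<phi>2 A"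
  proof -
    have "0 < exp (- P x) * (\<phi>2 x - \<phi>1 x)" using mono that by linarith
    then show ?thesis by (simp add: zero_less_mult_iff)
  qed
  show "AE x\<in>{A..B} in lebesgue. d1 x = angle_rhs w q x (\<phi>1 x) \<and> d2 x = angle_rhs w q x (\<phi>2 x)"
    if "\<phi>1 A \<le> \<phi>2 A" "\<phi>2 B \<le> \<phi>1 B" "A < B"
  proof -
    have "exp (- P B) * (\<phi>2 B - \<phi>1 B) \<le> 0"
      using that by (intro mult_nonneg_nonpos) auto
    also have "0 \<le> exp (- P A) * (\<phi>2 A - \<phi>1 A)" using that by simp
    finally have "AE x\<in>{A..B} in lebesgue.
      exp (- P x) * (defect w q \<phi>2 d2 x - defect w q \<phi>1 d1 x) = 0"
      using ac_deriv_nonneg_eq_imp_zero[OF D pos \<open>A < B\<close>] by simp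
    then show ?thesis using sub super by eventually_elim auto
  qed
qed

text \<open>
  Continuous dependence on the initial angle and on the potential: a change of potential appears
  as a defect.
\<close>

lemma angle_gronwall:
  assumes \<phi>1: "ac_deriv A B \<phi>1 d1" and \<phi>2: "ac_deriv A B \<phi>2 d2"
    and defect: "AE x\<in>{A..B} in lebesgue.
      \<bar>defect w q \<phi>2 d2 x - defect w q \<phi>1 d1 x\<bar> \<le> e"
    and x: "x \<in> {A..B}" and e: "e \<ge> 0"
  defines "C \<equiv> exp (integral {A..B} (lip_weight w q))"
  shows "\<bar>\<phi>2 x - \<phi>1 x\<bar> \<le> C * (\<bar>\<phi>2 A - \<phi>1 A\<bar> + C * e * (B - A))"
proof -
  obtain P where P: "P A = 0" "\<And>x. x \<in> {A..B} \<Longrightarrow> \<bar>P x\<bar> \<le> integral {A..B} (lip_weight w q)"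
    and D: "ac_deriv A B (\<lambda>x. exp (- P x) * (\<phi>2 x - \<phi>1 x))
      (\<lambda>x. exp (- P x) * (defect w q \<phi>2 d2 x - defect w q \<phi>1 d1 x))"
    by (rule angle_integrating_factor[OF \<phi>1 \<phi>2], rule that, assumption+)
  define F where "F x = exp (- P x) * (\<phi>2 x - \<phi>1 x)" for x
  define g where "g x = exp (- P x) * (defect w q \<phi>2 d2 x - defect w q \<phi>1 d1 x)" for x
  have D: "ac_deriv A B F g" using D by (simp add: F_def[abs_def] g_def[abs_def])
  have eP: "exp (- P x) \<le> C" "exp (P x) \<le> C" if "x \<in> {A..B}" for x
    using P(2)[OF that] by (auto simp: C_def)
  have C0: "C > 0" by (simp add: C_def)
  have g: "AE x\<in>{A..B} in lebesgue. \<bar>g x\<bar> \<le> C * e"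
    using defect
  proof eventually_elim
    case (elim x)
    show ?case
    proof
      assume "x \<in> {A..B}"
      then show "\<bar>g x\<bar> \<le> C * e"
        unfolding g_def abs_mult using elim eP(1)[of x] C0 by (intro mult_mono) auto
    qed
  qed
  have up: "AE x\<in>{A..B} in lebesgue. 0 \<le> C * e - g x"
    and down: "AE x\<in>{A..B} in lebesgue. 0 \<le> C * e + g x"
    using g by (eventually_elim, auto)+
  have "C * e * (A - A) - F A \<le> C * e * (x - A) - F x"
    using ac_deriv_nonneg_imp_mono[OF ac_deriv_diff[OF ac_deriv_linear[of A B "C * e" A] D] up, of A x] x by simp
  moreover have "C * e * (A - A) + F A \<le> C * e * (x - A) + F x"
    using ac_deriv_nonneg_imp_mono[OF ac_deriv_add[OF ac_deriv_linear[of A B "C * e" A] D] down, of A x] x by simp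
  moreover have "C * e * (x - A) \<le> C * e * (B - A)"
    using x e C0 by (intro mult_left_mono) auto
  moreover have "F A = \<phi>2 A - \<phi>1 A" by (simp add: F_def P)
  ultimately have "\<bar>F x\<bar> \<le> \<bar>\<phi>2 A - \<phi>1 A\<bar> + C * e * (B - A)" by (auto simp: abs_le_iff)
  then have "exp (P x) * \<bar>F x\<bar> \<le> C * (\<bar>\<phi>2 A - \<phi>1 A\<bar> + C * e * (B - A))"
    using eP(2)[OF x] C0 by (intro mult_mono) auto
  moreover have "exp (P x) * \<bar>F x\<bar> = \<bar>\<phi>2 x - \<phi>1 x\<bar>"
    by (simp add: F_def abs_mult exp_minus)
  ultimately show ?thesis by simp
qed

end

section \<open>Solutions in polar coordinates\<close>

definition lin_solution ::
    "(real \<Rightarrow> real) \<Rightarrow> real \<Rightarrow> real \<Rightarrow> (real \<Rightarrow> real) \<Rightarrow> (real \<Rightarrow> real) \<Rightarrow> bool" where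
  "lin_solution q A B u v \<longleftrightarrow> ac_deriv A B u v \<and> ac_deriv A B v (\<lambda>x. - q x * u x)"

text \<open>
  Only \<open>v\<close> is absolutely continuous by definition; \<open>u\<close> is because its derivative \<open>v\<close> is bounded on compact intervals.
\<close>

lemma hill_solution_imp_lin_solution:
  assumes h: "hill_solution a \<mu> I u v" and sub: "{A..B} \<subseteq> I"
  shows "lin_solution (\<lambda>x. \<mu> + a x) A B u v"
proof -
  have u: "(u has_real_derivative v x) (at x within {A..B})" if "x \<in> {A..B}" for x
  proof -
    have "(u has_real_derivative v x) (at x within I)"
      using h sub that unfolding hill_solution_def by blast
    then show ?thesis using sub by (rule DERIV_subset)
  qed
  have v: "abs_cont_on {A..B} v" using h sub by (auto simp: hill_solution_def)
  have "bounded (v ` {A..B})"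
    by (intro compact_imp_bounded compact_continuous_image abs_cont_on_imp_continuous_on v) auto
  then obtain C where "\<forall>y\<in>v ` {A..B}. norm y \<le> C"
    unfolding bounded_iff by blast
  then have C: "norm (v x) \<le> max C 0" if "x \<in> {A..B}" for x
    using that by (auto intro: max.coboundedI1)
  have "abs_cont_on {A..B} u"
  proof (rule abs_cont_on_comp_lipschitz2[of A B "\<lambda>x. x" "\<lambda>x. x" "max C 0"])
    show "abs_cont_on {A..B} (\<lambda>x. x)" "abs_cont_on {A..B} (\<lambda>x. x)"
      using ac_deriv_id[of A B] by (simp_all add: ac_deriv_def)
    fix x y assume xy: "x \<in> {A..B}" "y \<in> {A..B}"
    have "norm (u x - u y) \<le> max C 0 * norm (x - y)"
      by (rule field_differentiable_bound[where S="{A..B}" and f'=v])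
        (use u C xy in blast)+
    moreover have "0 \<le> max C 0 * \<bar>x - y\<bar>" by simp
    ultimately show "\<bar>u x - u y\<bar> \<le> max C 0 * \<bar>x - y\<bar> + max C 0 * \<bar>x - y\<bar>"
      unfolding real_norm_def by linarith
  qed simp
  then have "ac_deriv A B u v" using u by (simp add: ac_deriv_def)
  moreover have "AE x in lebesgue. x \<in> I \<longrightarrow>
        (\<exists>w. (v has_real_derivative w) (at x within I) \<and> w + (\<mu> + a x) * u x = 0)"
    using h by (simp add: hill_solution_def)
  then have "AE x\<in>{A..B} in lebesgue.
        (v has_real_derivative - (\<mu> + a x) * u x) (at x within {A..B})"
  proof eventually_elim
    case (elim x)
    show ?case
    proof
      assume "x \<in> {A..B}"
      then obtain w where w: "(v has_real_derivative w) (at x within I)" "w + (\<mu> + a x) * u x = 0"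
        using elim sub by blast
      then have "w = - (\<mu> + a x) * u x" by (simp only: mult_minus_left eq_neg_iff_add_eq_0)
      with w(1) show "(v has_real_derivative - (\<mu> + a x) * u x) (at x within {A..B})"
        using sub by (auto intro: DERIV_subset)
    qed
  qed
  ultimately show ?thesis using v by (simp add: lin_solution_def ac_deriv_def)
qed

text \<open>
  Since \<open>v\<close> is continuous, \<open>u = u A + \<integral> v\<close> is differentiable everywhere and not just almost everywhere.
\<close>

lemma lin_solution_imp_hill_solution:
  assumes l: "lin_solution (\<lambda>x. \<mu> + a x) A B u v"
  shows "hill_solution a \<mu> {A..B} u v"
proof -
  have u: "ac_deriv A B u v" and v: "ac_deriv A B v (\<lambda>x. - (\<mu> + a x) * u x)"
    using l by (auto simp: lin_solution_def)
  have cv: "continuous_on {A..B} v" using ac_deriv_continuous[OF v] .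
  have der: "(u has_real_derivative v x) (at x within {A..B})" if x: "x \<in> {A..B}" for x
  proof -
    have "((\<lambda>x. u A + integral {A..x} v) has_real_derivative v x) (at x within {A..B})"
      using integral_has_real_derivative[OF cv x] by (auto intro!: derivative_eq_intros)
    then show ?thesis
      by (rule has_field_derivative_transform_within[of _ _ _ _ 1])
        (use x ac_deriv_eq_integral[OF u absolutely_integrable_continuous_real[OF cv], symmetric] in auto)
  qed
  have "AE x\<in>{A..B} in lebesgue. (v has_real_derivative - (\<mu> + a x) * u x) (at x within {A..B})"
    using v by (simp add: ac_deriv_def)
  then have "AE x\<in>{A..B} in lebesgue.
        (\<exists>w. (v has_real_derivative w) (at x within {A..B}) \<and> w + (\<mu> + a x) * u x = 0)"
  proof eventually_elim
    case (elim x)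
    then show ?case
      by (intro impI exI[of _ "- (\<mu> + a x) * u x"]) (auto simp: algebra_simps)
  qed
  moreover have "abs_cont_on {s..t} v" if "{s..t} \<subseteq> {A..B}" for s t
    using abs_cont_on_subset[OF _ that] v by (simp add: ac_deriv_def)
  ultimately show ?thesis using der by (simp add: hill_solution_def)
qed

lemma wronskian_const:
  assumes l1: "lin_solution q A B u1 v1" and l2: "lin_solution q A B u2 v2" and x: "x \<in> {A..B}"
  shows "u1 x * v2 x - v1 x * u2 x = u1 A * v2 A - v1 A * u2 A"
proof -
  have *: "ac_deriv A B u1 v1" "ac_deriv A B v1 (\<lambda>x. - q x * u1 x)"
    "ac_deriv A B u2 v2" "ac_deriv A B v2 (\<lambda>x. - q x * u2 x)"
    using l1 l2 by (auto simp: lin_solution_def)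
  show ?thesis
    by (rule ac_deriv_zero_imp_const[OF ac_deriv_diff[OF ac_deriv_mult[OF *(1,4)] ac_deriv_mult[OF *(2,3)]] _ x])
      (auto simp: algebra_simps)
qed

lemma lin_solution_combine:
  assumes "lin_solution q A B u1 v1" "lin_solution q A B u2 v2"
  shows "lin_solution q A B (\<lambda>x. c * u1 x + d * u2 x) (\<lambda>x. c * v1 x + d * v2 x)"
proof -
  have "ac_deriv A B (\<lambda>x. c * u1 x + d * u2 x) (\<lambda>x. c * v1 x + d * v2 x)"
    using assms unfolding lin_solution_def by (intro ac_deriv_add ac_deriv_cmult) auto
  moreover have "ac_deriv A B (\<lambda>x. c * v1 x + d * v2 x) (\<lambda>x. c * (- q x * u1 x) + d * (- q x * u2 x))"
    using assms unfolding lin_solution_def by (intro ac_deriv_add ac_deriv_cmult) auto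
  then have "ac_deriv A B (\<lambda>x. c * v1 x + d * v2 x) (\<lambda>x. - q x * (c * u1 x + d * u2 x))"
    by (rule ac_deriv_cong) (auto simp: algebra_simps)
  ultimately show ?thesis by (simp add: lin_solution_def)
qed

lemma ac_deriv_sin: "ac_deriv A B f f' \<Longrightarrow> ac_deriv A B (\<lambda>x. sin (f x)) (\<lambda>x. cos (f x) * f' x)"
  by (rule ac_deriv_comp) (auto intro!: derivative_eq_intros continuous_intros)

lemma ac_deriv_cos: "ac_deriv A B f f' \<Longrightarrow> ac_deriv A B (\<lambda>x. cos (f x)) (\<lambda>x. - sin (f x) * f' x)"
  by (rule ac_deriv_comp) (auto intro!: derivative_eq_intros continuous_intros)

text \<open>
  The polar radius of a solution with angle \<open>\<phi>\<close>, normalised to 1 at \<open>A\<close>; it satisfies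
  \<open>r' = r (w - q / w) sin \<phi> cos \<phi>\<close>.
\<close>

definition amplitude :: "real \<Rightarrow> (real \<Rightarrow> real) \<Rightarrow> real \<Rightarrow> (real \<Rightarrow> real) \<Rightarrow> real \<Rightarrow> real" where
  "amplitude w q A \<phi> x = exp (integral {A..x} (\<lambda>s. (w - q s / w) * sin (\<phi> s) * cos (\<phi> s)))"

lemma amplitude_pos [simp]: "amplitude w q A \<phi> x > 0"
  by (simp add: amplitude_def)

lemma amplitude_start [simp]: "amplitude w q A \<phi> A = 1"
  by (simp add: amplitude_def)

lemma angle_solution_imp_lin_solution:
  assumes w: "w > 0" and q: "q absolutely_integrable_on {A..B}" and \<phi>: "angle_solution w q A B \<phi>"
  shows "lin_solution q A B (\<lambda>x. amplitude w q A \<phi> x * sin (\<phi> x) / w) (\<lambda>x. amplitude w q A \<phi> x * cos (\<phi> x))"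
proof -
  define r where "r = amplitude w q A \<phi>"
  define h where "h s = (w - q s / w) * sin (\<phi> s) * cos (\<phi> s)" for s
  have D: "ac_deriv A B \<phi> (\<lambda>x. angle_rhs w q x (\<phi> x))"
    using \<phi> by (simp add: angle_solution_def)
  have c: "continuous_on {A..B} \<phi>" using ac_deriv_continuous[OF D] .
  have "(\<lambda>s. (sin (\<phi> s) * cos (\<phi> s)) * (w + (- 1 / w) * q s)) absolutely_integrable_on {A..B}"
    using c by (intro absolutely_integrable_continuous_mult set_integral_add absolutely_integrable_const q continuous_intros)
  then have "h absolutely_integrable_on {A..B}"
    by (simp add: h_def[abs_def] mult_ac)
  then have "ac_deriv A B (\<lambda>x. exp (integral {A..x} h)) (\<lambda>x. exp (integral {A..x} h) * h x)"
    by (intro ac_deriv_exp ac_deriv_integral)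
  then have R: "ac_deriv A B r (\<lambda>x. r x * h x)"
    by (simp add: r_def amplitude_def[abs_def] h_def[abs_def])
  have "ac_deriv A B (\<lambda>x. (1 / w) * (r x * sin (\<phi> x)))
      (\<lambda>x. (1 / w) * ((r x * h x) * sin (\<phi> x) + r x * (cos (\<phi> x) * angle_rhs w q x (\<phi> x))))"
    by (intro ac_deriv_cmult ac_deriv_mult R ac_deriv_sin D)
  then have U: "ac_deriv A B (\<lambda>x. r x * sin (\<phi> x) / w) (\<lambda>x. r x * cos (\<phi> x))"
  proof (rule ac_deriv_cong)
    fix x
    have "(1 / w) * ((r * ((w - q / w) * s * c)) * s + r * (c * (w * c\<^sup>2 + q / w * s\<^sup>2))) = r * c * (s\<^sup>2 + c\<^sup>2)"
      for r s c q :: real using w by (simp add: field_simps power2_eq_square)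
    then have "(1 / w) * ((r x * h x) * sin (\<phi> x) + r x * (cos (\<phi> x) * angle_rhs w q x (\<phi> x)))
      = r x * cos (\<phi> x) * ((sin (\<phi> x))\<^sup>2 + (cos (\<phi> x))\<^sup>2)"
      unfolding h_def angle_rhs_def .
    then show "(1 / w) * ((r x * h x) * sin (\<phi> x) + r x * (cos (\<phi> x) * angle_rhs w q x (\<phi> x))) = r x * cos (\<phi> x)"
      by simp
  qed simp
  have "ac_deriv A B (\<lambda>x. r x * cos (\<phi> x))
      (\<lambda>x. (r x * h x) * cos (\<phi> x) + r x * (- sin (\<phi> x) * angle_rhs w q x (\<phi> x)))"
    by (intro ac_deriv_mult R ac_deriv_cos D)
  then have V: "ac_deriv A B (\<lambda>x. r x * cos (\<phi> x)) (\<lambda>x. - q x * (r x * sin (\<phi> x) / w))"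
  proof (rule ac_deriv_cong)
    fix x
    have "(r * ((w - q / w) * s * c)) * c + r * (- s * (w * c\<^sup>2 + q / w * s\<^sup>2)) = - q * (r * s / w) * (s\<^sup>2 + c\<^sup>2)"
      for r s c q :: real using w by (simp add: field_simps power2_eq_square)
    then have "(r x * h x) * cos (\<phi> x) + r x * (- sin (\<phi> x) * angle_rhs w q x (\<phi> x))
      = - q x * (r x * sin (\<phi> x) / w) * ((sin (\<phi> x))\<^sup>2 + (cos (\<phi> x))\<^sup>2)"
      unfolding h_def angle_rhs_def .
    then show "(r x * h x) * cos (\<phi> x) + r x * (- sin (\<phi> x) * angle_rhs w q x (\<phi> x)) = - q x * (r x * sin (\<phi> x) / w)"
      by simp
  qed simp
  from U V show ?thesis by (simp add: lin_solution_def r_def)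
qed

lemma AE_sin_affine_nonzero:
  fixes w c :: real
  assumes "w \<noteq> 0"
  shows "AE x in lebesgue. sin (c + w * x) \<noteq> 0"
proof -
  have "{x. sin (c + w * x) = 0} \<subseteq> (\<lambda>i::int. (of_int i * pi - c) / w) ` UNIV"
  proof
    fix x assume "x \<in> {x. sin (c + w * x) = 0}"
    then obtain i :: int where "c + w * x = of_int i * pi" by (auto simp: sin_zero_iff_int2)
    then have "x = (of_int i * pi - c) / w" using assms by (simp add: field_simps)
    then show "x \<in> (\<lambda>i::int. (of_int i * pi - c) / w) ` UNIV" by blast
  qed
  then have "countable {x. sin (c + w * x) = 0}" by (rule countable_subset) auto
  then have "negligible {x. sin (c + w * x) = 0}"
    by (simp add: negligible_iff_null_sets null_sets_completionI countable_imp_null_set_lborel)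
  then show ?thesis unfolding eventually_ae_filter_negligible by auto
qed

lemma AE_interval_nontrivial:
  assumes "A < B"
  shows "\<not> (AE x in lebesgue. x \<notin> {A..B :: real})"
proof
  assume "AE x in lebesgue. x \<notin> {A..B}"
  then obtain N where "negligible N" and N: "{x. \<not> x \<notin> {A..B}} \<subseteq> N"
    unfolding eventually_ae_filter_negligible by blast
  moreover have "{A..B} \<subseteq> N" using N by auto
  ultimately have "negligible {A..B}" using negligible_subset by blast
  then show False using assms negligible_interval(1)[of A B] by simp
qed

lemma angle_solution_shift:
  assumes "angle_solution w q A B \<phi>"
  shows "angle_solution w q A B (\<lambda>x. \<phi> x + of_int j * pi)"
proof -
  have "sin (of_int j * pi) = 0" by (simp add: sin_zero_iff_int2)
  then have s: "sin (y + of_int j * pi) = cos (of_int j * pi) * sin y"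
    "cos (y + of_int j * pi) = cos (of_int j * pi) * cos y" for y
    by (simp_all add: sin_add cos_add)
  from \<open>sin (of_int j * pi) = 0\<close> have "(cos (of_int j * pi) :: real)\<^sup>2 = 1" by (simp add: cos_squared_eq)
  then have "angle_rhs w q x (y + of_int j * pi) = angle_rhs w q x y" for x y
    by (simp add: angle_rhs_def s power_mult_distrib)
  moreover have "ac_deriv A B (\<lambda>x. \<phi> x + of_int j * pi) (\<lambda>x. angle_rhs w q x (\<phi> x) + 0)"
    using assms unfolding angle_solution_def by (intro ac_deriv_add ac_deriv_const)
  ultimately show ?thesis by (simp add: angle_solution_def)
qed

lemma angle_solution_compare:
  assumes "w > 0" "q absolutely_integrable_on {A..B}"
    and "angle_solution w q A B \<phi>1" "angle_solution w q A B \<phi>2" "x \<in> {A..B}"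
  shows "\<phi>1 A \<le> \<phi>2 A \<Longrightarrow> \<phi>1 x \<le> \<phi>2 x" "\<phi>1 A < \<phi>2 A \<Longrightarrow> \<phi>1 x < \<phi>2 x"
proof -
  have sub: "AE x\<in>{A..B} in lebesgue. angle_rhs w q x (\<phi>1 x) \<le> angle_rhs w q x (\<phi>1 x)"
    and super: "AE x\<in>{A..B} in lebesgue. angle_rhs w q x (\<phi>2 x) \<le> angle_rhs w q x (\<phi>2 x)"
    by simp_all
  note * = angle_compare(1,2)[OF assms(1,2) assms(3,4)[unfolded angle_solution_def] sub super assms(5)]
  show "\<phi>1 A \<le> \<phi>2 A \<Longrightarrow> \<phi>1 x \<le> \<phi>2 x" by (rule *(1))
  show "\<phi>1 A < \<phi>2 A \<Longrightarrow> \<phi>1 x < \<phi>2 x" by (rule *(2))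
qed

lemma angle_solution_unique:
  assumes "w > 0" "q absolutely_integrable_on {A..B}"
    and "angle_solution w q A B \<phi>1" "angle_solution w q A B \<phi>2" "x \<in> {A..B}" "\<phi>1 A = \<phi>2 A"
  shows "\<phi>1 x = \<phi>2 x"
  using angle_solution_compare(1)[OF assms(1-5)] angle_solution_compare(1)[OF assms(1,2,4,3,5)] assms(6)
  by simp

section \<open>The rotation over one period\<close>

locale hill_rotation =
  fixes T w :: real and a :: "real \<Rightarrow> real"
  assumes T_pos: "T > 0" and w_pos: "w > 0" and a_int: "a absolutely_integrable_on {0..T}"
begin

definition pot :: "real \<Rightarrow> real \<Rightarrow> real" where
  "pot \<mu> = (\<lambda>x. \<mu> + a x)"

text \<open>
  The choice is determined on \<open>[0,T]\<close>, by \<open>angle_solution_unique\<close>.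
\<close>

definition ang :: "real \<Rightarrow> real \<Rightarrow> real \<Rightarrow> real" where
  "ang \<mu> y = (SOME \<phi>. angle_solution w (pot \<mu>) 0 T \<phi> \<and> \<phi> 0 = y)"

text \<open>
  The action of the monodromy map on directions, lifted from the circle to the line.
\<close>

definition endang :: "real \<Rightarrow> real \<Rightarrow> real" where
  "endang \<mu> y = ang \<mu> y T"

definition rot :: "real \<Rightarrow> real \<Rightarrow> real" where
  "rot \<mu> y = endang \<mu> y - y"

text \<open>
  The factor by which the monodromy map stretches the unit vector of direction \<open>y\<close>.
\<close>

definition growth :: "real \<Rightarrow> real \<Rightarrow> real" where
  "growth \<mu> y = amplitude w (pot \<mu>) 0 (ang \<mu> y) T"

definition usol :: "real \<Rightarrow> real \<Rightarrow> real \<Rightarrow> real" where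
  "usol \<mu> y x = amplitude w (pot \<mu>) 0 (ang \<mu> y) x * sin (ang \<mu> y x) / w"

definition vsol :: "real \<Rightarrow> real \<Rightarrow> real \<Rightarrow> real" where
  "vsol \<mu> y x = amplitude w (pot \<mu>) 0 (ang \<mu> y) x * cos (ang \<mu> y x)"

lemma pot_int: "pot \<mu> absolutely_integrable_on {0..T}"
  unfolding pot_def by (intro set_integral_add absolutely_integrable_const a_int)

lemma ang: "angle_solution w (pot \<mu>) 0 T (ang \<mu> y)" "ang \<mu> y 0 = y"
proof -
  have "0 \<le> T" using T_pos by simp
  then obtain \<phi> where "angle_solution w (pot \<mu>) 0 T \<phi>" "\<phi> 0 = y"
    by (rule angle_solution_exists[OF w_pos pot_int])
  then have "angle_solution w (pot \<mu>) 0 T (ang \<mu> y) \<and> ang \<mu> y 0 = y"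
    unfolding ang_def by (intro someI[of "\<lambda>\<phi>. angle_solution w (pot \<mu>) 0 T \<phi> \<and> \<phi> 0 = y"]) auto
  then show "angle_solution w (pot \<mu>) 0 T (ang \<mu> y)" "ang \<mu> y 0 = y" by auto
qed

lemma ang_ac: "ac_deriv 0 T (ang \<mu> y) (\<lambda>x. angle_rhs w (pot \<mu>) x (ang \<mu> y x))"
  using ang(1) by (simp add: angle_solution_def)

lemma T_mem: "T \<in> {0..T}" "0 \<in> {0..T}" using T_pos by auto

lemma endang_eq:
  assumes "angle_solution w (pot \<mu>) 0 T \<phi>"
  shows "\<phi> T = endang \<mu> (\<phi> 0)"
  unfolding endang_def
  by (rule angle_solution_unique[OF w_pos pot_int assms ang(1) T_mem(1)]) (simp add: ang)

lemma endang_strict_mono: "y < z \<Longrightarrow> endang \<mu> y < endang \<mu> z"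
  unfolding endang_def
  by (rule angle_solution_compare(2)[OF w_pos pot_int ang(1) ang(1) T_mem(1)]) (simp add: ang)

lemma endang_mono: "y \<le> z \<Longrightarrow> endang \<mu> y \<le> endang \<mu> z"
  using endang_strict_mono[of y z \<mu>] by (cases "y = z") auto

lemma endang_add_pi: "endang \<mu> (y + of_int j * pi) = endang \<mu> y + of_int j * pi"
  using endang_eq[OF angle_solution_shift[OF ang(1)[of \<mu> y], of j]] by (simp add: ang endang_def)

lemma rot_add_pi: "rot \<mu> (y + of_int j * pi) = rot \<mu> y"
  by (simp add: rot_def endang_add_pi)

lemma reduce_mod_pi:
  obtains j :: int where "z + of_int j * pi \<in> {y..<y + pi}"
proof -
  define j where "j = - \<lfloor>(z - y) / pi\<rfloor>"
  have "of_int \<lfloor>(z - y) / pi\<rfloor> \<le> (z - y) / pi" "(z - y) / pi < of_int \<lfloor>(z - y) / pi\<rfloor> + 1"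
    by linarith+
  then have "of_int \<lfloor>(z - y) / pi\<rfloor> * pi \<le> z - y" "z - y < (of_int \<lfloor>(z - y) / pi\<rfloor> + 1) * pi"
    by (simp_all only: pos_le_divide_eq[OF pi_gt_zero] pos_divide_less_eq[OF pi_gt_zero])
  then have "z + of_int j * pi \<in> {y..<y + pi}" by (auto simp: j_def algebra_simps)
  then show thesis by (rule that)
qed

text \<open>
  The map \<open>endang \<mu>\<close> is increasing and commutes with the translation by \<open>\<pi>\<close>.
\<close>

lemma rot_diff_less_pi: "\<bar>rot \<mu> z - rot \<mu> y\<bar> < pi"
proof -
  obtain j :: int where j: "z + of_int j * pi \<in> {y..<y + pi}" by (rule reduce_mod_pi)
  define \<gamma> where "\<gamma> = z + of_int j * pi"
  have g: "rot \<mu> z = rot \<mu> \<gamma>" "y \<le> \<gamma>" "\<gamma> < y + pi" using j by (auto simp: \<gamma>_def rot_add_pi)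
  have "endang \<mu> y \<le> endang \<mu> \<gamma>" "endang \<mu> \<gamma> < endang \<mu> y + pi"
    using endang_mono[OF g(2), of \<mu>] endang_strict_mono[OF g(3), of \<mu>] endang_add_pi[of \<mu> y 1] by auto
  then show ?thesis using g by (auto simp: rot_def abs_less_iff)
qed

text \<open>
  At an angle that is a multiple of \<open>\<pi>\<close> the right-hand side equals \<open>w > 0\<close> whatever the potential
  is, so the angle crosses these values upwards only.
\<close>

lemma endang_0_pos: "endang \<mu> 0 > 0"
proof (rule ccontr)
  assume "\<not> endang \<mu> 0 > 0"
  then have le: "ang \<mu> 0 T \<le> 0" by (simp add: endang_def)
  have sub: "AE x\<in>{0..T} in lebesgue. 0 \<le> angle_rhs w (pot \<mu>) x 0"
    and super: "AE x\<in>{0..T} in lebesgue. angle_rhs w (pot \<mu>) x (ang \<mu> 0 x) \<le> angle_rhs w (pot \<mu>) x (ang \<mu> 0 x)"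
    using w_pos by (simp_all add: angle_rhs_def)
  have "AE x\<in>{0..T} in lebesgue. 0 = angle_rhs w (pot \<mu>) x 0 \<and>
      angle_rhs w (pot \<mu>) x (ang \<mu> 0 x) = angle_rhs w (pot \<mu>) x (ang \<mu> 0 x)"
    by (rule angle_compare(3)[OF w_pos pot_int ac_deriv_const ang_ac sub super T_mem(1)])
      (use le T_pos in \<open>simp_all add: ang\<close>)
  then have "AE x in lebesgue. x \<notin> {0..T}"
    by eventually_elim (use w_pos in \<open>auto simp: angle_rhs_def\<close>)
  then show False using AE_interval_nontrivial[OF T_pos] by simp
qed

lemma rot_greater: "rot \<mu> y > - pi"
proof -
  obtain j :: int where j: "y + of_int j * pi \<in> {0..<0 + pi}" by (rule reduce_mod_pi)
  define \<gamma> where "\<gamma> = y + of_int j * pi"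
  have g: "rot \<mu> y = rot \<mu> \<gamma>" "0 \<le> \<gamma>" "\<gamma> < pi" using j by (auto simp: \<gamma>_def rot_add_pi)
  have "endang \<mu> \<gamma> > 0" using endang_mono[OF g(2), of \<mu>] endang_0_pos[of \<mu>] by simp
  then show ?thesis using g by (simp add: rot_def)
qed

text \<open>
  By the equality case of the comparison, no gain over \<open>[0,T]\<close> would mean that \<open>sin\<^sup>2 \<phi>\<close>, the derivative of the
  right-hand side with respect to \<open>\<mu>\<close> up to the factor \<open>w\<close>, vanishes along the solution.
\<close>

lemma endang_strict_mono_param:
  assumes "\<mu> < \<nu>"
  shows "endang \<mu> y < endang \<nu> y"
proof (rule ccontr)
  assume "\<not> endang \<mu> y < endang \<nu> y"
  then have le: "ang \<nu> y T \<le> ang \<mu> y T" by (simp add: endang_def)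
  have dr: "angle_rhs w (pot \<nu>) x t = angle_rhs w (pot \<mu>) x t + (\<nu> - \<mu>) / w * (sin t)\<^sup>2" for x t
    by (simp add: angle_rhs_def pot_def diff_divide_distrib add_divide_distrib algebra_simps)
  have "AE x\<in>{0..T} in lebesgue.
      angle_rhs w (pot \<mu>) x (ang \<mu> y x) = angle_rhs w (pot \<mu>) x (ang \<mu> y x) \<and>
      angle_rhs w (pot \<nu>) x (ang \<nu> y x) = angle_rhs w (pot \<mu>) x (ang \<nu> y x)"
  proof (rule angle_compare(3)[OF w_pos pot_int ang_ac ang_ac _ _ T_mem(1)])
    show "AE x\<in>{0..T} in lebesgue. angle_rhs w (pot \<mu>) x (ang \<nu> y x) \<le> angle_rhs w (pot \<nu>) x (ang \<nu> y x)"
      using assms w_pos by (simp add: dr)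
  qed (use le T_pos in \<open>simp_all add: ang\<close>)
  then have s: "AE x\<in>{0..T} in lebesgue. sin (ang \<nu> y x) = 0"
  proof eventually_elim
    case (elim x)
    show ?case
    proof
      assume "x \<in> {0..T}"
      then have "(\<nu> - \<mu>) / w * (sin (ang \<nu> y x))\<^sup>2 = 0" using elim dr by simp
      then show "sin (ang \<nu> y x) = 0" using assms w_pos by simp
    qed
  qed
  \<comment> \<open>Then the angle would move with speed \<open>w\<close> almost everywhere, and leave the zeros of the sine.\<close>
  have "AE x\<in>{0..T} in lebesgue. angle_rhs w (pot \<nu>) x (ang \<nu> y x) = w"
    using s by eventually_elim (auto simp: angle_rhs_def cos_squared_eq)
  then have D: "ac_deriv 0 T (ang \<nu> y) (\<lambda>_. w)" by (rule ac_deriv_AE_cong[OF ang_ac])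
  have lin: "ang \<nu> y x = y + w * x" if x: "x \<in> {0..T}" for x
    using ac_deriv_zero_imp_const[OF ac_deriv_diff[OF D ac_deriv_linear[of 0 T w 0]] _ x] by (simp add: ang)
  have "AE x in lebesgue. sin (y + w * x) \<noteq> 0"
    using w_pos by (intro AE_sin_affine_nonzero) simp
  with s have "AE x in lebesgue. x \<notin> {0..T}"
    by eventually_elim (use lin in auto)
  then show False using AE_interval_nontrivial[OF T_pos] by simp
qed

lemma endang_lipschitz:
  obtains K where "K > 0" "\<And>y z \<nu>. \<bar>endang \<nu> z - endang \<mu> y\<bar> \<le> K * (\<bar>z - y\<bar> + \<bar>\<nu> - \<mu>\<bar>)"
proof -
  define C where "C = exp (integral {0..T} (lip_weight w (pot \<mu>)))"
  define K where "K = C + C * (C * (1 / w) * T)"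
  have C0: "C > 0" by (simp add: C_def)
  have K0: "C * (C * (1 / w) * T) > 0" using C0 w_pos T_pos by simp
  have "\<bar>endang \<nu> z - endang \<mu> y\<bar> \<le> K * (\<bar>z - y\<bar> + \<bar>\<nu> - \<mu>\<bar>)" for y z \<nu>
  proof -
    have dr: "angle_rhs w (pot \<nu>) x t - angle_rhs w (pot \<mu>) x t = (\<nu> - \<mu>) / w * (sin t)\<^sup>2" for x t
      by (simp add: angle_rhs_def pot_def diff_divide_distrib add_divide_distrib algebra_simps)
    have "\<bar>(\<nu> - \<mu>) / w * (sin t)\<^sup>2\<bar> \<le> \<bar>\<nu> - \<mu>\<bar> / w * 1" for t
      unfolding abs_mult using w_pos by (intro mult_mono) (auto simp: abs_divide abs_square_le_1)
    then have "\<bar>ang \<nu> z T - ang \<mu> y T\<bar> \<le> C * (\<bar>ang \<nu> z 0 - ang \<mu> y 0\<bar> + C * (\<bar>\<nu> - \<mu>\<bar> / w) * (T - 0))"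
      unfolding C_def using w_pos
      by (intro angle_gronwall[OF w_pos pot_int ang_ac ang_ac _ T_mem(1)]) (auto simp: dr)
    also have "\<dots> = C * \<bar>z - y\<bar> + C * (C * (1 / w) * T) * \<bar>\<nu> - \<mu>\<bar>"
      by (simp add: ang algebra_simps)
    also have "\<dots> \<le> K * \<bar>z - y\<bar> + K * \<bar>\<nu> - \<mu>\<bar>"
      using K0 C0 by (intro add_mono mult_right_mono) (auto simp: K_def)
    finally show ?thesis by (simp add: endang_def distrib_left)
  qed
  moreover have "K > 0" using C0 K0 by (simp add: K_def)
  ultimately show thesis using that by blast
qed

lemma continuous_rot: "continuous_on S (rot \<mu>)"
proof -
  obtain K where K: "K > 0" "\<And>y z \<nu>. \<bar>endang \<nu> z - endang \<mu> y\<bar> \<le> K * (\<bar>z - y\<bar> + \<bar>\<nu> - \<mu>\<bar>)"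
    using endang_lipschitz by blast
  have "K-lipschitz_on UNIV (endang \<mu>)"
    by (rule lipschitz_onI) (use K(1) K(2)[of \<mu>] in \<open>auto simp: dist_real_def\<close>)
  then have "continuous_on UNIV (endang \<mu>)" by (rule lipschitz_on_continuous_on)
  then have "continuous_on UNIV (\<lambda>y. endang \<mu> y - y)" by (intro continuous_intros)
  then show ?thesis unfolding rot_def[abs_def] by (rule continuous_on_subset) auto
qed

definition rotmax :: "real \<Rightarrow> real" where "rotmax \<mu> = Sup (range (rot \<mu>))"
definition rotmin :: "real \<Rightarrow> real" where "rotmin \<mu> = Inf (range (rot \<mu>))"

lemma rot_range: "range (rot \<mu>) = rot \<mu> ` {0..pi}"
proof
  show "range (rot \<mu>) \<subseteq> rot \<mu> ` {0..pi}"
  proof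
    fix r assume "r \<in> range (rot \<mu>)"
    then obtain y where r: "r = rot \<mu> y" by auto
    obtain j :: int where "y + of_int j * pi \<in> {0..<0 + pi}" by (rule reduce_mod_pi)
    then show "r \<in> rot \<mu> ` {0..pi}"
      using r rot_add_pi[of \<mu> y j] by (intro image_eqI[of _ _ "y + of_int j * pi"]) auto
  qed
qed auto

lemma compact_rot_range: "compact (range (rot \<mu>))"
  unfolding rot_range by (intro compact_continuous_image continuous_rot) auto

lemma rot_le_rotmax: "rot \<mu> y \<le> rotmax \<mu>"
  unfolding rotmax_def
  by (intro cSup_upper bounded_imp_bdd_above compact_imp_bounded compact_rot_range) auto

lemma rotmin_le_rot: "rotmin \<mu> \<le> rot \<mu> y"
  unfolding rotmin_def
  by (intro cInf_lower bounded_imp_bdd_below compact_imp_bounded compact_rot_range) auto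

text \<open>
  By \<open>\<pi>\<close>-periodicity the range over all angles is the range over the compact interval \<open>[0,\<pi>]\<close>.
\<close>

lemma rotmax_attained: obtains y where "rot \<mu> y = rotmax \<mu>"
proof -
  obtain y where "\<And>z. rot \<mu> z \<le> rot \<mu> y"
    using compact_attains_sup[OF compact_rot_range[of \<mu>]] by auto
  then have "rotmax \<mu> \<le> rot \<mu> y" unfolding rotmax_def by (intro cSup_least) auto
  then show thesis using that[of y] rot_le_rotmax[of \<mu> y] by simp
qed

lemma rotmin_attained: obtains y where "rot \<mu> y = rotmin \<mu>"
proof -
  obtain y where "\<And>z. rot \<mu> y \<le> rot \<mu> z"
    using compact_attains_inf[OF compact_rot_range[of \<mu>]] by auto
  then have "rotmin \<mu> \<ge> rot \<mu> y" unfolding rotmin_def by (intro cInf_greatest) auto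
  then show thesis using that[of y] rotmin_le_rot[of \<mu> y] by simp
qed

lemma rotmin_le_rotmax: "rotmin \<mu> \<le> rotmax \<mu>"
  using rotmin_le_rot[of \<mu> 0] rot_le_rotmax[of \<mu> 0] by simp

lemma rotmax_less: "rotmax \<mu> < rotmin \<mu> + pi"
proof -
  obtain y z where "rot \<mu> y = rotmax \<mu>" "rot \<mu> z = rotmin \<mu>"
    using rotmax_attained rotmin_attained by metis
  then show ?thesis using rot_diff_less_pi[of \<mu> y z] by (simp add: abs_less_iff)
qed

lemma rotmax_pos: "rotmax \<mu> > 0"
  using rot_le_rotmax[of \<mu> 0] endang_0_pos[of \<mu>] by (simp add: rot_def)

lemma rotmax_strict_mono: "\<mu> < \<nu> \<Longrightarrow> rotmax \<mu> < rotmax \<nu>"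
proof -
  assume "\<mu> < \<nu>"
  obtain y where "rot \<mu> y = rotmax \<mu>" by (rule rotmax_attained)
  then show ?thesis
    using endang_strict_mono_param[OF \<open>\<mu> < \<nu>\<close>, of y] rot_le_rotmax[of \<nu> y] by (simp add: rot_def)
qed

lemma rotmin_strict_mono: "\<mu> < \<nu> \<Longrightarrow> rotmin \<mu> < rotmin \<nu>"
proof -
  assume "\<mu> < \<nu>"
  obtain y where "rot \<nu> y = rotmin \<nu>" by (rule rotmin_attained)
  then show ?thesis
    using endang_strict_mono_param[OF \<open>\<mu> < \<nu>\<close>, of y] rotmin_le_rot[of \<mu> y] by (simp add: rot_def)
qed

lemma continuous_from_pointwise_lipschitz:
  fixes f :: "real \<Rightarrow> real"
  assumes "\<And>x. \<exists>K>0. \<forall>y. \<bar>f y - f x\<bar> \<le> K * \<bar>y - x\<bar>"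
  shows "continuous_on S f"
  unfolding continuous_on_iff
proof (intro ballI allI impI)
  fix x e :: real assume "e > 0"
  obtain K where K: "K > 0" "\<And>y. \<bar>f y - f x\<bar> \<le> K * \<bar>y - x\<bar>" using assms by blast
  have "dist (f y) (f x) < e" if "dist y x < e / K" for y
  proof -
    have "K * \<bar>y - x\<bar> < e" using that K(1) by (simp add: dist_real_def pos_less_divide_eq mult.commute)
    then show ?thesis using K(2)[of y] by (simp add: dist_real_def)
  qed
  then show "\<exists>d>0. \<forall>y\<in>S. dist y x < d \<longrightarrow> dist (f y) (f x) < e"
    using \<open>e > 0\<close> K(1) by (intro exI[of _ "e / K"]) auto
qed

lemma continuous_rotmax: "continuous_on S rotmax" and continuous_rotmin: "continuous_on S rotmin"
proof -
  have "\<exists>K>0. \<forall>\<nu>. \<bar>rotmax \<nu> - rotmax \<mu>\<bar> \<le> K * \<bar>\<nu> - \<mu>\<bar> \<and> \<bar>rotmin \<nu> - rotmin \<mu>\<bar> \<le> K * \<bar>\<nu> - \<mu>\<bar>" for \<mu>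
  proof -
    obtain K where K: "K > 0" "\<And>y z \<nu>. \<bar>endang \<nu> z - endang \<mu> y\<bar> \<le> K * (\<bar>z - y\<bar> + \<bar>\<nu> - \<mu>\<bar>)"
      using endang_lipschitz by blast
    have le: "\<bar>rot \<nu> y - rot \<mu> y\<bar> \<le> K * \<bar>\<nu> - \<mu>\<bar>" for \<nu> y using K(2)[of \<nu> y y] by (simp add: rot_def)
    have "\<bar>rotmax \<nu> - rotmax \<mu>\<bar> \<le> K * \<bar>\<nu> - \<mu>\<bar>" for \<nu>
    proof -
      obtain y z where "rot \<mu> y = rotmax \<mu>" "rot \<nu> z = rotmax \<nu>" using rotmax_attained by metis
      then show ?thesis
        using le[of \<nu> y] le[of \<nu> z] rot_le_rotmax[of \<mu> z] rot_le_rotmax[of \<nu> y] by linarith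
    qed
    moreover have "\<bar>rotmin \<nu> - rotmin \<mu>\<bar> \<le> K * \<bar>\<nu> - \<mu>\<bar>" for \<nu>
    proof -
      obtain y z where "rot \<mu> y = rotmin \<mu>" "rot \<nu> z = rotmin \<nu>" using rotmin_attained by metis
      then show ?thesis
        using le[of \<nu> y] le[of \<nu> z] rotmin_le_rot[of \<mu> z] rotmin_le_rot[of \<nu> y] by linarith
    qed
    ultimately show ?thesis using K(1) by blast
  qed
  then show "continuous_on S rotmax" "continuous_on S rotmin"
    by (meson continuous_from_pointwise_lipschitz)+
qed

lemma sol_lin: "lin_solution (pot \<mu>) 0 T (usol \<mu> y) (vsol \<mu> y)"
  using angle_solution_imp_lin_solution[OF w_pos pot_int ang(1)]
  by (simp add: usol_def[abs_def] vsol_def[abs_def])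

lemma sol_start: "usol \<mu> y 0 = sin y / w" "vsol \<mu> y 0 = cos y"
  by (simp_all add: usol_def vsol_def ang)

lemma sol_end: "usol \<mu> y T = growth \<mu> y * sin (endang \<mu> y) / w"
  "vsol \<mu> y T = growth \<mu> y * cos (endang \<mu> y)"
  by (simp_all add: usol_def vsol_def growth_def endang_def)

lemma growth_pos: "growth \<mu> y > 0" by (simp add: growth_def)

text \<open>
  The Wronskian of two solutions is the same at \<open>0\<close> and \<open>T\<close>; in polar coordinates it is the product of the radii
  and the sine of the difference of the angles, up to the factor \<open>1 / w\<close>.
\<close>

lemma growth_wronskian:
  "growth \<mu> y * growth \<mu> z * sin (endang \<mu> z - endang \<mu> y) = sin (z - y)"
proof -
  have "usol \<mu> z T * vsol \<mu> y T - vsol \<mu> z T * usol \<mu> y T = usol \<mu> z 0 * vsol \<mu> y 0 - vsol \<mu> z 0 * usol \<mu> y 0"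
    by (rule wronskian_const[OF sol_lin sol_lin T_mem(1)])
  then have "growth \<mu> y * growth \<mu> z * (sin (endang \<mu> z) * cos (endang \<mu> y) - cos (endang \<mu> z) * sin (endang \<mu> y)) / w
    = (sin z * cos y - cos z * sin y) / w"
    unfolding sol_start sol_end by (simp add: diff_divide_distrib algebra_simps)
  then show ?thesis using w_pos by (simp add: sin_diff)
qed

end

lemma sgn_sin: "\<bar>x\<bar> < pi \<Longrightarrow> sgn (sin x) = sgn (x :: real)"
  using sin_gt_zero[of x] sin_gt_zero[of "-x"] by (cases x "0::real" rule: linorder_cases) (auto simp: sgn_if)

context hill_rotation
begin

text \<open>
  Suppose that the direction \<open>y\<close> is invariant, and let \<open>l\<close> be its factor. By the Wronskian identity the
  monodromy map is triangular in the basis of directions \<open>y\<close>, \<open>y + \<pi>/2\<close>, with diagonal \<open>l\<close>, \<open>1/l\<close>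
  and some off-diagonal entry \<open>C\<close>; this determines whether the direction \<open>y + t\<close> is turned by
  more or by less than \<open>y\<close> is.
\<close>

lemma rot_sign_near_invariant_direction:
  assumes fixd: "rot \<mu> y = of_int j * pi"
  defines "l \<equiv> growth \<mu> y"
  obtains C where "\<And>t. 0 < t \<Longrightarrow> t < pi \<Longrightarrow>
    sgn (rot \<mu> (y + t) - of_int j * pi) = sgn ((1 / l - l) * cos t - C * sin t)"
proof -
  have l0: "l > 0" by (simp add: l_def growth_pos)
  define \<tau> where "\<tau> t = endang \<mu> (y + t) - endang \<mu> y" for t
  define r where "r t = growth \<mu> (y + t)" for t
  have r0: "r t > 0" for t by (simp add: r_def growth_pos)
  have W: "l * r t * sin (\<tau> t) = sin t" for t
    using growth_wronskian[of \<mu> y "y + t"] by (simp add: l_def r_def \<tau>_def)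
  have W': "r t * r (pi/2) * sin (\<tau> (pi/2) - \<tau> t) = cos t" for t
    using growth_wronskian[of \<mu> "y + t" "y + pi/2"] by (simp add: r_def \<tau>_def cos_sin_eq)
  define C where "C = r (pi/2) * cos (\<tau> (pi/2))"
  have s: "r t * sin (\<tau> t) = sin t / l" for t using W[of t] l0 by (simp add: field_simps)
  have c: "r t * cos (\<tau> t) = l * cos t + C * sin t" for t
  proof -
    have "cos t = (r (pi/2) * sin (\<tau> (pi/2))) * (r t * cos (\<tau> t)) - C * (r t * sin (\<tau> t))"
      using W'[of t] by (simp add: sin_diff C_def algebra_simps)
    also have "\<dots> = (1 / l) * (r t * cos (\<tau> t)) - C * (sin t / l)"
      using s[of "pi/2"] s[of t] by simp
    finally show ?thesis using l0 by (simp add: field_simps)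
  qed
  show thesis
  proof (rule that)
    fix t assume t: "0 < t" "t < pi"
    have "0 < \<tau> t" "\<tau> t < pi"
      using endang_strict_mono[of y "y + t" \<mu>] endang_strict_mono[of "y + t" "y + pi" \<mu>]
        endang_add_pi[of \<mu> y 1] t by (auto simp: \<tau>_def)
    then have "sgn (\<tau> t - t) = sgn (sin (\<tau> t - t))"
      using t by (intro sgn_sin[symmetric]) (auto simp: abs_less_iff)
    also have "\<dots> = sgn (r t * sin (\<tau> t - t))" using r0[of t] by (simp add: sgn_mult)
    also have "r t * sin (\<tau> t - t) = (r t * sin (\<tau> t)) * cos t - (r t * cos (\<tau> t)) * sin t"
      by (simp add: sin_diff algebra_simps)
    also have "\<dots> = sin t * ((1 / l - l) * cos t - C * sin t)"
      unfolding s c by (simp add: algebra_simps)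
    also have "sgn \<dots> = sgn ((1 / l - l) * cos t - C * sin t)"
      using sin_gt_zero[OF t] by (simp add: sgn_mult)
    finally show "sgn (rot \<mu> (y + t) - of_int j * pi) = sgn ((1 / l - l) * cos t - C * sin t)"
      using fixd by (simp add: rot_def \<tau>_def algebra_simps)
  qed
qed

end

text \<open>
  Positivity near \<open>t = 0\<close>, with an explicit \<open>t\<close>: the condition reads \<open>C tan t < k\<close>.
\<close>

lemma trig_linear_form_pos:
  assumes "k > (0::real)"
  obtains t where "0 < t" "t < pi" "k * cos t - C * sin t > 0"
proof -
  define t where "t = arctan (k / (\<bar>C\<bar> + 1))"
  have tpos: "0 < t" "t < pi/2" using assms arctan_ubound by (auto simp: t_def)
  then have ct: "cos t > 0" by (intro cos_gt_zero) auto
  have "C * tan t \<le> \<bar>C\<bar> * (k / (\<bar>C\<bar> + 1))"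
    using assms unfolding t_def tan_arctan by (intro mult_right_mono) auto
  also have "\<dots> < k" using assms by (simp add: field_simps)
  finally have "cos t * (k - C * tan t) > 0" using ct by simp
  also have "cos t * (k - C * tan t) = k * cos t - C * sin t"
    using ct by (simp add: tan_def field_simps)
  finally show thesis using tpos that[of t] by simp
qed

lemma trig_linear_form_sign_changes:
  assumes "k \<noteq> (0::real)"
  shows "\<exists>t. 0 < t \<and> t < pi \<and> k * cos t - C * sin t > 0"
    and "\<exists>t. 0 < t \<and> t < pi \<and> k * cos t - C * sin t < 0"
proof -
  have pos: "\<exists>t. 0 < t \<and> t < pi \<and> k * cos t - C * sin t > 0" if "k \<noteq> 0" for k C :: real
  proof (cases "k > 0")
    case True
    then show ?thesis using trig_linear_form_pos[of k C] by blast
  next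
    case False
    then have "- k > 0" using \<open>k \<noteq> 0\<close> by simp
    then obtain t where "0 < t" "t < pi" "(- k) * cos t - C * sin t > 0"
      by (rule trig_linear_form_pos)
    then show ?thesis by (intro exI[of _ "pi - t"]) auto
  qed
  show "\<exists>t. 0 < t \<and> t < pi \<and> k * cos t - C * sin t > 0" using pos assms by blast
  obtain t where "0 < t" "t < pi" "(- k) * cos t - (- C) * sin t > 0" using pos[of "-k" "-C"] assms by auto
  then show "\<exists>t. 0 < t \<and> t < pi \<and> k * cos t - C * sin t < 0" by (intro exI[of _ t]) auto
qed

context hill_rotation
begin

text \<open>
  For \<open>l = 1\<close> the linear form is \<open>- C sin t\<close>, of constant sign: all directions lag behind \<open>y\<close>, or all
  run ahead, or all turn alike.
\<close>

lemma rot_side_if_growth_1: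
  assumes fixd: "rot \<mu> y = of_int j * pi" and g: "growth \<mu> y = 1"
  obtains e where "\<And>t. 0 < t \<Longrightarrow> t < pi \<Longrightarrow> sgn (rot \<mu> (y + t) - of_int j * pi) = e"
    "\<And>z. rot \<mu> z = of_int j * pi \<or> sgn (rot \<mu> z - of_int j * pi) = e"
proof -
  obtain C where C: "\<And>t. 0 < t \<Longrightarrow> t < pi \<Longrightarrow>
    sgn (rot \<mu> (y + t) - of_int j * pi) = sgn ((1 / 1 - 1) * cos t - C * sin t)"
    using rot_sign_near_invariant_direction[OF fixd] unfolding g by blast
  have 1: "sgn (rot \<mu> (y + t) - of_int j * pi) = - sgn C" if "0 < t" "t < pi" for t
    using C[OF that] sin_gt_zero[OF that] by (simp add: sgn_mult sgn_minus)
  have "rot \<mu> z = of_int j * pi \<or> sgn (rot \<mu> z - of_int j * pi) = - sgn C" for z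
  proof -
    obtain i :: int where i: "z + of_int i * pi \<in> {y..<y + pi}" by (rule reduce_mod_pi)
    define t where "t = z + of_int i * pi - y"
    have rz: "rot \<mu> z = rot \<mu> (y + t)" by (simp add: t_def rot_add_pi)
    have "t = 0 \<or> 0 < t \<and> t < pi" using i by (auto simp: t_def)
    then show ?thesis using 1[of t] fixd rz by auto
  qed
  with 1 show thesis by (rule that)
qed

text \<open>
  If the factor is not 1, the linear form of \<open>rot_sign_near_invariant_direction\<close> takes both signs, so some directions
  turn by more than \<open>y\<close> and some by less.
\<close>

lemma growth_eq_1_iff_extremal:
  assumes fixd: "rot \<mu> y = of_int j * pi"
  shows "growth \<mu> y = 1 \<longleftrightarrow> rotmax \<mu> = of_int j * pi \<or> rotmin \<mu> = of_int j * pi"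
proof -
  show ?thesis
  proof
    assume "growth \<mu> y = 1"
    then obtain e where e: "\<And>z. rot \<mu> z = of_int j * pi \<or> sgn (rot \<mu> z - of_int j * pi) = e"
      using rot_side_if_growth_1[OF fixd] by blast
    show "rotmax \<mu> = of_int j * pi \<or> rotmin \<mu> = of_int j * pi"
    proof (cases "e \<le> 0")
      case True
      have "rot \<mu> z \<le> of_int j * pi" for z using e[of z] True by (auto simp: sgn_if split: if_splits)
      then have "rotmax \<mu> \<le> of_int j * pi" using rotmax_attained[of \<mu>] by metis
      then show ?thesis using rot_le_rotmax[of \<mu> y] fixd by simp
    next
      case False
      have "rot \<mu> z \<ge> of_int j * pi" for z using e[of z] False by (auto simp: sgn_if split: if_splits)
      then have "rotmin \<mu> \<ge> of_int j * pi" using rotmin_attained[of \<mu>] by metis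
      then show ?thesis using rotmin_le_rot[of \<mu> y] fixd by simp
    qed
  next
    define l where "l = growth \<mu> y"
    have l0: "l > 0" by (simp add: l_def growth_pos)
    obtain C where C: "\<And>t. 0 < t \<Longrightarrow> t < pi \<Longrightarrow>
      sgn (rot \<mu> (y + t) - of_int j * pi) = sgn ((1 / l - l) * cos t - C * sin t)"
      using rot_sign_near_invariant_direction[OF fixd] unfolding l_def by blast
    assume ext: "rotmax \<mu> = of_int j * pi \<or> rotmin \<mu> = of_int j * pi"
    have "1 / l - l = 0"
    proof (rule ccontr)
      assume k: "1 / l - l \<noteq> 0"
      obtain t where t: "0 < t" "t < pi" "(1 / l - l) * cos t - C * sin t > 0"
        using trig_linear_form_sign_changes(1)[OF k] by blast
      obtain t' where t': "0 < t'" "t' < pi" "(1 / l - l) * cos t' - C * sin t' < 0"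
        using trig_linear_form_sign_changes(2)[OF k] by blast
      have "rot \<mu> (y + t) > of_int j * pi" "rot \<mu> (y + t') < of_int j * pi"
        using C[OF t(1,2)] C[OF t'(1,2)] t(3) t'(3) by (auto simp: sgn_if split: if_splits)
      then show False
        using ext rot_le_rotmax[of \<mu> "y + t"] rotmin_le_rot[of \<mu> "y + t'"] by auto
    qed
    then have "(l - 1) * (l + 1) = 0" using l0 by (simp add: field_simps)
    then show "growth \<mu> y = 1" using l0 by (simp add: l_def)
  qed
qed

text \<open>Two independent eigenvectors make the monodromy map a multiple of the identity.\<close>

lemma rot_const_if_two_eigendirections:
  assumes fixd: "rot \<mu> y = of_int j * pi" and g: "growth \<mu> y = 1"
    and two: "0 < t" "t < pi" "rot \<mu> (y + t) = of_int j * pi"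
  shows "rot \<mu> z = of_int j * pi"
proof -
  obtain e where e: "\<And>t. 0 < t \<Longrightarrow> t < pi \<Longrightarrow> sgn (rot \<mu> (y + t) - of_int j * pi) = e"
    "\<And>z. rot \<mu> z = of_int j * pi \<or> sgn (rot \<mu> z - of_int j * pi) = e"
    by (rule rot_side_if_growth_1[OF fixd g], rule that, assumption+)
  have "e = 0" using e(1)[OF two(1,2)] two(3) by simp
  then show ?thesis using e(2)[of z] by (simp add: sgn_0_0)
qed

end

section \<open>Eigenvalues and their multiplicities\<close>

context hill_rotation
begin

lemma hill_solution_iff_lin_solution:
  "hill_solution a \<mu> {0..T} u v \<longleftrightarrow> lin_solution (pot \<mu>) 0 T u v"
  using hill_solution_imp_lin_solution[of a \<mu> "{0..T}" u v 0 T] lin_solution_imp_hill_solution[of \<mu> a 0 T u v]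
  by (auto simp: pot_def)

text \<open>
  The Wronskians with two independent solutions vanish, which determines the pair \<open>(u, v)\<close>.
\<close>

lemma lin_solution_zero:
  assumes l: "lin_solution (pot \<mu>) 0 T u v" and z: "u 0 = 0" "v 0 = 0" and x: "x \<in> {0..T}"
  shows "u x = 0" "v x = 0"
proof -
  let ?u0 = "usol \<mu> 0 x" and ?v0 = "vsol \<mu> 0 x" and ?u1 = "usol \<mu> (pi/2) x" and ?v1 = "vsol \<mu> (pi/2) x"
  have W: "?u0 * ?v1 - ?v0 * ?u1 = - 1 / w"
    using wronskian_const[OF sol_lin[of \<mu> 0] sol_lin[of \<mu> "pi/2"] x] by (simp add: sol_start)
  have 0: "u x * ?v0 - v x * ?u0 = 0"
    using wronskian_const[OF l sol_lin[of \<mu> 0] x] z by simp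
  have 1: "u x * ?v1 - v x * ?u1 = 0"
    using wronskian_const[OF l sol_lin[of \<mu> "pi/2"] x] z by simp
  have "u x * (?u0 * ?v1 - ?v0 * ?u1) = ?u0 * (u x * ?v1 - v x * ?u1) - ?u1 * (u x * ?v0 - v x * ?u0)"
    by (simp add: algebra_simps)
  then show "u x = 0" using w_pos by (simp only: W 0 1) simp
  have "v x * (?u0 * ?v1 - ?v0 * ?u1) = ?v0 * (u x * ?v1 - v x * ?u1) - ?v1 * (u x * ?v0 - v x * ?u0)"
    by (simp add: algebra_simps)
  then show "v x = 0" using w_pos by (simp only: W 0 1) simp
qed

lemma lin_solution_eqI:
  assumes l1: "lin_solution (pot \<mu>) 0 T u1 v1" and l2: "lin_solution (pot \<mu>) 0 T u2 v2"
    and "u1 0 = u2 0" "v1 0 = v2 0" and x: "x \<in> {0..T}"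
  shows "u1 x = u2 x" "v1 x = v2 x"
  using lin_solution_zero[OF lin_solution_combine[OF l1 l2, of 1 "-1"] _ _ x] assms by auto

lemma cos_sin_shift_pi:
  fixes j :: int
  shows "cos (x + of_int j * pi) * cos (of_int j * pi) = cos x"
    and "sin (x + of_int j * pi) * cos (of_int j * pi) = sin x"
proof -
  have s: "sin (of_int j * pi) = 0" by (simp add: sin_zero_iff_int2)
  then have "(cos (of_int j * pi))\<^sup>2 = 1" by (simp add: cos_squared_eq)
  then show "cos (x + of_int j * pi) * cos (of_int j * pi) = cos x"
    "sin (x + of_int j * pi) * cos (of_int j * pi) = sin x"
    by (simp_all add: cos_add sin_add s power2_eq_square mult.assoc)
qed

text \<open>Polar coordinates of the initial data, with the direction chosen in a prescribed half-turn.\<close>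

lemma lin_solution_polar:
  assumes l: "lin_solution (pot \<mu>) 0 T u v"
  obtains c y where "y0 \<le> y" "y < y0 + pi"
    "\<And>x. x \<in> {0..T} \<Longrightarrow> u x = c * usol \<mu> y x" "\<And>x. x \<in> {0..T} \<Longrightarrow> v x = c * vsol \<mu> y x"
proof -
  obtain r z where r: "v 0 = r * cos z" "w * u 0 = r * sin z" using polar_Ex by blast
  obtain j :: int where j: "z + of_int j * pi \<in> {y0..<y0 + pi}" by (rule reduce_mod_pi)
  define y where "y = z + of_int j * pi"
  define c where "c = r * cos (of_int j * pi)"
  have start: "u 0 = c * usol \<mu> y 0 + 0 * usol \<mu> y 0" "v 0 = c * vsol \<mu> y 0 + 0 * vsol \<mu> y 0"
    using r w_pos cos_sin_shift_pi[where x=z and j=j]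
    by (simp_all add: sol_start c_def y_def mult.assoc mult.commute[of _ "cos (of_int j * pi)"] field_simps)
  note eq = lin_solution_eqI[OF l lin_solution_combine[OF sol_lin[of \<mu> y] sol_lin[of \<mu> y], of c 0] start]
  show thesis by (rule that[of y c]) (use j eq in \<open>auto simp: y_def\<close>)
qed

text \<open>
  The eigenspaces consist of functions that vanish outside \<open>[0,T]\<close>.
\<close>

definition ext_sol :: "real \<Rightarrow> real \<Rightarrow> real \<Rightarrow> real" where
  "ext_sol \<mu> y x = (if x \<in> {0..T} then usol \<mu> y x else 0)"

lemma ext_sol_nonzero: "ext_sol \<mu> y \<noteq> (\<lambda>x. 0)"
proof
  assume z: "ext_sol \<mu> y = (\<lambda>x. 0)"
  have uz: "usol \<mu> y x = 0" if "x \<in> {0..T}" for x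
    using fun_cong[OF z, of x] that by (simp add: ext_sol_def)
  have "hill_solution a \<mu> {0..T} (usol \<mu> y) (vsol \<mu> y)"
    by (simp only: hill_solution_iff_lin_solution sol_lin)
  then have "(usol \<mu> y has_real_derivative vsol \<mu> y 0) (at 0 within {0..T})"
    using T_pos by (simp add: hill_solution_def)
  moreover have "(usol \<mu> y has_real_derivative 0) (at 0 within {0..T})"
    by (rule has_field_derivative_transform_within[of "\<lambda>_. 0" _ _ _ 1]) (use uz T_pos in auto)
  moreover have "at (0::real) within {0..T} \<noteq> bot"
    using T_pos by (simp add: trivial_limit_within islimpt_Icc)
  ultimately have "vsol \<mu> y 0 = 0" using has_field_derivative_unique by blast
  then have "cos y = 0" "sin y = 0" using uz[of 0] T_pos w_pos by (auto simp: sol_start)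
  then show False using sin_cos_squared_add[of y] by simp
qed

definition eigendirection :: "nat \<Rightarrow> real \<Rightarrow> real \<Rightarrow> bool" where
  "eigendirection s \<mu> y \<longleftrightarrow> growth \<mu> y = 1 \<and> (\<exists>i::nat. even (i + s) \<and> rot \<mu> y = real i * pi)"

text \<open>
  The parity of the number of half-turns gives the sign of the boundary condition. That number is natural because
  no direction turns by \<open>- \<pi>\<close> or less.
\<close>

lemma eigendirection_iff_boundary_condition:
  "eigendirection s \<mu> y \<longleftrightarrow>
    usol \<mu> y 0 - (- 1) ^ s * usol \<mu> y T = 0 \<and> vsol \<mu> y 0 - (- 1) ^ s * vsol \<mu> y T = 0"
proof -
  define \<sigma> :: real where "\<sigma> = (- 1) ^ s"
  define \<Phi> where "\<Phi> = endang \<mu> y"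
  define \<rho> where "\<rho> = growth \<mu> y"
  have \<sigma>2: "\<sigma> * \<sigma> = 1" by (simp add: \<sigma>_def power_add[symmetric])
  have \<rho>0: "\<rho> > 0" by (simp add: \<rho>_def growth_pos)
  have bc: "usol \<mu> y 0 - \<sigma> * usol \<mu> y T = 0 \<and> vsol \<mu> y 0 - \<sigma> * vsol \<mu> y T = 0 \<longleftrightarrow>
      sin y = \<sigma> * \<rho> * sin \<Phi> \<and> cos y = \<sigma> * \<rho> * cos \<Phi>"
    using w_pos by (auto simp: sol_start sol_end \<Phi>_def \<rho>_def field_simps)
  have "eigendirection s \<mu> y \<longleftrightarrow> sin y = \<sigma> * \<rho> * sin \<Phi> \<and> cos y = \<sigma> * \<rho> * cos \<Phi>"
  proof
    assume "eigendirection s \<mu> y"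
    then obtain i :: nat where i: "\<rho> = 1" "even (i + s)" "\<Phi> = y + real i * pi"
      by (auto simp: eigendirection_def rot_def \<rho>_def \<Phi>_def algebra_simps)
    have "(- 1 :: real) ^ i = \<sigma>" using i(2) by (simp add: \<sigma>_def minus_one_power_iff)
    then show "sin y = \<sigma> * \<rho> * sin \<Phi> \<and> cos y = \<sigma> * \<rho> * cos \<Phi>"
      using i(1) \<sigma>2 by (simp add: i(3) sin_add cos_add mult.assoc[symmetric])
  next
    assume sc: "sin y = \<sigma> * \<rho> * sin \<Phi> \<and> cos y = \<sigma> * \<rho> * cos \<Phi>"
    have "1 = (sin y)\<^sup>2 + (cos y)\<^sup>2" by simp
    also have "\<dots> = (\<sigma> * \<rho> * sin \<Phi>)\<^sup>2 + (\<sigma> * \<rho> * cos \<Phi>)\<^sup>2" using sc by simp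
    also have "\<dots> = (\<sigma> * \<sigma>) * \<rho>\<^sup>2 * ((sin \<Phi>)\<^sup>2 + (cos \<Phi>)\<^sup>2)" by algebra
    finally have "\<rho>\<^sup>2 = 1" by (simp add: \<sigma>2)
    then have \<rho>1: "\<rho> = 1" using \<rho>0 by (simp add: power2_eq_1_iff)
    have "sin (\<Phi> - y) = 0" using sc by (simp add: sin_diff)
    then obtain j :: int where j: "\<Phi> - y = of_int j * pi" by (auto simp: sin_zero_iff_int2)
    have "of_int j * pi > - 1 * pi" using rot_greater[of \<mu> y] j by (simp add: rot_def \<Phi>_def)
    then have "j > -1" by (simp only: mult_less_cancel_right_pos[OF pi_gt_zero])
    then obtain i :: nat where i: "j = int i" using zero_le_imp_eq_int[of j] by auto
    have r: "rot \<mu> y = real i * pi" using j i by (simp add: rot_def \<Phi>_def)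
    have "cos (\<Phi> - y) = cos \<Phi> * (\<sigma> * cos \<Phi>) + sin \<Phi> * (\<sigma> * sin \<Phi>)"
      using sc \<rho>1 by (simp add: cos_diff)
    also have "\<dots> = \<sigma> * ((sin \<Phi>)\<^sup>2 + (cos \<Phi>)\<^sup>2)" by algebra
    finally have "(- 1) ^ i = \<sigma>" using j i by simp
    then have "even (i + s)" by (auto simp: \<sigma>_def minus_one_power_iff split: if_splits)
    then show "eigendirection s \<mu> y" using r \<rho>1 by (auto simp: eigendirection_def \<rho>_def)
  qed
  then show ?thesis using bc by (simp add: \<sigma>_def)
qed

abbreviation eigenspace :: "nat \<Rightarrow> real \<Rightarrow> (real \<Rightarrow> real) set" where
  "eigenspace s \<equiv> hill_eigenspace T a ((- 1) ^ s)"

lemma eigenspace_elim: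
  assumes "u \<in> eigenspace s \<mu>"
  obtains c y where "y0 \<le> y" "y < y0 + pi" "u = fun_scale c (ext_sol \<mu> y)" "c = 0 \<or> eigendirection s \<mu> y"
proof -
  obtain v where out: "\<And>x. x \<notin> {0..T} \<Longrightarrow> u x = 0" and l: "lin_solution (pot \<mu>) 0 T u v"
    and bc: "u 0 - (- 1) ^ s * u T = 0" "v 0 - (- 1) ^ s * v T = 0"
    using assms by (auto simp: hill_eigenspace_def hill_solution_iff_lin_solution)
  obtain c y where y: "y0 \<le> y" "y < y0 + pi" and u: "\<And>x. x \<in> {0..T} \<Longrightarrow> u x = c * usol \<mu> y x"
    and v: "\<And>x. x \<in> {0..T} \<Longrightarrow> v x = c * vsol \<mu> y x"
    using lin_solution_polar[OF l] by metis
  have "u = fun_scale c (ext_sol \<mu> y)"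
    using out u by (auto simp: fun_scale_def ext_sol_def fun_eq_iff)
  moreover have "eigendirection s \<mu> y" if "c \<noteq> 0"
  proof -
    have "c * (usol \<mu> y 0 - (- 1) ^ s * usol \<mu> y T) = 0" "c * (vsol \<mu> y 0 - (- 1) ^ s * vsol \<mu> y T) = 0"
      using bc u[OF T_mem(1)] u[OF T_mem(2)] v[OF T_mem(1)] v[OF T_mem(2)] by (simp_all add: algebra_simps)
    then show ?thesis using that by (simp add: eigendirection_iff_boundary_condition)
  qed
  ultimately show thesis using y that by blast
qed

lemma eigenspace_intro:
  assumes e: "eigendirection s \<mu> y"
  shows "fun_scale c (ext_sol \<mu> y) \<in> eigenspace s \<mu>"
proof -
  define u where u: "u = fun_scale c (ext_sol \<mu> y)"
  have ux: "u x = c * usol \<mu> y x" if "x \<in> {0..T}" for x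
    using that u by (simp add: fun_scale_def ext_sol_def)
  have "lin_solution (pot \<mu>) 0 T (\<lambda>x. c * usol \<mu> y x + 0 * usol \<mu> y x) (\<lambda>x. c * vsol \<mu> y x + 0 * vsol \<mu> y x)"
    by (rule lin_solution_combine[OF sol_lin sol_lin])
  then have A: "ac_deriv 0 T (\<lambda>x. c * usol \<mu> y x) (\<lambda>x. c * vsol \<mu> y x)"
    and B: "ac_deriv 0 T (\<lambda>x. c * vsol \<mu> y x) (\<lambda>x. - pot \<mu> x * (c * usol \<mu> y x))"
    by (simp_all add: lin_solution_def)
  have "ac_deriv 0 T u (\<lambda>x. c * vsol \<mu> y x)"
    using A by (rule ac_deriv_cong) (simp_all only: ux)
  moreover have "ac_deriv 0 T (\<lambda>x. c * vsol \<mu> y x) (\<lambda>x. - pot \<mu> x * u x)"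
    using B by (rule ac_deriv_cong) (simp_all only: ux)
  ultimately have "lin_solution (pot \<mu>) 0 T u (\<lambda>x. c * vsol \<mu> y x)" by (simp add: lin_solution_def)
  moreover have "c * (usol \<mu> y 0 - (- 1) ^ s * usol \<mu> y T) = 0" "c * (vsol \<mu> y 0 - (- 1) ^ s * vsol \<mu> y T) = 0"
    using e by (auto simp: eigendirection_iff_boundary_condition)
  then have "u 0 - (- 1) ^ s * u T = 0" "c * vsol \<mu> y 0 - (- 1) ^ s * (c * vsol \<mu> y T) = 0"
    using ux[OF T_mem(1)] ux[OF T_mem(2)] by (simp_all add: algebra_simps)
  moreover have "u x = 0" if "x \<notin> {0..T}" for x using that u by (auto simp: fun_scale_def ext_sol_def)
  ultimately show "fun_scale c (ext_sol \<mu> y) \<in> eigenspace s \<mu>"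
    unfolding hill_eigenspace_def hill_solution_iff_lin_solution u[symmetric] by blast
qed

text \<open>
  The list of eigenvalues for the sign \<open>(- 1) ^ s\<close> is indexed so that entry \<open>i\<close> is the parameter at which
  \<open>rotmin\<close> equals \<open>i \<pi>\<close>, if \<open>i\<close> has the parity of \<open>s\<close>, and at which \<open>rotmax\<close> equals \<open>(i + 1) \<pi>\<close> otherwise.
\<close>

definition entry_at :: "nat \<Rightarrow> real \<Rightarrow> nat set" where
  "entry_at s \<mu> = {i. (even (i + s) \<and> rotmin \<mu> = real i * pi) \<or> (odd (i + s) \<and> rotmax \<mu> = real (i + 1) * pi)}"

definition entries_upto :: "nat \<Rightarrow> real \<Rightarrow> nat set" where
  "entries_upto s \<mu> = {i. (even (i + s) \<and> real i * pi \<le> rotmin \<mu>) \<or> (odd (i + s) \<and> real (i + 1) * pi \<le> rotmax \<mu>)}"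

text \<open>
  The thresholds interlace because \<open>rotmin \<le> rotmax < rotmin + \<pi>\<close>.
\<close>

lemma entries_upto_downward:
  assumes "i \<in> entries_upto s \<mu>" "k \<le> i"
  shows "k \<in> entries_upto s \<mu>"
proof (cases "k = i")
  case False
  then have k: "k + 1 \<le> i" using assms by simp
  have le: "real m * pi \<le> real n * pi" if "m \<le> n" for m n :: nat
    using that by (intro mult_right_mono) auto
  have i1: "real (i + 1) * pi = real i * pi + pi" by (simp add: algebra_simps)
  consider "even (i + s)" "real i * pi \<le> rotmin \<mu>" | "odd (i + s)" "real (i + 1) * pi \<le> rotmax \<mu>"
    using assms by (auto simp: entries_upto_def)
  then show ?thesis
  proof cases
    case 1
    have "real k * pi \<le> rotmin \<mu>" "real (k + 1) * pi \<le> rotmax \<mu>"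
      using 1 le[of k i] le[OF k] k rotmin_le_rotmax[of \<mu>] by linarith+
    then show ?thesis by (cases "even (k + s)") (simp_all add: entries_upto_def)
  next
    case 2
    have "real k * pi \<le> rotmin \<mu>" "real (k + 1) * pi \<le> rotmax \<mu>"
      using 2 i1 le[of k i] le[OF k] k rotmax_less[of \<mu>] pi_gt_zero by linarith+
    then show ?thesis by (cases "even (k + s)") (simp_all add: entries_upto_def)
  qed
qed (use assms in simp)

lemma finite_entries_upto: "finite (entries_upto s \<mu>)"
proof -
  have "entries_upto s \<mu> \<subseteq> {..nat \<lceil>rotmax \<mu> / pi\<rceil>}"
  proof
    fix i assume "i \<in> entries_upto s \<mu>"
    then have "real i * pi \<le> rotmin \<mu> \<or> real (i + 1) * pi \<le> rotmax \<mu>" by (auto simp: entries_upto_def)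
    moreover have "real (i + 1) * pi = real i * pi + pi" by (simp add: algebra_simps)
    ultimately have "real i * pi \<le> rotmax \<mu>" using rotmin_le_rotmax[of \<mu>] pi_gt_zero by linarith
    then have "real i \<le> rotmax \<mu> / pi" by (simp add: pos_le_divide_eq)
    then show "i \<in> {..nat \<lceil>rotmax \<mu> / pi\<rceil>}" by (simp add: le_nat_iff) linarith
  qed
  then show ?thesis using finite_subset by blast
qed

lemma entry_at_subset: "entry_at s \<mu> \<subseteq> entries_upto s \<mu>"
  by (auto simp: entry_at_def entries_upto_def)

lemma finite_entry_at: "finite (entry_at s \<mu>)"
  using entry_at_subset finite_entries_upto finite_subset by blast

text \<open>
  If the extremal value \<open>i \<pi>\<close> is the minimum, the entry is \<open>i\<close>; if it is the maximum, which is positive, the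
  entry is \<open>i - 1\<close>.
\<close>

lemma eigendirection_imp_entry:
  assumes e: "eigendirection s \<mu> y"
  shows "entry_at s \<mu> \<noteq> {}"
proof -
  obtain i :: nat where i: "growth \<mu> y = 1" "even (i + s)" "rot \<mu> y = of_int (int i) * pi"
    using e by (auto simp: eigendirection_def)
  then have "rotmax \<mu> = real i * pi \<or> rotmin \<mu> = real i * pi"
    using growth_eq_1_iff_extremal[OF i(3)] by simp
  then show ?thesis
  proof
    assume m: "rotmax \<mu> = real i * pi"
    then have "i > 0" using rotmax_pos[of \<mu>] by (cases i) auto
    then have "i - 1 \<in> entry_at s \<mu>" using m i(2) by (auto simp: entry_at_def of_nat_diff)
    then show ?thesis by blast
  next
    assume "rotmin \<mu> = real i * pi"
    then have "i \<in> entry_at s \<mu>" using i(2) by (auto simp: entry_at_def)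
    then show ?thesis by blast
  qed
qed

lemma entry_imp_eigendirection:
  assumes "entry_at s \<mu> \<noteq> {}"
  obtains y where "eigendirection s \<mu> y"
proof -
  obtain i where "i \<in> entry_at s \<mu>" using assms by blast
  then consider "even (i + s)" "rotmin \<mu> = real i * pi" | "even (i + 1 + s)" "rotmax \<mu> = real (i + 1) * pi"
    by (auto simp: entry_at_def)
  then show thesis
  proof cases
    case 1
    obtain y where y: "rot \<mu> y = rotmin \<mu>" by (rule rotmin_attained)
    then have "growth \<mu> y = 1" using growth_eq_1_iff_extremal[of \<mu> y "int i"] 1 by simp
    then show thesis using that[of y] y 1 by (auto simp: eigendirection_def)
  next
    case 2
    obtain y where y: "rot \<mu> y = rotmax \<mu>" by (rule rotmax_attained)
    then have "growth \<mu> y = 1" using growth_eq_1_iff_extremal[of \<mu> y "int (i + 1)"] 2 by simp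
    then show thesis using that[of y] y 2 unfolding eigendirection_def by metis
  qed
qed

lemma hill_eigenvalue_iff_entry: "hill_eigenvalue T a ((- 1) ^ s) \<mu> \<longleftrightarrow> entry_at s \<mu> \<noteq> {}"
proof
  assume "hill_eigenvalue T a ((- 1) ^ s) \<mu>"
  then obtain u where u: "u \<in> eigenspace s \<mu>" "u \<noteq> (\<lambda>x. 0)"
    by (auto simp: hill_eigenvalue_def)
  obtain c y where "u = fun_scale c (ext_sol \<mu> y)" "c = 0 \<or> eigendirection s \<mu> y"
    using u(1) by (rule eigenspace_elim)
  then have "eigendirection s \<mu> y" using u(2) by (auto simp: fun_scale_def)
  then show "entry_at s \<mu> \<noteq> {}" by (rule eigendirection_imp_entry)
next
  assume "entry_at s \<mu> \<noteq> {}"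
  then obtain y where y: "eigendirection s \<mu> y" by (rule entry_imp_eigendirection)
  have "ext_sol \<mu> y \<in> eigenspace s \<mu>"
    using eigenspace_intro[OF y, of 1] by (simp add: fun_scale_def)
  then show "hill_eigenvalue T a ((- 1) ^ s) \<mu>"
    using ext_sol_nonzero unfolding hill_eigenvalue_def by blast
qed

text \<open>
  Two eigendirections turn by multiples of \<open>\<pi>\<close> of the same parity that differ by less than \<open>\<pi>\<close>, hence by the
  same multiple, and \<open>rot_const_if_two_eigendirections\<close> applies.
\<close>

lemma eigendirections_unique_or_all:
  assumes e: "eigendirection s \<mu> y" and e': "eigendirection s \<mu> z" and ab: "y < z" "z < y + pi"
  obtains i where "rotmin \<mu> = real (i + 1) * pi" "rotmax \<mu> = real (i + 1) * pi" "odd (i + s)"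
proof -
  obtain i where i: "growth \<mu> y = 1" "even (i + s)" "rot \<mu> y = of_int (int i) * pi"
    using e by (auto simp: eigendirection_def)
  obtain k where k: "even (k + s)" "rot \<mu> z = real k * pi"
    using e' by (auto simp: eigendirection_def)
  have "\<bar>real k * pi - real i * pi\<bar> < 1 * pi" using rot_diff_less_pi[of \<mu> z y] i k by simp
  then have "\<bar>real k - real i\<bar> * pi < 1 * pi" by (simp add: left_diff_distrib[symmetric] abs_mult)
  then have "\<bar>real k - real i\<bar> < 1" by (simp only: mult_less_cancel_right_pos[OF pi_gt_zero])
  then have "k = i" by linarith
  then have two: "rot \<mu> (y + (z - y)) = of_int (int i) * pi" using k by simp
  have const: "rot \<mu> \<gamma> = real i * pi" for \<gamma>
    using rot_const_if_two_eigendirections[OF i(3,1) _ _ two, of \<gamma>] ab by simp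
  have mm: "rotmin \<mu> = real i * pi" "rotmax \<mu> = real i * pi"
    using rotmin_attained[of \<mu>] rotmax_attained[of \<mu>] const by metis+
  then have "i > 0" using rotmax_pos[of \<mu>] by (cases i) auto
  then show thesis using mm i(2) by (intro that[of "i - 1"]) (auto simp: of_nat_diff)
qed

text \<open>
  Entries of both parities occur together only if \<open>rotmin = rotmax\<close>, when all solutions are eigenfunctions and the
  solutions of directions \<open>0\<close> and \<open>\<pi>/2\<close> form a basis. With one entry, two eigendirections in a half-turn
  would produce a second one, so the eigenspace is a line.
\<close>

lemma multiplicity_eq_card_entry:
  assumes ne: "entry_at s \<mu> \<noteq> {}"
  shows "hill_multiplicity T a ((- 1) ^ s) \<mu> = card (entry_at s \<mu>)"
proof -
  interpret fs: vector_space fun_scale by (rule vector_space_fun_scale)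
  let ?E = "eigenspace s \<mu>"
  show ?thesis
  proof (cases "\<exists>i k. i \<in> entry_at s \<mu> \<and> even (i + s) \<and> k \<in> entry_at s \<mu> \<and> odd (k + s)")
    case True
    then obtain i k where i: "even (i + s)" "rotmin \<mu> = real i * pi"
      and k: "odd (k + s)" "rotmax \<mu> = real (k + 1) * pi" by (auto simp: entry_at_def)
    have "real i * pi \<le> real (k + 1) * pi" using rotmin_le_rotmax[of \<mu>] i k by simp
    then have le: "i \<le> k + 1" by (simp only: mult_le_cancel_right_pos[OF pi_gt_zero] of_nat_le_iff)
    have "real (k + 1) * pi < real (i + 1) * pi" using rotmax_less[of \<mu>] i k by (simp add: distrib_right)
    then have "k + 1 < i + 1" by (simp only: mult_less_cancel_right_pos[OF pi_gt_zero] of_nat_less_iff)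
    with le have ik: "i = k + 1 \<or> i = k" by auto
    then have ik: "i = k + 1" using i k by auto
    have mm: "rotmin \<mu> = real (k + 1) * pi" "rotmax \<mu> = real (k + 1) * pi" using i k ik by auto
    have "entry_at s \<mu> = {k, k + 1}"
    proof (intro equalityI subsetI)
      fix n assume "n \<in> entry_at s \<mu>"
      then have "real (k + 1) * pi = real n * pi \<or> real (k + 1) * pi = real (n + 1) * pi"
        by (auto simp: entry_at_def mm)
      then have "real (k + 1) = real n \<or> real (k + 1) = real (n + 1)"
        using pi_neq_zero by (simp only: mult_cancel_right) simp
      then show "n \<in> {k, k + 1}" by auto
    qed (use i k ik mm in \<open>auto simp: entry_at_def\<close>)
    then have c2: "card (entry_at s \<mu>) = 2" by simp
    have all: "eigendirection s \<mu> y" for y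
    proof -
      have r: "rot \<mu> y = of_int (int (k + 1)) * pi"
        using rotmin_le_rot[of \<mu> y] rot_le_rotmax[of \<mu> y] mm by simp
      then have "growth \<mu> y = 1" using growth_eq_1_iff_extremal[OF r] mm by simp
      then show ?thesis unfolding eigendirection_def using r k by (intro conjI exI[of _ "k + 1"]) auto
    qed
    let ?b0 = "ext_sol \<mu> 0" and ?b1 = "ext_sol \<mu> (pi/2)"
    have E: "?E = fs.span {?b0, ?b1}"
    proof (intro equalityI subsetI)
      fix u assume "u \<in> ?E"
      then obtain c y where u: "u = fun_scale c (ext_sol \<mu> y)" by (rule eigenspace_elim)
      have "usol \<mu> y x = cos y * usol \<mu> 0 x + sin y * usol \<mu> (pi/2) x" if "x \<in> {0..T}" for x
        by (rule lin_solution_eqI(1)[OF sol_lin lin_solution_combine[OF sol_lin[of \<mu> 0] sol_lin[of \<mu> "pi/2"]] _ _ that])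
          (simp_all add: sol_start)
      then have "u = fun_scale (c * cos y) ?b0 + fun_scale (c * sin y) ?b1"
        unfolding u by (auto simp: fun_scale_def ext_sol_def fun_eq_iff plus_fun_def algebra_simps)
      then show "u \<in> fs.span {?b0, ?b1}"
        by (simp add: fs.span_add fs.span_scale fs.span_base)
    next
      fix u assume "u \<in> fs.span {?b0, ?b1}"
      then obtain c d where "u - fun_scale c ?b0 = fun_scale d ?b1"
        by (auto simp: fs.span_insert[of ?b0 "{?b1}"] fs.span_singleton)
      then have u: "u x = c * ext_sol \<mu> 0 x + d * ext_sol \<mu> (pi/2) x" for x
        by (auto simp: fun_eq_iff fun_scale_def fun_diff_def algebra_simps dest: spec[of _ x])
      obtain e y where e: "0 \<le> y" "y < 0 + pi"
        "\<And>x. x \<in> {0..T} \<Longrightarrow> c * usol \<mu> 0 x + d * usol \<mu> (pi/2) x = e * usol \<mu> y x"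
        using lin_solution_polar[OF lin_solution_combine[OF sol_lin[of \<mu> 0] sol_lin[of \<mu> "pi/2"], of c d], of 0] by metis
      then have "u = fun_scale e (ext_sol \<mu> y)"
        using u by (auto simp: fun_scale_def ext_sol_def fun_eq_iff)
      then show "u \<in> ?E" using eigenspace_intro[OF all] by simp
    qed
    have ne: "?b1 \<noteq> fun_scale c ?b0" for c
    proof
      assume "?b1 = fun_scale c ?b0"
      from fun_cong[OF this, of 0] show False
        using T_pos w_pos by (simp add: fun_scale_def ext_sol_def sol_start)
    qed
    then have "?b1 \<noteq> ?b0" using ne[of 1] by (simp add: fun_scale_def)
    moreover have "?b1 \<notin> fs.span {?b0}" using ne by (auto simp: fs.span_singleton)
    moreover have "\<not> fs.dependent {?b0}" using ext_sol_nonzero[of \<mu> 0] by (simp add: fs.dependent_single zero_fun_def)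
    ultimately have "\<not> fs.dependent {?b1, ?b0}" by (simp add: fs.independent_insert)
    then have "fs.dim ?E = card {?b1, ?b0}"
      unfolding E by (subst insert_commute) (rule fs.dim_span_eq_card_independent)
    then show ?thesis using \<open>?b1 \<noteq> ?b0\<close> c2 by (simp add: hill_multiplicity_def)
  next
    case False
    obtain y where y: "eigendirection s \<mu> y" using ne by (rule entry_imp_eigendirection)
    have inj: "i = k" if ik: "i \<in> entry_at s \<mu>" "k \<in> entry_at s \<mu>" for i k
    proof -
      have "even (i + s) \<longleftrightarrow> even (k + s)" using False ik by blast
      then have "real i * pi = real k * pi \<or> real (i + 1) * pi = real (k + 1) * pi"
        using ik by (auto simp: entry_at_def)
      then show ?thesis using pi_neq_zero by (simp only: mult_cancel_right) simp
    qed
    obtain i where "i \<in> entry_at s \<mu>" using ne by blast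
    then have "entry_at s \<mu> = {i}" using inj by blast
    then have c1: "card (entry_at s \<mu>) = 1" by simp
    have E: "?E = fs.span {ext_sol \<mu> y}"
    proof (intro equalityI subsetI)
      fix u assume "u \<in> ?E"
      then obtain c z where u: "y \<le> z" "z < y + pi" "u = fun_scale c (ext_sol \<mu> z)" "c = 0 \<or> eigendirection s \<mu> z"
        by (rule eigenspace_elim)
      have "z = y" if z: "eigendirection s \<mu> z"
      proof (rule ccontr)
        assume "z \<noteq> y"
        then have "y < z" using u by simp
        then obtain k where k: "rotmin \<mu> = real (k + 1) * pi" "rotmax \<mu> = real (k + 1) * pi" "odd (k + s)"
          using eigendirections_unique_or_all[OF y z _ u(2)] by blast
        then have "k \<in> entry_at s \<mu>" "k + 1 \<in> entry_at s \<mu>" by (auto simp: entry_at_def)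
        then show False using inj[of k "k + 1"] by simp
      qed
      then show "u \<in> fs.span {ext_sol \<mu> y}"
        using u by (auto simp: fs.span_singleton fun_scale_def fun_eq_iff)
    next
      fix u assume "u \<in> fs.span {ext_sol \<mu> y}"
      then obtain c where u: "u = fun_scale c (ext_sol \<mu> y)" by (auto simp: fs.span_singleton)
      then show "u \<in> ?E" using eigenspace_intro[OF y] by simp
    qed
    have "\<not> fs.dependent {ext_sol \<mu> y}" using ext_sol_nonzero[of \<mu> y] by (simp add: fs.dependent_single zero_fun_def)
    then have "fs.dim ?E = card {ext_sol \<mu> y}" unfolding E by (rule fs.dim_span_eq_card_independent)
    then show ?thesis using c1 by (simp add: hill_multiplicity_def)
  qed
qed

text \<open>
  With \<open>g = C x - \<integral> a\<close>, the positive function \<open>exp (\<integral> g)\<close> solves the equation with potential \<open>a - C - g\<^sup>2\<close>.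
  Its angle \<open>\<pi>/2 - arctan (g / w)\<close> ends below where it started, and dominates the angle for
  \<open>\<mu> = - C - G\<^sup>2\<close>, where \<open>G\<close> bounds \<open>\<bar>g\<bar>\<close>.
\<close>

lemma rotmin_neg_exists: "\<exists>\<nu>. rotmin \<nu> < 0"
proof -
  define Ia where "Ia x = integral {0..x} a" for x
  \<comment> \<open>This value makes \<open>g T = T > 0 = g 0\<close>.\<close>
  define C where "C = Ia T / T + 1"
  define g where "g x = C * (x - 0) - Ia x" for x
  have g: "ac_deriv 0 T g (\<lambda>x. C - a x)"
    unfolding g_def Ia_def by (intro ac_deriv_diff ac_deriv_linear ac_deriv_integral a_int)
  have g0: "g 0 = 0" by (simp add: g_def Ia_def)
  have gT: "g T > 0" using T_pos by (simp add: g_def C_def algebra_simps)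
  have "bounded (g ` {0..T})"
    by (intro compact_imp_bounded compact_continuous_image ac_deriv_continuous[OF g]) auto
  then obtain G where "\<forall>y\<in>g ` {0..T}. norm y \<le> G" unfolding bounded_iff by blast
  then have G: "\<bar>g x\<bar> \<le> G" if "x \<in> {0..T}" for x using that by auto
  define \<nu> where "\<nu> = - C - G\<^sup>2"
  define h where "h y = pi/2 - arctan (y / w)" for y
  define h' where "h' y = - (1 / w) / (1 + (y / w)\<^sup>2)" for y
  have h: "(h has_real_derivative h' y) (at y)" for y
  proof -
    have d: "((\<lambda>y. y / w) has_real_derivative 1 / w) (at y)"
      using DERIV_cdivide[OF DERIV_ident, of w] by simp
    have "((\<lambda>y. pi/2 - arctan (y / w)) has_real_derivative 0 - inverse (1 + (y / w)\<^sup>2) * (1 / w)) (at y)"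
      by (rule DERIV_diff[OF DERIV_const DERIV_chain2[OF DERIV_arctan d]])
    moreover have "0 - inverse (1 + (y / w)\<^sup>2) * (1 / w) = h' y"
      by (simp only: h'_def divide_inverse) simp
    ultimately show ?thesis by (simp only: h_def[abs_def])
  qed
  have nz: "1 + (y / w)\<^sup>2 \<noteq> 0" for y using zero_le_power2[of "y / w"] by linarith
  have ch': "continuous_on UNIV h'"
    unfolding h'_def[abs_def] using w_pos nz by (intro continuous_intros) auto
  have D: "ac_deriv 0 T (\<lambda>x. h (g x)) (\<lambda>x. h' (g x) * (C - a x))"
    by (rule ac_deriv_comp[OF g h ch'])
  have super: "angle_rhs w (pot \<nu>) x (h (g x)) \<le> h' (g x) * (C - a x)" if x: "x \<in> {0..T}" for x
  proof -
    define y where "y = g x / w"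
    define N where "N = 1 + y\<^sup>2"
    have N0: "N > 0" using zero_le_power2[of y] unfolding N_def by linarith
    have sc: "(sin (h (g x)))\<^sup>2 = 1 / N" "(cos (h (g x)))\<^sup>2 = y\<^sup>2 / N"
      using N0 by (simp_all add: h_def y_def[symmetric] sin_diff cos_diff sin_arctan cos_arctan power_divide N_def)
    have "(g x)\<^sup>2 \<le> G\<^sup>2" using G[OF x] by (metis abs_ge_zero power2_abs power_mono)
    then have "w * y\<^sup>2 \<le> G\<^sup>2 / w" using w_pos by (simp add: y_def power_divide power2_eq_square field_simps)
    then have "w * y\<^sup>2 + (\<nu> + a x) / w \<le> (a x - C) / w"
      by (simp add: \<nu>_def add_divide_distrib diff_divide_distrib)
    then have "(w * y\<^sup>2 + (\<nu> + a x) / w) / N \<le> ((a x - C) / w) / N"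
      using N0 by (intro divide_right_mono) auto
    moreover have "angle_rhs w (pot \<nu>) x (h (g x)) = (w * y\<^sup>2 + (\<nu> + a x) / w) / N"
      by (simp add: angle_rhs_def sc pot_def add_divide_distrib)
    moreover have "h' (g x) * (C - a x) = ((a x - C) / w) / N"
      unfolding h'_def y_def[symmetric] N_def[symmetric] by (simp add: divide_inverse algebra_simps)
    ultimately show ?thesis by simp
  qed
  have "ang \<nu> (pi/2) T \<le> h (g T)"
    by (rule angle_compare(1)[OF w_pos pot_int ang_ac D _ _ T_mem(1)])
      (use super in \<open>auto simp: ang h_def g0\<close>)
  also have "h (g T) < pi/2" using gT w_pos by (simp add: h_def)
  finally have "rot \<nu> (pi/2) < 0" by (simp add: rot_def endang_def)
  then show ?thesis using rotmin_le_rot[of \<nu> "pi/2"] by (intro exI[of _ \<nu>]) simp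
qed

lemma entry_at_unique:
  assumes "i \<in> entry_at s \<mu>" "i \<in> entry_at s \<nu>"
  shows "\<mu> = \<nu>"
proof (rule ccontr)
  assume "\<mu> \<noteq> \<nu>"
  then consider "\<mu> < \<nu>" | "\<nu> < \<mu>" by linarith
  then have "rotmin \<mu> \<noteq> rotmin \<nu> \<and> rotmax \<mu> \<noteq> rotmax \<nu>"
  proof cases
    case 1
    from rotmin_strict_mono[OF this] rotmax_strict_mono[OF this] show ?thesis by simp
  next
    case 2
    from rotmin_strict_mono[OF this] rotmax_strict_mono[OF this] show ?thesis by simp
  qed
  then show False using assms by (auto simp: entry_at_def)
qed

lemma entry_at_exists:
  assumes "i \<in> entries_upto s \<mu>"
  shows "\<exists>\<nu>\<le>\<mu>. i \<in> entry_at s \<nu>"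
proof -
  obtain \<nu>0 where neg: "rotmin \<nu>0 < 0" using rotmin_neg_exists by blast
  have i0: "real i * pi \<ge> 0" "real (i + 1) * pi \<ge> 1 * pi" by (simp, intro mult_right_mono) auto
  consider "even (i + s)" "real i * pi \<le> rotmin \<mu>" | "odd (i + s)" "real (i + 1) * pi \<le> rotmax \<mu>"
    using assms by (auto simp: entries_upto_def)
  then show ?thesis
  proof cases
    case 1
    have "\<nu>0 \<le> \<mu>" using neg i0(1) 1(2) rotmin_strict_mono[of \<mu> \<nu>0] by linarith
    then obtain \<nu> where "\<nu> \<le> \<mu>" "rotmin \<nu> = real i * pi"
      using IVT'[of rotmin \<nu>0 "real i * pi" \<mu>] continuous_rotmin neg i0 1 by auto
    then show ?thesis using 1 by (auto simp: entry_at_def)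
  next
    case 2
    have neg': "rotmax \<nu>0 < pi" using neg rotmax_less[of \<nu>0] by simp
    have "\<nu>0 \<le> \<mu>" using neg' i0(2) 2(2) rotmax_strict_mono[of \<mu> \<nu>0] by linarith
    then obtain \<nu> where "\<nu> \<le> \<mu>" "rotmax \<nu> = real (i + 1) * pi"
      using IVT'[of rotmax \<nu>0 "real (i + 1) * pi" \<mu>] continuous_rotmax neg' i0(2) 2(2) by fastforce
    then show ?thesis using 2 by (auto simp: entry_at_def)
  qed
qed

lemma entry_at_upto_mono:
  assumes "i \<in> entry_at s \<nu>" "\<nu> \<le> \<mu>"
  shows "i \<in> entries_upto s \<mu>"
proof -
  have "rotmin \<nu> \<le> rotmin \<mu> \<and> rotmax \<nu> \<le> rotmax \<mu>"
  proof (cases "\<nu> = \<mu>")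
    case False
    then have "\<nu> < \<mu>" using assms(2) by simp
    from rotmin_strict_mono[OF this] rotmax_strict_mono[OF this] show ?thesis by simp
  qed simp
  then show ?thesis using assms(1) by (auto simp: entry_at_def entries_upto_def)
qed

text \<open>
  The sets \<open>entry_at s \<nu>\<close> for \<open>\<nu> \<le> \<mu>\<close> partition \<open>entries_upto s \<mu>\<close>: each threshold is reached, by the intermediate
  value theorem from below, and only once.
\<close>

lemma eigenvalue_count:
  "(\<Sum>\<nu> | hill_eigenvalue T a ((- 1) ^ s) \<nu> \<and> \<nu> \<le> \<mu>. hill_multiplicity T a ((- 1) ^ s) \<nu>) = card (entries_upto s \<mu>)"
proof -
  define N where "N = {\<nu>. entry_at s \<nu> \<noteq> {} \<and> \<nu> \<le> \<mu>}"
  have un: "entries_upto s \<mu> = (\<Union>\<nu>\<in>N. entry_at s \<nu>)"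
  proof (intro equalityI subsetI)
    fix i assume "i \<in> entries_upto s \<mu>"
    then obtain \<nu> where "\<nu> \<le> \<mu>" "i \<in> entry_at s \<nu>" using entry_at_exists by blast
    then show "i \<in> (\<Union>\<nu>\<in>N. entry_at s \<nu>)" unfolding N_def by blast
  next
    fix i assume "i \<in> (\<Union>\<nu>\<in>N. entry_at s \<nu>)"
    then show "i \<in> entries_upto s \<mu>" using entry_at_upto_mono unfolding N_def by blast
  qed
  have "\<forall>\<nu>\<in>N. \<exists>i. i \<in> entry_at s \<nu>" by (auto simp: N_def)
  then obtain e where e: "\<And>\<nu>. \<nu> \<in> N \<Longrightarrow> e \<nu> \<in> entry_at s \<nu>" by metis
  have "inj_on e N" using e entry_at_unique by (metis inj_onI)
  moreover have "e ` N \<subseteq> entries_upto s \<mu>" using e un by blast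
  ultimately have finN: "finite N" using finite_entries_upto by (metis finite_imageD finite_subset)
  have "(\<Sum>\<nu>\<in>N. hill_multiplicity T a ((- 1) ^ s) \<nu>) = (\<Sum>\<nu>\<in>N. card (entry_at s \<nu>))"
    by (intro sum.cong refl multiplicity_eq_card_entry) (auto simp: N_def)
  also have "\<dots> = card (entries_upto s \<mu>)"
    unfolding un by (intro card_UN_disjoint[symmetric] finN) (use finite_entry_at entry_at_unique in auto)
  finally show ?thesis by (simp add: N_def hill_eigenvalue_iff_entry)
qed

text \<open>
  Since the sets of entries are initial segments, more than \<open>p\<close> entries have been passed exactly when entry \<open>p\<close> has.
\<close>

lemma nth_eigenvalue_eq:
  assumes p: "p \<in> entry_at s \<mu>"
  shows "nth_eigenvalue T a ((- 1) ^ s) p = \<mu>"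
  unfolding nth_eigenvalue_def eigenvalue_count
  unfolding hill_eigenvalue_iff_entry
proof (rule Least_equality)
  have "{..p} \<subseteq> entries_upto s \<mu>"
    using entries_upto_downward p entry_at_subset by blast
  then have "card {..p} \<le> card (entries_upto s \<mu>)" by (rule card_mono[OF finite_entries_upto])
  then show "entry_at s \<mu> \<noteq> {} \<and> p < card (entries_upto s \<mu>)" using p by auto
next
  fix \<nu> assume \<nu>: "entry_at s \<nu> \<noteq> {} \<and> p < card (entries_upto s \<nu>)"
  show "\<mu> \<le> \<nu>"
  proof (rule ccontr)
    assume "\<not> \<mu> \<le> \<nu>"
    then have "p \<notin> entries_upto s \<nu>"
      using p rotmin_strict_mono[of \<nu> \<mu>] rotmax_strict_mono[of \<nu> \<mu>] by (auto simp: entry_at_def entries_upto_def)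
    then have "entries_upto s \<nu> \<subseteq> {..<p}"
      using entries_upto_downward by (meson lessThan_iff linorder_not_less subsetI)
    then have "card (entries_upto s \<nu>) \<le> card {..<p}" by (intro card_mono) auto
    then show False using \<nu> by simp
  qed
qed

text \<open>
  Both endpoints are entry \<open>p\<close> of a list: the left one for the sign \<open>(-1) ^ p\<close>, the right one for the
  opposite sign. The shift of the antiperiodic numbering by one is what makes these indices agree for all \<open>p\<close>.
\<close>

lemma zone_left_eq: "rotmin \<mu> = real p * pi \<Longrightarrow> zone_left T a p = \<mu>"
  using nth_eigenvalue_eq[of p p \<mu>]
  by (auto simp: zone_left_def per_eigenvalue_def antiper_eigenvalue_def entry_at_def)

lemma zone_right_eq: "rotmax \<mu> = real (p + 1) * pi \<Longrightarrow> zone_right T a p = \<mu>"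
  using nth_eigenvalue_eq[of p "p + 1" \<mu>]
  by (auto simp: zone_right_def per_eigenvalue_def antiper_eigenvalue_def entry_at_def)

end

section \<open>Bounds for a potential above a constant\<close>

lemma angle_minus_uniform_motion:
  assumes w: "w > 0" and \<phi>: "angle_solution w q A B \<phi>"
  shows "ac_deriv A B (\<lambda>x. \<phi> x - w * (x - 0)) (\<lambda>x. (q x - w\<^sup>2) / w * (sin (\<phi> x))\<^sup>2)"
proof -
  have "ac_deriv A B (\<lambda>x. \<phi> x - w * (x - 0)) (\<lambda>x. angle_rhs w q x (\<phi> x) - w)"
    using \<phi> unfolding angle_solution_def by (intro ac_deriv_diff ac_deriv_linear)
  moreover have "angle_rhs w q x y - w = (q x - w\<^sup>2) / w * (sin y)\<^sup>2" for x y
    using w unfolding angle_rhs_def cos_squared_eq[of y] power2_eq_square[of w] by (simp add: field_simps)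
  ultimately show ?thesis by simp
qed

lemma AE_excess_speed_nonneg:
  fixes q \<phi> :: "real \<Rightarrow> real"
  assumes "w > 0" "AE x\<in>{A..B} in lebesgue. w\<^sup>2 \<le> q x"
  shows "AE x\<in>{A..B} in lebesgue. 0 \<le> (q x - w\<^sup>2) / w * (sin (\<phi> x))\<^sup>2"
  using assms(2) by eventually_elim (use assms(1) in simp)

lemma angle_solution_speed:
  assumes w: "w > 0" and \<phi>: "angle_solution w q A B \<phi>"
    and q: "AE x\<in>{A..B} in lebesgue. w\<^sup>2 \<le> q x" and xy: "A \<le> x" "x \<le> y" "y \<le> B"
  shows "\<phi> y - \<phi> x \<ge> w * (y - x)"
  using ac_deriv_nonneg_imp_mono[OF angle_minus_uniform_motion[OF w \<phi>] AE_excess_speed_nonneg[OF w q] xy]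
  by (simp add: algebra_simps)

text \<open>
  An angle of minimal increment is affine, so its sine vanishes only on a null set, and off this set the excess of the
  potential is zero.
\<close>

lemma angle_solution_minimal_rotation:
  assumes w: "w > 0" and AB: "A < B" and \<phi>: "angle_solution w q A B \<phi>"
    and q: "AE x\<in>{A..B} in lebesgue. w\<^sup>2 \<le> q x" and le: "\<phi> B - \<phi> A \<le> w * (B - A)"
  shows "AE x\<in>{A..B} in lebesgue. q x = w\<^sup>2"
proof -
  note D = angle_minus_uniform_motion[OF w \<phi>]
  have "\<phi> B - w * (B - 0) \<le> \<phi> A - w * (A - 0)" using le by (simp add: algebra_simps)
  note z = ac_deriv_nonneg_eq_imp_zero[OF D AE_excess_speed_nonneg[OF w q] AB this]
  define c where "c = \<phi> A - w * A"
  have lin: "\<phi> x = c + w * x" if "x \<in> {A..B}" for x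
    using ac_deriv_zero_imp_const[OF D z that] by (simp add: c_def algebra_simps)
  have "AE x in lebesgue. sin (c + w * x) \<noteq> 0"
    using w by (intro AE_sin_affine_nonzero) simp
  with z show ?thesis
  proof eventually_elim
    case (elim x)
    then show ?case using w lin[of x] by auto
  qed
qed

lemma angle_solution_constant_potential:
  assumes w: "w > 0" and \<phi>: "angle_solution w q A B \<phi>"
    and q: "AE x\<in>{A..B} in lebesgue. q x = w\<^sup>2" and AB: "A \<le> B"
  shows "\<phi> B - \<phi> A = w * (B - A)"
proof -
  have "AE x\<in>{A..B} in lebesgue. (q x - w\<^sup>2) / w * (sin (\<phi> x))\<^sup>2 = 0"
    using q by eventually_elim simp
  from ac_deriv_zero_imp_const[OF angle_minus_uniform_motion[OF w \<phi>] this, of B] AB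
  show ?thesis by (simp add: algebra_simps)
qed

text \<open>
  The cost of an interval: the mass of the potential above the constant \<open>w\<^sup>2\<close>.
\<close>

abbreviation excess :: "real \<Rightarrow> (real \<Rightarrow> real) \<Rightarrow> real \<Rightarrow> real \<Rightarrow> real" where
  "excess w q s t \<equiv> integral {s..t} (\<lambda>x. q x - w\<^sup>2)"

text \<open>The energy \<open>v\<^sup>2 + w\<^sup>2 u\<^sup>2\<close> is conserved.\<close>

lemma hill_stable_constant:
  assumes w: "w > 0" and a: "AE x in lebesgue. a x = w\<^sup>2"
  shows "hill_stable a 0"
  unfolding hill_stable_def
proof (intro allI impI)
  fix u v assume h: "hill_solution a 0 UNIV u v"
  have const: "(v x)\<^sup>2 + (w * u x)\<^sup>2 = (v (-R))\<^sup>2 + (w * u (-R))\<^sup>2" if "x \<in> {-R..R}" for x R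
  proof -
    have l: "ac_deriv (-R) R u v" "ac_deriv (-R) R v (\<lambda>x. - (0 + a x) * u x)"
      using hill_solution_imp_lin_solution[OF h, of "-R" R] by (auto simp: lin_solution_def)
    have "ac_deriv (-R) R (\<lambda>x. v x * v x + w\<^sup>2 * (u x * u x))
      (\<lambda>x. (- (0 + a x) * u x * v x + v x * (- (0 + a x) * u x)) + w\<^sup>2 * (v x * u x + u x * v x))"
      by (intro ac_deriv_add ac_deriv_cmult ac_deriv_mult l)
    moreover have "AE x\<in>{-R..R} in lebesgue.
       (- (0 + a x) * u x * v x + v x * (- (0 + a x) * u x)) + w\<^sup>2 * (v x * u x + u x * v x) = 0"
      using a by eventually_elim (simp add: algebra_simps)
    ultimately have "v x * v x + w\<^sup>2 * (u x * u x) = v (-R) * v (-R) + w\<^sup>2 * (u (-R) * u (-R))"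
      using that by (rule ac_deriv_zero_imp_const)
    then show ?thesis by (simp add: power2_eq_square algebra_simps)
  qed
  define E where "E = (v 0)\<^sup>2 + (w * u 0)\<^sup>2"
  have en: "(v x)\<^sup>2 + (w * u x)\<^sup>2 = E" for x
  proof -
    have "x \<in> {- \<bar>x\<bar>..\<bar>x\<bar>}" "0 \<in> {- \<bar>x\<bar>..\<bar>x\<bar>}" unfolding atLeastAtMost_iff by linarith+
    then show ?thesis using const unfolding E_def by metis
  qed
  have le: "(v x)\<^sup>2 \<le> E" "(w * u x)\<^sup>2 \<le> E" for x
    using en[of x] zero_le_power2[of "w * u x"] zero_le_power2[of "v x"] by linarith+
  have "\<bar>v x\<bar> \<le> sqrt E" for x
    using real_sqrt_le_mono[OF le(1)[of x]] by simp
  moreover have "\<bar>u x\<bar> \<le> sqrt E / w" for x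
  proof -
    have "\<bar>w * u x\<bar> \<le> sqrt E" using real_sqrt_le_mono[OF le(2)[of x]] by simp
    then show ?thesis using w by (simp add: abs_mult field_simps)
  qed
  ultimately show "bounded (range u) \<and> bounded (range v)"
    by (auto intro!: boundedI simp: real_norm_def)
qed

text \<open>
  Testing the equation against a solution \<open>c\<close> of \<open>c'' + w\<^sup>2 c = 0\<close>: the increment of the Wronskian of \<open>u\<close> and
  \<open>c\<close> is the integral of \<open>(q - w\<^sup>2) u c\<close>, which is at most \<open>U\<close> times that of \<open>q - w\<^sup>2\<close>.
\<close>

lemma excess_integral_bound:
  assumes st: "s < t" and q: "q absolutely_integrable_on {s..t}"
    and ge: "AE x\<in>{s..t} in lebesgue. w\<^sup>2 \<le> q x"
    and l: "lin_solution q s t u v"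
    and c: "lin_solution (\<lambda>_. w\<^sup>2) s t c d"
    and uc: "\<And>x. x \<in> {s..t} \<Longrightarrow> u x * c x \<le> U"
  shows "(u t * d t - v t * c t) - (u s * d s - v s * c s) \<le> U * excess w q s t"
    and "U * excess w q s t \<le> (u t * d t - v t * c t) - (u s * d s - v s * c s) \<Longrightarrow>
      AE x\<in>{s..t} in lebesgue. u x * c x < U \<longrightarrow> q x = w\<^sup>2"
proof -
  have qi: "(\<lambda>x. q x - w\<^sup>2) absolutely_integrable_on {s..t}"
    by (intro set_integral_diff q absolutely_integrable_const)
  define F where "F x = U * excess w q s x + (v x * c x - u x * d x)" for x
  have *: "ac_deriv s t u v" "ac_deriv s t v (\<lambda>x. - q x * u x)"
    "ac_deriv s t c d" "ac_deriv s t d (\<lambda>x. - w\<^sup>2 * c x)"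
    using l c by (auto simp: lin_solution_def)
  have "ac_deriv s t F (\<lambda>x. U * (q x - w\<^sup>2) + ((- q x * u x * c x + v x * d x) - (v x * d x + u x * (- w\<^sup>2 * c x))))"
    unfolding F_def by (intro ac_deriv_add ac_deriv_cmult ac_deriv_diff ac_deriv_mult ac_deriv_integral qi *)
  then have F: "ac_deriv s t F (\<lambda>x. (q x - w\<^sup>2) * (U - u x * c x))"
    by (rule ac_deriv_cong) (simp_all add: algebra_simps)
  have pos: "AE x\<in>{s..t} in lebesgue. 0 \<le> (q x - w\<^sup>2) * (U - u x * c x)"
    using ge by eventually_elim (use uc in auto)
  have "F s \<le> F t" by (rule ac_deriv_nonneg_imp_le[OF F _ pos]) (use st in auto)
  then show "(u t * d t - v t * c t) - (u s * d s - v s * c s) \<le> U * excess w q s t"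
    by (simp add: F_def)
  assume "U * excess w q s t \<le> (u t * d t - v t * c t) - (u s * d s - v s * c s)"
  then have "F t \<le> F s" by (simp add: F_def)
  from ac_deriv_nonneg_eq_imp_zero[OF F pos st this]
  show "AE x\<in>{s..t} in lebesgue. u x * c x < U \<longrightarrow> q x = w\<^sup>2"
    by eventually_elim auto
qed

lemma AE_lebesgue_neq: "AE x in lebesgue. x \<noteq> (c :: real)"
  unfolding eventually_ae_filter_negligible by (intro exI[of _ "{c}"]) auto

text \<open>
  The test functions for the excess integral.
\<close>

lemma lin_solution_sin_scaled:
  "lin_solution (\<lambda>_. w\<^sup>2) s t (\<lambda>x. C * sin (w * (x - b))) (\<lambda>x. C * (cos (w * (x - b)) * w))"
proof -
  have 1: "ac_deriv s t (\<lambda>x. C * sin (w * (x - b))) (\<lambda>x. C * (cos (w * (x - b)) * w))"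
    by (intro ac_deriv_cmult ac_deriv_sin ac_deriv_linear)
  have "ac_deriv s t (\<lambda>x. (C * w) * cos (w * (x - b))) (\<lambda>x. (C * w) * (- sin (w * (x - b)) * w))"
    by (intro ac_deriv_cmult ac_deriv_cos ac_deriv_linear)
  then have "ac_deriv s t (\<lambda>x. C * (cos (w * (x - b)) * w)) (\<lambda>x. - w\<^sup>2 * (C * sin (w * (x - b))))"
    by (rule ac_deriv_cong) (simp_all add: power2_eq_square)
  with 1 show ?thesis by (simp add: lin_solution_def)
qed

text \<open>
  In a quarter turn \<open>u\<close> is monotone between a zero and an extremum. The test function is the multiple of a sine
  that vanishes where \<open>u\<close> does and is 1 at the extremum.
\<close>

lemma quarter_turn_bound:
  assumes w: "w > 0" and st: "s < t" and q: "q absolutely_integrable_on {s..t}"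
    and ge: "AE x\<in>{s..t} in lebesgue. w\<^sup>2 \<le> q x"
    and \<phi>: "angle_solution w q s t \<phi>" and start: "\<phi> s = real_of_int j * (pi/2)" and final: "\<phi> t = \<phi> s + pi/2"
  shows "w * (t - s) \<le> pi/2"
    and "w * cot (w * (t - s)) \<le> excess w q s t"
    and "excess w q s t \<le> w * cot (w * (t - s)) \<Longrightarrow>
      AE x\<in>{s..t} in lebesgue. q x = w\<^sup>2"
proof -
  have quarter: "w * (t - s) \<le> pi/2"
    using angle_solution_speed[OF w \<phi> ge, of s t] st final by simp
  then show "w * (t - s) \<le> pi/2" .
  define y where "y = w * (t - s)"
  have y: "0 < y" "y \<le> pi/2" using w st quarter by (auto simp: y_def)
  have siny: "sin y > 0" using y pi_gt_zero by (intro sin_gt_zero) auto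
  obtain i where i: "j = 2 * i \<or> j = 2 * i + 1" by (metis oddE evenE)
  define \<psi> where "\<psi> x = \<phi> x + of_int (- i) * pi" for x
  have \<psi>: "angle_solution w q s t \<psi>" unfolding \<psi>_def by (rule angle_solution_shift[OF \<phi>])
  have \<psi>_st: "\<psi> s = 0 \<and> \<psi> t = pi/2 \<or> \<psi> s = pi/2 \<and> \<psi> t = pi"
    using i start final by (auto simp: \<psi>_def algebra_simps)
  have \<psi>_range: "\<psi> s \<le> \<psi> x" "\<psi> x \<le> \<psi> t" if "x \<in> {s..t}" for x
  proof -
    have "0 \<le> w * (x - s)" "0 \<le> w * (t - x)" using that w by auto
    then show "\<psi> s \<le> \<psi> x" "\<psi> x \<le> \<psi> t"
      using angle_solution_speed[OF w \<psi> ge, of s x] angle_solution_speed[OF w \<psi> ge, of x t] that by auto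
  qed
  \<comment> \<open>\<open>z\<close> is the zero and \<open>e\<close> the extremum of \<open>u\<close>; \<open>\<sigma>\<close> is the sign of \<open>u'\<close> in between.\<close>
  obtain \<sigma> z e :: real where ends: "\<sigma> = 1 \<and> z = s \<and> e = t \<or> \<sigma> = - 1 \<and> z = t \<and> e = s"
    and at_ends: "sin (\<psi> z) = 0" "sin (\<psi> e) = 1" "cos (\<psi> e) = 0"
    and range: "\<And>x. x \<in> {s..t} \<Longrightarrow> 0 \<le> \<psi> x \<and> \<psi> x \<le> pi \<and> 0 \<le> \<sigma> * cos (\<psi> x)"
    using \<psi>_st
  proof
    assume *: "\<psi> s = 0 \<and> \<psi> t = pi/2"
    have "0 \<le> \<psi> x \<and> \<psi> x \<le> pi \<and> 0 \<le> 1 * cos (\<psi> x)" if "x \<in> {s..t}" for x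
      using \<psi>_range[OF that] * cos_ge_zero[of "\<psi> x"] by auto
    moreover have "sin (\<psi> s) = 0" "sin (\<psi> t) = 1" "cos (\<psi> t) = 0"
      using * by (simp_all only: sin_zero sin_pi_half cos_pi_half)
    ultimately show ?thesis by (intro that[of 1 s t]) auto
  next
    assume *: "\<psi> s = pi/2 \<and> \<psi> t = pi"
    have "0 \<le> \<psi> x \<and> \<psi> x \<le> pi \<and> 0 \<le> - 1 * cos (\<psi> x)" if "x \<in> {s..t}" for x
      using \<psi>_range[OF that] * cos_ge_zero[of "pi - \<psi> x"] by auto
    moreover have "sin (\<psi> t) = 0" "sin (\<psi> s) = 1" "cos (\<psi> s) = 0"
      using * by (simp_all only: sin_pi sin_pi_half cos_pi_half)
    ultimately show ?thesis by (intro that[of "- 1" t s]) auto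
  qed
  define r where "r = amplitude w q s \<psi>"
  have r0: "r x > 0" for x by (simp add: r_def)
  define u where "u x = r x * sin (\<psi> x) / w" for x
  define v where "v x = r x * cos (\<psi> x)" for x
  have l: "lin_solution q s t u v"
    using angle_solution_imp_lin_solution[OF w q \<psi>] by (simp add: u_def[abs_def] v_def[abs_def] r_def)
  define U where "U = u e"
  have U: "U > 0" using at_ends r0[of e] w by (simp add: U_def u_def)
  have u0: "u x \<ge> 0" if "x \<in> {s..t}" for x
    unfolding u_def using range[OF that] r0[of x] w by (intro divide_nonneg_pos mult_nonneg_nonneg sin_ge_zero) auto
  have uU: "u x \<le> U" if "x \<in> {s..t}" for x
  proof -
    have D: "ac_deriv s t (\<lambda>x. \<sigma> * u x) (\<lambda>x. \<sigma> * v x)"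
      using l unfolding lin_solution_def by (intro ac_deriv_cmult) auto
    have "0 \<le> \<sigma> * v x" if "x \<in> {s..t}" for x
      using mult_nonneg_nonneg[OF less_imp_le[OF r0[of x]], of "\<sigma> * cos (\<psi> x)"] range[OF that] by (simp add: v_def mult_ac)
    then have "\<sigma> * u x' \<le> \<sigma> * u y'" if "s \<le> x'" "x' \<le> y'" "y' \<le> t" for x' y'
      using ac_deriv_nonneg_imp_mono[OF D _ that] by simp
    from this[of s x] this[of x t] show ?thesis using ends that by (auto simp: U_def)
  qed
  define c where "c x = (\<sigma> / sin y) * sin (w * (x - z))" for x
  define d where "d x = (\<sigma> / sin y) * (cos (w * (x - z)) * w)" for x
  have c: "lin_solution (\<lambda>_. w\<^sup>2) s t c d" unfolding c_def d_def by (rule lin_solution_sin_scaled)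
  have c_dist: "c x = sin (w * \<bar>x - z\<bar>) / sin y" if "x \<in> {s..t}" for x
  proof -
    have "sin (w * (z - x)) = - sin (w * (x - z))" by (metis minus_diff_eq mult_minus_right sin_minus)
    then show ?thesis using ends that by (auto simp: c_def abs_if)
  qed
  have dist: "0 \<le> w * \<bar>x - z\<bar>" "w * \<bar>x - z\<bar> \<le> y" "x \<noteq> e \<Longrightarrow> w * \<bar>x - z\<bar> < y" if "x \<in> {s..t}" for x
    using ends that w by (auto simp: y_def)
  have c_le: "c x \<le> 1" if x: "x \<in> {s..t}" for x
    using sin_monotone_2pi_le[OF _ dist(2)[OF x]] dist(1)[OF x] y siny by (simp add: c_dist[OF x])
  have c_less: "c x < 1" if x: "x \<in> {s..t}" "x \<noteq> e" for x
    using sin_monotone_2pi[OF _ dist(3)[OF x]] dist(1)[OF x(1)] y siny by (simp add: c_dist[OF x(1)])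
  have uc: "u x * c x \<le> U" if "x \<in> {s..t}" for x
    using mult_left_mono[OF c_le u0, OF that that] uU[OF that] by simp
  have uc': "u x * c x < U" if "x \<in> {s..t}" "x \<noteq> e" for x
  proof (cases "u x = 0")
    case False
    then have "u x * c x < u x * 1"
      using u0[OF that(1)] by (intro mult_strict_left_mono c_less that) simp
    then show ?thesis using uU[OF that(1)] by simp
  qed (use U in simp)
  have "c z = 0" "u z = 0" "v e = 0" using at_ends by (simp_all add: c_def u_def v_def)
  then have "(u t * d t - v t * c t) - (u s * d s - v s * c s) = U * (\<sigma> * d e)"
    using ends by (auto simp: U_def)
  also have "\<sigma> * d e = w * cot y"
    using ends cos_minus[of y] by (auto simp: d_def y_def cot_def algebra_simps)
  finally have bd: "(u t * d t - v t * c t) - (u s * d s - v s * c s) = U * (w * cot y)" .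
  note B = excess_integral_bound[OF st q ge l c uc, unfolded bd]
  show "w * cot (w * (t - s)) \<le> excess w q s t"
    using B(1) U by (simp add: y_def)
  assume "excess w q s t \<le> w * cot (w * (t - s))"
  then have "AE x\<in>{s..t} in lebesgue. u x * c x < U \<longrightarrow> q x = w\<^sup>2"
    using B(2) U by (simp add: y_def)
  with AE_lebesgue_neq[of e] show "AE x\<in>{s..t} in lebesgue. q x = w\<^sup>2"
    by eventually_elim (use uc' in auto)
qed

text \<open>
  By the mean value theorem, as the derivative \<open>- 1 / sin\<^sup>2\<close> increases up to \<open>\<pi>/2\<close>.
\<close>

lemma cot_above_tangent:
  assumes "0 < y" "y \<le> pi/2" "0 < c" "c \<le> pi/2"
  shows "cot y \<ge> cot c - (y - c) / (sin c)\<^sup>2"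
proof -
  have der: "(cot has_real_derivative - inverse ((sin z)\<^sup>2)) (at z)" if "0 < z" "z < pi" for z :: real
    using sin_gt_zero[OF that] by (intro DERIV_cot) simp
  have sc: "sin c > 0" "sin y > 0" using assms pi_gt_zero by (auto intro!: sin_gt_zero)
  show ?thesis
  proof (cases y c rule: linorder_cases)
    case less
    obtain z where z: "y < z" "z < c" "cot c - cot y = (c - y) * - inverse ((sin z)\<^sup>2)"
      using MVT2[OF less, of cot "\<lambda>z. - inverse ((sin z)\<^sup>2)"] der assms pi_gt_zero by fastforce
    have "0 < sin z" "sin z \<le> sin c"
      using z assms pi_gt_zero by (auto intro!: sin_gt_zero sin_monotone_2pi_le)
    then have "inverse ((sin c)\<^sup>2) \<le> inverse ((sin z)\<^sup>2)"
      by (intro le_imp_inverse_le power_mono) auto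
    then have "(c - y) * inverse ((sin c)\<^sup>2) \<le> (c - y) * inverse ((sin z)\<^sup>2)"
      using less by (intro mult_left_mono) auto
    then show ?thesis using z(3) by (simp add: divide_inverse algebra_simps)
  next
    case greater
    obtain z where z: "c < z" "z < y" "cot y - cot c = (y - c) * - inverse ((sin z)\<^sup>2)"
      using MVT2[OF greater, of cot "\<lambda>z. - inverse ((sin z)\<^sup>2)"] der assms pi_gt_zero by fastforce
    have "0 < sin c" "sin c \<le> sin z"
      using z sc assms pi_gt_zero by (auto intro!: sin_monotone_2pi_le)
    then have "inverse ((sin z)\<^sup>2) \<le> inverse ((sin c)\<^sup>2)"
      by (intro le_imp_inverse_le power_mono) auto
    then have "(y - c) * inverse ((sin z)\<^sup>2) \<le> (y - c) * inverse ((sin c)\<^sup>2)"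
      using greater by (intro mult_left_mono) auto
    then show ?thesis using z(3) by (simp add: divide_inverse algebra_simps)
  qed simp
qed

text \<open>
  Jensen's inequality for the cotangent; as the cotangent decreases, a bound on the sum of the
  arguments suffices.
\<close>

lemma sum_cot_ge:
  fixes y :: "nat \<Rightarrow> real"
  assumes "\<And>i. i < n \<Longrightarrow> 0 < y i \<and> y i \<le> pi/2" "(\<Sum>i<n. y i) \<le> real n * c" "0 < c" "c \<le> pi/2"
  shows "real n * cot c \<le> (\<Sum>i<n. cot (y i))"
proof -
  have "(\<Sum>i<n. cot c - (y i - c) / (sin c)\<^sup>2) \<le> (\<Sum>i<n. cot (y i))"
    using assms by (intro sum_mono cot_above_tangent) auto
  moreover have "(\<Sum>i<n. cot c - (y i - c) / (sin c)\<^sup>2) = real n * cot c - ((\<Sum>i<n. y i) - real n * c) / (sin c)\<^sup>2"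
    by (simp add: sum_subtractf sum_divide_distrib[symmetric])
  moreover have "((\<Sum>i<n. y i) - real n * c) / (sin c)\<^sup>2 \<le> 0"
    using assms(2) by (intro divide_nonpos_nonneg) auto
  ultimately show ?thesis by linarith
qed

lemma periodic_int_multiple:
  fixes a :: "real \<Rightarrow> real"
  assumes "\<And>x. a (x + T) = a x"
  shows "a (x + of_int n * T) = a x"
proof (induction n rule: int_induct[where k=0])
  case (step1 i)
  then show ?case using assms[of "x + of_int i * T"] by (simp add: algebra_simps)
next
  case (step2 i)
  then show ?case using assms[of "x + of_int (i - 1) * T"] by (simp add: algebra_simps)
qed simp

lemma periodic_AE_extend:
  fixes a :: "real \<Rightarrow> real"
  assumes T: "T > 0" and per: "\<And>x. a (x + T) = a x" and ae: "AE x\<in>{c..c + T} in lebesgue. P (a x)"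
  shows "AE x in lebesgue. P (a x)"
proof -
  have "AE x in lebesgue. \<forall>n::int. x + of_int n * T \<in> {c..c + T} \<longrightarrow> P (a (x + of_int n * T))"
    unfolding AE_all_countable using AE_lebesgue_translate[OF ae] by blast
  then show ?thesis
  proof eventually_elim
    case (elim x)
    define n where "n = - \<lfloor>(x - c) / T\<rfloor>"
    have "of_int \<lfloor>(x - c) / T\<rfloor> \<le> (x - c) / T" "(x - c) / T < of_int \<lfloor>(x - c) / T\<rfloor> + 1" by linarith+
    then have "of_int \<lfloor>(x - c) / T\<rfloor> * T \<le> x - c" "x - c < (of_int \<lfloor>(x - c) / T\<rfloor> + 1) * T"
      by (simp_all only: pos_le_divide_eq[OF T] pos_divide_less_eq[OF T])
    then have "x + of_int n * T \<in> {c..c + T}" by (auto simp: n_def algebra_simps)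
    then show ?case using elim periodic_int_multiple[of a T, OF per] by metis
  qed
qed

section \<open>The position of zero\<close>

context hill_rotation
begin

lemma pot_0: "pot 0 = a" by (simp add: pot_def)

text \<open>
  The hypothesis on \<open>rotmax\<close> says that at most \<open>p\<close> entries of the list lie at or below 0; it remains to show that
  entry \<open>p\<close> exists. As the count of eigenvalues does not depend on the angular scale, this may be done in the scale
  \<open>(p + 1) \<pi> / T\<close>: if the parameter lifts the potential to the square of the scale or above, every solution turns
  by \<open>(p + 1) \<pi>\<close> at least.
\<close>

lemma zone_right_pos:
  assumes lower: "AE x\<in>{0..T} in lebesgue. k \<le> a x" and less: "rotmax 0 < real (p + 1) * pi"
  shows "0 < zone_right T a p"
proof -
  define \<omega> where "\<omega> = real (p + 1) * pi / T"
  have \<omega>: "\<omega> > 0" "\<omega> * T = real (p + 1) * pi" using T_pos by (auto simp: \<omega>_def)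
  interpret O: hill_rotation T \<omega> a by unfold_locales (use T_pos \<omega> a_int in auto)
  define \<mu>1 where "\<mu>1 = \<omega>\<^sup>2 - k"
  have ge: "AE x\<in>{0..T} in lebesgue. \<omega>\<^sup>2 \<le> O.pot \<mu>1 x"
    using lower by eventually_elim (simp add: O.pot_def \<mu>1_def)
  have "O.rot \<mu>1 0 \<ge> \<omega> * T"
    using angle_solution_speed[OF \<omega>(1) O.ang(1) ge, of 0 T 0] T_pos by (simp add: O.rot_def O.endang_def O.ang)
  then have big: "real (p + 1) * pi \<le> O.rotmax \<mu>1" using O.rot_le_rotmax[of \<mu>1 0] \<omega> by simp
  then have "p \<in> O.entries_upto (p + 1) \<mu>1" by (simp add: O.entries_upto_def)
  then obtain \<mu> where \<mu>: "p \<in> O.entry_at (p + 1) \<mu>" using O.entry_at_exists by blast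
  then have eq: "zone_right T a p = \<mu>" by (intro O.zone_right_eq) (simp add: O.entry_at_def)
  have "{..p} \<subseteq> O.entries_upto (p + 1) \<mu>" using \<mu> O.entries_upto_downward O.entry_at_subset by blast
  then have "card {..p} \<le> card (O.entries_upto (p + 1) \<mu>)" by (rule card_mono[OF O.finite_entries_upto])
  also have "\<dots> = card (entries_upto (p + 1) \<mu>)"
    using O.eigenvalue_count[of "p + 1" \<mu>] eigenvalue_count[of "p + 1" \<mu>] by simp
  finally have many: "p < card (entries_upto (p + 1) \<mu>)" by simp
  show ?thesis
  proof (rule ccontr)
    assume "\<not> 0 < zone_right T a p"
    then have "\<mu> \<le> 0" using eq by simp
    have "entries_upto (p + 1) \<mu> \<subseteq> {..<p}"
    proof
      fix i assume "i \<in> entries_upto (p + 1) \<mu>"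
      then obtain \<nu> where "\<nu> \<le> \<mu>" "i \<in> entry_at (p + 1) \<nu>" using entry_at_exists by blast
      then have "i \<in> entries_upto (p + 1) 0" using entry_at_upto_mono \<open>\<mu> \<le> 0\<close> by (meson order_trans)
      moreover have "p \<notin> entries_upto (p + 1) 0" using less by (simp add: entries_upto_def)
      ultimately show "i \<in> {..<p}" using entries_upto_downward by (meson lessThan_iff linorder_not_less)
    qed
    then have "card (entries_upto (p + 1) \<mu>) \<le> card {..<p}" by (intro card_mono) auto
    then show False using many by simp
  qed
qed

end

locale hill_rotation_periodic = hill_rotation +
  assumes periodic: "\<And>x. a (x + T) = a x"
    and lower: "AE x in lebesgue. w\<^sup>2 \<le> a x"
begin

lemma lower_on: "AE x\<in>{c..d} in lebesgue. w\<^sup>2 \<le> a x"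
  using lower by eventually_elim simp

lemma rot_ge_speed: "w * T \<le> rot 0 \<alpha>"
  using angle_solution_speed[OF w_pos ang(1)[of 0 \<alpha>, unfolded pot_0] lower_on, of 0 T] T_pos
  by (simp add: rot_def endang_def ang)

lemma rot_constant_potential:
  assumes "AE x in lebesgue. a x = w\<^sup>2"
  shows "rot 0 \<alpha> = w * T"
proof -
  have "AE x\<in>{0..T} in lebesgue. a x = w\<^sup>2" using assms by eventually_elim simp
  from angle_solution_constant_potential[OF w_pos ang(1)[of 0 \<alpha>, unfolded pot_0] this] T_pos
  show ?thesis by (simp add: rot_def endang_def ang)
qed

lemma constant_if_minimal_rotation:
  assumes "rotmin 0 \<le> w * T"
  shows "AE x in lebesgue. a x = w\<^sup>2"
proof -
  obtain \<alpha> where "rot 0 \<alpha> = rotmin 0" by (rule rotmin_attained)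
  then have "ang 0 \<alpha> T - ang 0 \<alpha> 0 \<le> w * (T - 0)" using assms by (simp add: rot_def endang_def ang)
  then have "AE x\<in>{0..T} in lebesgue. a x = w\<^sup>2"
    by (rule angle_solution_minimal_rotation[OF w_pos T_pos ang(1)[of 0 \<alpha>, unfolded pot_0] lower_on])
  then show ?thesis using periodic_AE_extend[of T a 0 "\<lambda>y. y = w\<^sup>2"] T_pos periodic by simp
qed

lemma a_int_two_periods: "a absolutely_integrable_on {0..2 * T}"
proof -
  have "(\<lambda>x. a (x + - T)) absolutely_integrable_on {T..2 * T}"
    using absolutely_integrable_translate(1)[where f=a and A=T and B="2 * T" and c="- T"] a_int by simp
  moreover have "a (x + - T) = a x" for x using periodic[of "x - T"] by simp
  ultimately have "a absolutely_integrable_on {T..2 * T}" by simp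
  from absolutely_integrable_Un[OF a_int this] show ?thesis
    using T_pos by (simp add: ivl_disj_un_two_touch)
qed

lemma excess_integral_period:
  assumes "x0 \<in> {0..T}"
  shows "excess w a x0 (x0 + T) = excess w a 0 T"
proof -
  let ?b = "\<lambda>x. a x - w\<^sup>2"
  have b: "?b absolutely_integrable_on {0..2 * T}"
    by (intro set_integral_diff a_int_two_periods absolutely_integrable_const)
  then have bi: "?b integrable_on {0..2 * T}" by (simp add: absolutely_integrable_on_def)
  have sub: "?b integrable_on {c..d}" if "0 \<le> c" "d \<le> 2 * T" for c d
    using bi by (rule integrable_on_subinterval) (use that in auto)
  have "integral {0..x0} ?b = integral {0..x0} (\<lambda>x. ?b (x + T))" by (simp add: periodic)
  also have "\<dots> = integral {0 + T..x0 + T} ?b"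
    by (rule absolutely_integrable_translate(2), rule absolutely_integrable_on_subinterval[OF b]) (use assms in auto)
  finally have 1: "integral {0..x0} ?b = integral {T..x0 + T} ?b" by simp
  have "integral {0..x0} ?b + integral {x0..x0 + T} ?b = integral {0..x0 + T} ?b"
    "integral {0..T} ?b + integral {T..x0 + T} ?b = integral {0..x0 + T} ?b"
    using assms T_pos by (auto intro!: Henstock_Kurzweil_Integration.integral_combine sub)
  with 1 show ?thesis by simp
qed

text \<open>
  If some solution turns by \<open>(p + 1) \<pi>\<close> over a period, then so does one that starts at one of its zeros, because
  angles keep their order and the equation is periodic.
\<close>

lemma full_turns_from_zero:
  assumes big: "real n * pi \<le> rotmax 0" and n: "n \<ge> 1"
  obtains \<phi> x0 j where "angle_solution w a 0 (2 * T) \<phi>" "x0 \<in> {0..T}" "\<phi> x0 = real_of_int j * pi"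
    "\<phi> x0 + real n * pi \<le> \<phi> (x0 + T)"
proof -
  obtain \<alpha> where \<alpha>: "rot 0 \<alpha> = rotmax 0" by (rule rotmax_attained)
  have "0 \<le> 2 * T" using T_pos by simp
  then obtain \<phi> where \<phi>: "angle_solution w a 0 (2 * T) \<phi>" "\<phi> 0 = \<alpha>"
    by (rule angle_solution_exists[OF w_pos a_int_two_periods])
  have \<phi>T: "angle_solution w a 0 T \<phi>"
    using \<phi>(1) T_pos unfolding angle_solution_def by (auto intro: ac_deriv_subinterval)
  have turned: "\<phi> T \<ge> \<alpha> + real n * pi"
    using endang_eq[of 0 \<phi>] \<phi>T \<phi>(2) \<alpha> big by (simp add: pot_0 rot_def)
  define j where "j = \<lceil>\<alpha> / pi\<rceil>"
  have "\<alpha> / pi \<le> of_int j" "of_int j < \<alpha> / pi + 1" unfolding j_def by linarith+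
  then have j: "\<alpha> \<le> of_int j * pi" "of_int j * pi \<le> \<alpha> + 1 * pi" by (simp_all add: field_simps)
  have "1 * pi \<le> real n * pi" using n by (intro mult_right_mono) auto
  then have jT: "of_int j * pi \<le> \<phi> T" using j turned by linarith
  have "continuous_on {0..T} \<phi>" using ac_deriv_continuous \<phi>T unfolding angle_solution_def by blast
  then obtain x0 where x0: "0 \<le> x0" "x0 \<le> T" "\<phi> x0 = of_int j * pi"
    using IVT'[of \<phi> 0 "of_int j * pi" T] j jT \<phi>(2) T_pos by auto
  have "angle_solution w a (0 + T) (T + T) \<phi>"
    using \<phi>(1) T_pos unfolding angle_solution_def by (auto intro: ac_deriv_subinterval)
  moreover from this have "(\<lambda>x. angle_rhs w a x (\<phi> x)) absolutely_integrable_on {0 + T..T + T}"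
    unfolding angle_solution_def
    by (intro angle_rhs_integrable[OF w_pos] absolutely_integrable_on_subinterval[OF a_int_two_periods] ac_deriv_continuous)
      (use T_pos in auto)
  ultimately have "ac_deriv 0 T (\<lambda>x. \<phi> (x + T)) (\<lambda>x. angle_rhs w a (x + T) (\<phi> (x + T)))"
    unfolding angle_solution_def by (rule ac_deriv_translate)
  then have next_period: "angle_solution w a 0 T (\<lambda>x. \<phi> (x + T))"
    by (simp add: angle_solution_def angle_rhs_def periodic)
  have "\<phi> x0 + of_int (int n) * pi \<le> \<phi> (x0 + T)"
    by (rule angle_solution_compare(1)[OF w_pos a_int angle_solution_shift[OF \<phi>T] next_period])
      (use turned \<phi>(2) x0 in auto)
  then show thesis using that[OF \<phi>(1), of x0 j] x0 by simp
qed

text \<open>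
  The cost of the quarter turns, at least \<open>2 n w cot (w T / (2 n))\<close> by \<open>sum_cot_ge\<close>, exhausts the excess
  that the norm allows. So each quarter turn is in the equality case of \<open>quarter_turn_bound\<close>, where the
  potential is constant.
\<close>

lemma constant_if_maximal_rotation:
  assumes wT: "w * T \<le> real n * pi" and n: "n \<ge> 1" and big: "real n * pi \<le> rotmax 0"
    and norm: "excess w a 0 T \<le> 2 * real n * w * cot (w * T / (2 * real n))"
  shows "AE x in lebesgue. a x = w\<^sup>2"
proof -
  obtain \<phi> x0 j where \<phi>: "angle_solution w a 0 (2 * T) \<phi>" and x0: "x0 \<in> {0..T}" and zero: "\<phi> x0 = real_of_int j * pi"
    and turns: "\<phi> x0 + real n * pi \<le> \<phi> (x0 + T)"
    by (rule full_turns_from_zero[OF big n])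
  let ?b = "\<lambda>x. a x - w\<^sup>2"
  define N where "N = 2 * n"
  have N0: "N > 0" using n by (simp add: N_def)
  have speed: "w * (y - x) \<le> \<phi> y - \<phi> x" if "0 \<le> x" "x \<le> y" "y \<le> 2 * T" for x y
    using angle_solution_speed[OF w_pos \<phi> lower_on that] .
  have \<phi>_cont: "continuous_on {x0..x0 + T} \<phi>"
    using ac_deriv_continuous[OF \<phi>[unfolded angle_solution_def]] by (rule continuous_on_subset) (use x0 in auto)
  have "\<exists>x. x0 \<le> x \<and> x \<le> x0 + T \<and> \<phi> x = \<phi> x0 + real i * (pi/2)" if "i \<le> N" for i
  proof -
    have "real i * (pi/2) \<le> real N * (pi/2)" using that by (intro mult_right_mono) auto
    also have "\<dots> = real n * pi" by (simp add: N_def)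
    finally have "\<phi> x0 + real i * (pi/2) \<le> \<phi> (x0 + T)" using turns by linarith
    then show ?thesis using T_pos \<phi>_cont by (intro IVT') auto
  qed
  then have "\<forall>i. \<exists>x. i \<le> N \<longrightarrow> x0 \<le> x \<and> x \<le> x0 + T \<and> \<phi> x = \<phi> x0 + real i * (pi/2)" by blast
  then obtain t where t: "\<And>i. i \<le> N \<Longrightarrow> x0 \<le> t i \<and> t i \<le> x0 + T \<and> \<phi> (t i) = \<phi> x0 + real i * (pi/2)"
    by metis
  have t_less: "t i < t (Suc i)" if "i < N" for i
  proof (rule ccontr)
    assume "\<not> t i < t (Suc i)"
    then have le: "t (Suc i) \<le> t i" by simp
    have "0 \<le> w * (t i - t (Suc i))" using le w_pos by simp
    also have "\<dots> \<le> \<phi> (t i) - \<phi> (t (Suc i))"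
      using le t[of i] t[of "Suc i"] that x0 by (intro speed) auto
    finally show False using t[of i] t[of "Suc i"] that pi_gt_zero by (simp add: field_simps)
  qed
  have t0: "t 0 = x0"
  proof (rule ccontr)
    assume "t 0 \<noteq> x0"
    then have "0 < w * (t 0 - x0)" using t[of 0] w_pos by simp
    also have "\<dots> \<le> \<phi> (t 0) - \<phi> x0" using t[of 0] x0 by (intro speed) auto
    finally show False using t[of 0] by simp
  qed
  have t_le: "t i \<le> t N" if "i \<le> N" for i
    using that
  proof (induction rule: inc_induct)
    case (step m)
    then show ?case using t_less[of m] by simp
  qed simp
  have b: "?b absolutely_integrable_on {0..2 * T}"
    by (intro set_integral_diff a_int_two_periods absolutely_integrable_const)
  then have bi: "?b integrable_on {c..d}" if "0 \<le> c" "d \<le> 2 * T" for c d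
    using integrable_on_subinterval[of ?b "{0..2 * T}" c d] that by (auto simp: absolutely_integrable_on_def)
  define I where "I i = excess w a (t i) (t (Suc i))" for i
  define y where "y i = w * (t (Suc i) - t i)" for i
  have quarter: "y i \<le> pi/2 \<and> w * cot (y i) \<le> I i \<and>
      (I i \<le> w * cot (y i) \<longrightarrow> (AE x\<in>{t i..t (Suc i)} in lebesgue. a x = w\<^sup>2))" if "i < N" for i
  proof -
    have ti: "0 \<le> t i" "t (Suc i) \<le> 2 * T" using t[of i] t[of "Suc i"] that x0 by auto
    have 1: "a absolutely_integrable_on {t i..t (Suc i)}"
      by (rule absolutely_integrable_on_subinterval[OF a_int_two_periods]) (use ti in auto)
    have 2: "angle_solution w a (t i) (t (Suc i)) \<phi>"
      using \<phi> ti unfolding angle_solution_def by (auto intro: ac_deriv_subinterval)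
    have 3: "\<phi> (t i) = real_of_int (2 * j + int i) * (pi/2)"
      using t[of i] that zero by (simp add: algebra_simps)
    have 4: "\<phi> (t (Suc i)) = \<phi> (t i) + pi/2"
      using t[of i] t[of "Suc i"] that by (simp add: algebra_simps)
    note Q = quarter_turn_bound[OF w_pos t_less[OF that] 1 lower_on 2 3 4]
    show ?thesis using Q unfolding I_def y_def by blast
  qed
  have y_pos: "y i > 0" if "i < N" for i using t_less[OF that] w_pos by (simp add: y_def)
  have sum_I: "(\<Sum>i<m. I i) = excess w a x0 (t m)" if "m \<le> N" for m
    using that
  proof (induction m)
    case (Suc m)
    have "excess w a x0 (t m) + excess w a (t m) (t (Suc m)) = excess w a x0 (t (Suc m))"
      using t[of m] t[of "Suc m"] t_less[of m] Suc.prems x0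
      by (intro Henstock_Kurzweil_Integration.integral_combine bi) auto
    then show ?case using Suc by (simp add: I_def)
  qed (simp add: t0)
  have sum_y: "(\<Sum>i<N. y i) = w * (t N - x0)"
    using sum_lessThan_telescope[of t N] t0 by (simp add: y_def sum_distrib_left[symmetric])
  define c where "c = w * T / (2 * real n)"
  have c: "0 < c" "c \<le> pi/2" using w_pos T_pos n wT by (auto simp: c_def field_simps)
  have "w * (t N - x0) \<le> w * T" using t[of N] w_pos by (intro mult_left_mono) auto
  then have sum_y_le: "(\<Sum>i<N. y i) \<le> real N * c" using sum_y n by (simp add: N_def c_def)
  have "excess w a x0 (t N) \<le> excess w a x0 (x0 + T)"
  proof -
    have "excess w a x0 (t N) + excess w a (t N) (x0 + T) = excess w a x0 (x0 + T)"
      using t[of N] x0 by (intro Henstock_Kurzweil_Integration.integral_combine bi) auto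
    moreover have "0 \<le> excess w a (t N) (x0 + T)"
    proof -
      have D: "ac_deriv (t N) (x0 + T) (\<lambda>x. excess w a (t N) x) ?b"
        by (intro ac_deriv_integral absolutely_integrable_on_subinterval[OF b]) (use t[of N] x0 in auto)
      have "AE x\<in>{t N..x0 + T} in lebesgue. 0 \<le> ?b x" using lower by eventually_elim simp
      from ac_deriv_nonneg_imp_le[OF D _ this] t[of N] show ?thesis by simp
    qed
    ultimately show ?thesis by simp
  qed
  also have "\<dots> \<le> w * (real N * cot c)"
    using excess_integral_period[OF x0] norm by (simp add: N_def c_def mult_ac)
  also have "\<dots> \<le> w * (\<Sum>i<N. cot (y i))"
    using w_pos y_pos quarter sum_y_le c by (intro mult_left_mono sum_cot_ge) auto
  finally have "(\<Sum>i<N. I i) \<le> (\<Sum>i<N. w * cot (y i))"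
    by (simp add: sum_I sum_distrib_left)
  then have "(\<Sum>i<N. I i - w * cot (y i)) = 0"
    using quarter by (intro antisym sum_nonneg) (auto simp: sum_subtractf)
  then have eq: "I i = w * cot (y i)" if "i < N" for i
    using sum_nonneg_eq_0_iff[of "{..<N}" "\<lambda>i. I i - w * cot (y i)"] quarter that by auto
  have const: "AE x\<in>{x0..t m} in lebesgue. a x = w\<^sup>2" if "m \<le> N" for m
    using that
  proof (induction m)
    case 0
    show ?case using AE_lebesgue_neq[of x0] by eventually_elim (simp add: t0)
  next
    case (Suc m)
    then have "AE x\<in>{x0..t m} in lebesgue. a x = w\<^sup>2" by simp
    moreover have "AE x\<in>{t m..t (Suc m)} in lebesgue. a x = w\<^sup>2"
      using quarter[of m] eq[of m] Suc.prems by simp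
    ultimately show ?case by eventually_elim auto
  qed
  \<comment> \<open>On this set the angle moves with speed \<open>w\<close>, so the turns use up the whole period.\<close>
  have "angle_solution w a x0 (t N) \<phi>"
    using \<phi> t[of N] x0 unfolding angle_solution_def by (auto intro: ac_deriv_subinterval)
  from angle_solution_constant_potential[OF w_pos this const[OF order_refl]]
  have "\<phi> (t N) - \<phi> x0 = w * (t N - x0)" using t[of N] by simp
  then have "w * T \<le> w * (t N - x0)" using t[of N] wT by (simp add: N_def)
  then have "x0 + T \<le> t N" using w_pos by simp
  then have "AE x\<in>{x0..x0 + T} in lebesgue. a x = w\<^sup>2"
    using const[of N] by (auto elim!: eventually_mono)
  then show ?thesis using periodic_AE_extend[of T a x0 "\<lambda>y. y = w\<^sup>2"] T_pos periodic by simp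
qed

text \<open>
  If \<open>rotmin 0 = p \<pi>\<close> or \<open>rotmax 0 \<ge> (p + 1) \<pi>\<close>, the potential is constant, so that \<open>0\<close> is an endpoint and the equation
  is stable there.
\<close>

lemma zero_in_stability_zone:
  assumes wT: "real p * pi \<le> w * T" "w * T \<le> real (p + 1) * pi"
    and norm: "excess w a 0 T \<le> 2 * real (p + 1) * w * cot (w * T / (2 * real (p + 1)))"
  shows "0 \<in> stability_zone T a p"
proof -
  obtain \<alpha> where \<alpha>: "rot 0 \<alpha> = rotmin 0" by (rule rotmin_attained)
  have min_ge: "w * T \<le> rotmin 0" using rot_ge_speed[of \<alpha>] \<alpha> by simp
  have left: "zone_left T a p < 0 \<or> zone_left T a p = 0 \<and> hill_stable a 0"
  proof (cases "rotmin 0 = real p * pi")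
    case True
    then have "AE x in lebesgue. a x = w\<^sup>2" using wT by (intro constant_if_minimal_rotation) simp
    then show ?thesis using zone_left_eq[OF True] hill_stable_constant[OF w_pos] by blast
  next
    case False
    then have "p \<in> entries_upto p 0" using min_ge wT by (simp add: entries_upto_def)
    then obtain \<mu> where \<mu>: "\<mu> \<le> 0" "p \<in> entry_at p \<mu>" using entry_at_exists by blast
    then have eq: "rotmin \<mu> = real p * pi" by (simp add: entry_at_def)
    then have "\<mu> \<noteq> 0" using False by auto
    then show ?thesis using zone_left_eq[OF eq] \<mu> by simp
  qed
  have right: "0 < zone_right T a p \<or> zone_right T a p = 0 \<and> hill_stable a 0"
  proof (cases "rotmax 0 < real (p + 1) * pi")
    case True
    then show ?thesis using zone_right_pos[OF lower_on] by blast
  next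
    case False
    then have const: "AE x in lebesgue. a x = w\<^sup>2"
      using wT norm by (intro constant_if_maximal_rotation[of "p + 1"]) auto
    obtain \<beta> where "rot 0 \<beta> = rotmax 0" by (rule rotmax_attained)
    then have "rotmax 0 = real (p + 1) * pi" using rot_constant_potential[OF const, of \<beta>] wT False by simp
    then show ?thesis using zone_right_eq hill_stable_constant[OF w_pos const] by blast
  qed
  from left right show ?thesis by (auto simp: stability_zone_def)
qed

end

theorem theorem4p1:
  fixes T :: real and a :: "real \<Rightarrow> real" and p :: nat and k :: real
  assumes "T > 0"
    and "a \<in> L_per T"
    and "p \<ge> 1"
    and "k \<in> {(real p)\<^sup>2 * pi\<^sup>2 / T\<^sup>2 .. (real (p + 1))\<^sup>2 * pi\<^sup>2 / T\<^sup>2}"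
    and "AE x in lebesgue. k \<le> a x"
    and "L1_norm T a \<le> k * T + 2 * real (p + 1) * sqrt k * cot (sqrt k * T / (2 * real (p + 1)))"
  shows "0 \<in> stability_zone T a p"
proof -
  define w where "w = sqrt k"
  have sq: "(real m)\<^sup>2 * pi\<^sup>2 / T\<^sup>2 = (real m * pi / T)\<^sup>2" for m by (simp add: power_mult_distrib power_divide)
  have "0 < (real p * pi / T)\<^sup>2" using assms(1,3) by simp
  also have "\<dots> \<le> k" using assms(4) by (simp only: sq atLeastAtMost_iff)
  finally have k0: "k > 0" .
  then have w: "w > 0" "w\<^sup>2 = k" by (auto simp: w_def)
  have "real p * pi / T \<le> w" "w \<le> real (p + 1) * pi / T"
    using assms(1,4) unfolding sq w_def by (auto intro!: real_le_rsqrt real_le_lsqrt)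
  then have wT: "real p * pi \<le> w * T" "w * T \<le> real (p + 1) * pi"
    using assms(1) by (simp_all add: field_simps)
  have int: "a absolutely_integrable_on {0..T}"
    using assms(2) absolutely_integrable_on_open_interval[of 0 T a] by (simp add: L_per_def)
  have per: "a (x + T) = a x" for x using assms(2) by (simp add: L_per_def)
  interpret hill_rotation_periodic T w a
    by unfold_locales (use assms(1,5) w int per in auto)
  have "L1_norm T a = integral {0<..<T} (\<lambda>x. \<bar>a x\<bar>)"
    unfolding L1_norm_def
  proof (rule set_lebesgue_integral_eq_integral(2))
    have "a absolutely_integrable_on {0<..<T}" using assms(2) by (simp add: L_per_def)
    then show "(\<lambda>x. \<bar>a x\<bar>) absolutely_integrable_on {0<..<T}" by (rule set_integrable_abs)
  qed
  also have "\<dots> = integral {0..T} (\<lambda>x. \<bar>a x\<bar>)"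
    using integral_open_interval[of 0 T "\<lambda>x. \<bar>a x\<bar>"] by (simp only: box_real)
  also have "\<dots> = integral {0..T} a"
  proof -
    have "AE x in lebesgue. a x = \<bar>a x\<bar>" using assms(5) by eventually_elim (use k0 in auto)
    then obtain N where "negligible N" "{x. \<not> a x = \<bar>a x\<bar>} \<subseteq> N"
      unfolding eventually_ae_filter_negligible by auto
    then show ?thesis by (intro integral_spike[of N]) auto
  qed
  finally have "excess w a 0 T = L1_norm T a - k * T"
    using int assms(1) w Henstock_Kurzweil_Integration.integral_diff[of a "{0..T}" "\<lambda>_. w\<^sup>2"]
    by (simp add: absolutely_integrable_on_def integrable_const_ivl mult.commute)
  then have "excess w a 0 T \<le> 2 * real (p + 1) * w * cot (w * T / (2 * real (p + 1)))"
    using assms(6) by (simp add: w_def)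
  then show ?thesis by (rule zero_in_stability_zone[OF wT])
qed

end
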